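(* Given any $(\mu,N,K)$ SC-PIR system with $M=\mu N\in[2:N]$ an integer, the optimal (minimum) equal-size sub-packetization of all capacity-achieving linear SF-SC-PIR schemes is given by $\frac{N(M-1)}{\gcd(N,M)}$.
   Context: Notation: $[a:b]=\{a,a+1,\dots,b\}$; entropies are in base $q$, where $q$ is a prime power; $A_{1:N}=(A_1,\dots,A_N)$. A scheme for the $(\mu,N,K)$ SC-PIR (storage constrained private information retrieval) system, with $N$ servers, $K$ files and normalized storage capacity $\mu\in[1/N,1]$, consists of the following. Files: $W_1,\dots,W_K\in\mathbb F_q^{L}$ are independent, each made of $L$ i.i.d. uniform symbols (the file size $L$ may be arbitrarily large). Storage: each file $W_k$ is partitioned into $F$ disjoint packets $W_{k,1},\dots,W_{k,F}$, with $H(W_{k,i})$ not depending on $k$; $F$ is the sub-packetization. Server $n\in[1:N]$ stores $Z_n=\{W_{k,i}:k\in[1:K],i\in\mathcal Z_n\}$ for some $\mathcal Z_n\subseteq[1:F]$; every packet is stored at at least one server, and $H(Z_n)\le\mu KL$ for all $n$. Retrieval: for each desired index $\theta\in[1:K]$ there are random queries $Q_{1:N}^{[\theta]}$ and answers $A_{1:N}^{[\theta]}$ with $I(Q_{1:N}^{[\theta]};W_{1:K})=0$; $H(A_n^{[\theta]}|Q_n^{[\theta]},Z_n)=0$ for all $n$; decodability $H(W_\theta|A_{1:N}^{[\theta]},Q_{1:N}^{[\theta]})=0$; and privacy: for every $n$, the distribution of $(Q_n^{[\theta]},A_n^{[\theta]},Z_n)$ does not depend on $\theta$. The retrieval rate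 is $R=L/D$, where $D=\sum_{n=1}^N H(A_n^{[\theta]})$ is the average download cost from the $N$ servers over random queries. The capacity $C^*$ is the supremum of achievable rates; for $M=\mu N\in[1:N]$ an integer it is known that $C^*=\left(1+\frac1M+\dots+\frac1{M^{K-1}}\right)^{-1}$. A scheme is capacity-achieving if its rate equals $C^*$. An $(M,K)$ SF-PIR (storage full) scheme is a scheme for the $(1,M,K)$ SC-PIR system, i.e. $M$ servers each storing all $K$ files. The scheme is linear if each answer has the form $A_n^{[\theta]}=(\mathbf{LC}_{n,1}^{[\theta]}(Z_n),\dots,\mathbf{LC}_{n,\ell_n}^{[\theta]}(Z_n))$ with $\mathbf{LC}_{n,j}^{[\theta]}(Z_n)=\sum_{k\in[1:K]}\sum_{i\in\mathcal Z_n}\beta_{n,k,i,j}^{[\theta]}W_{k,i}$, where $\ell_n$ is the answer length of the query $Q_n^{[\theta]}$ and the coefficients $\beta_{n,k,i,j}^{[\theta]}\in\mathbb F_q$ are determined completely by $Q_n^{[\theta]}$. Packets are represented by vectors over $\mathbb F_q$; packets of different dimensions are added after zero-padding to the largest dimension. SF-SC-PIR schemes. Take a family $\{\alpha_{\mathcal S}\}_{\mathcal S\subseteq[1:N],|\mathcal S|=M}$ with $0\le\alpha_{\mathcal S}\le1$ and $\sum_{|\mathcal S|=M,\,n\in\mathcal S}\alpha_{\mathcal S}=\mu$ for all $n\in[1:N]$, and a capacity-achieving $(M,K)$ SF-PIR scheme with sub-packetization $F_{\mathrm{SF}}$. The resulting SF-SC-PIR scheme is: divide each $W_k$ into parts $W_{k,\mathcal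 S}$ with $H(W_{k,\mathcal S})=\alpha_{\mathcal S}L$, one for each $\mathcal S$ with $|\mathcal S|=M$ and $\alpha_{\mathcal S}>0$; divide each $W_{k,\mathcal S}$ into $F_{\mathrm{SF}}$ disjoint packets; server $n$ stores all $W_{k,\mathcal S}$ with $n\in\mathcal S$; to retrieve $W_\theta$, for each $\mathcal S$ with $\alpha_{\mathcal S}>0$ employ the SF-PIR scheme independently to retrieve $W_{\theta,\mathcal S}$ privately from the $M$ servers in $\mathcal S$ and the $K$ packet sets $\{W_{k,\mathcal S}:k\in[1:K]\}$, and combine the $W_{\theta,\mathcal S}$ to recover $W_\theta$. It is linear if the SF-PIR scheme is linear. The sub-packetization of a scheme is called an equal-size sub-packetization if all packets have equal size: $H(W_{k,1})=\dots=H(W_{k,F})=L/F$ for all $k\in[1:K]$.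
   Formalization: The download cost is taken as the sum of H(A_n|Q_n) (average over queries) instead of H(A_n), since with H(A_n) the claim fails for all K≥2; and K≥2 is assumed, since for K=1 and M≥3 directly downloading the single file beats the claimed minimum. *)

theory Defs
  imports "HOL-Probability.Probability" "HOL-Library.More_List"
begin

section \<open>Storage constrained private information retrieval\<close>

text \<open>
  The finite field is a type \<open>'f\<close> of classes field and finite, so \<open>q = CARD('f)\<close>. A file is a list
  over \<open>'f\<close> of length \<open>file_len\<close>. The packets of a file are labelled by the set \<open>packets\<close> (so the
  sub-packetization is its cardinality), and the packet of file \<open>k\<close> labelled \<open>i\<close> consists of the
  symbols of the file at the positions \<open>packet_pos k i\<close>. The index \<open>\<theta>\<close> of the desired file is the first
  argument of \<open>query\<close> and \<open>answer\<close>, the server is the second one.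
\<close>

record ('w, 'f, 'i, 'q, 'a) pir =
  sample :: "'w measure"
  file_len :: nat
  file_var :: "nat \<Rightarrow> 'w \<Rightarrow> 'f list"
  packets :: "'i set"
  packet_pos :: "nat \<Rightarrow> 'i \<Rightarrow> nat set"
  stored :: "nat \<Rightarrow> 'i set"
  query :: "nat \<Rightarrow> nat \<Rightarrow> 'w \<Rightarrow> 'q"
  answer :: "nat \<Rightarrow> nat \<Rightarrow> 'w \<Rightarrow> 'a"

text \<open>
  Base-\<open>q\<close> entropy, conditional entropy and mutual information of finitely valued random variables;
  these are the library's \<open>\<H>(X)\<close>, \<open>\<H>(X | Y)\<close> and \<open>\<I>(X ; Y)\<close> outside of the locale
  \<open>information_space\<close>.
\<close>

definition ent :: "('w, 'f::finite, 'i, 'q, 'a) pir \<Rightarrow> ('w \<Rightarrow> 'x) \<Rightarrow> real" where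
  "ent s X = prob_space.entropy (sample s) (real CARD('f)) (count_space (X ` space (sample s))) X"

definition cond_ent ::
  "('w, 'f::finite, 'i, 'q, 'a) pir \<Rightarrow> ('w \<Rightarrow> 'x) \<Rightarrow> ('w \<Rightarrow> 'y) \<Rightarrow> real" where
  "cond_ent s X Y = prob_space.conditional_entropy (sample s) (real CARD('f))
     (count_space (X ` space (sample s))) (count_space (Y ` space (sample s))) X Y"

definition mut_inf ::
  "('w, 'f::finite, 'i, 'q, 'a) pir \<Rightarrow> ('w \<Rightarrow> 'x) \<Rightarrow> ('w \<Rightarrow> 'y) \<Rightarrow> real" where
  "mut_inf s X Y = prob_space.mutual_information (sample s) (real CARD('f))
     (count_space (X ` space (sample s))) (count_space (Y ` space (sample s))) X Y"

definition packet :: "('w, 'f, 'i, 'q, 'a) pir \<Rightarrow> nat \<Rightarrow> 'i \<Rightarrow> 'w \<Rightarrow> 'f list" where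
  "packet s k i \<omega> = nths (file_var s k \<omega>) (packet_pos s k i)"

definition all_files :: "nat \<Rightarrow> ('w, 'f, 'i, 'q, 'a) pir \<Rightarrow> 'w \<Rightarrow> nat \<Rightarrow> 'f list" where
  "all_files K s \<omega> = (\<lambda>k\<in>{1..K}. file_var s k \<omega>)"

definition content ::
  "nat \<Rightarrow> ('w, 'f, 'i, 'q, 'a) pir \<Rightarrow> nat \<Rightarrow> 'w \<Rightarrow> nat \<times> 'i \<Rightarrow> 'f list" where
  "content K s n \<omega> = restrict (\<lambda>(k, i). packet s k i \<omega>) ({1..K} \<times> stored s n)"

definition all_queries :: "nat \<Rightarrow> ('w, 'f, 'i, 'q, 'a) pir \<Rightarrow> nat \<Rightarrow> 'w \<Rightarrow> nat \<Rightarrow> 'q" where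
  "all_queries N s \<theta> \<omega> = (\<lambda>n\<in>{1..N}. query s \<theta> n \<omega>)"

definition all_answers :: "nat \<Rightarrow> ('w, 'f, 'i, 'q, 'a) pir \<Rightarrow> nat \<Rightarrow> 'w \<Rightarrow> nat \<Rightarrow> 'a" where
  "all_answers N s \<theta> \<omega> = (\<lambda>n\<in>{1..N}. answer s \<theta> n \<omega>)"

text \<open>The files are independent and each consists of independent uniform symbols.\<close>

definition uniform_files :: "nat \<Rightarrow> ('w, 'f::finite, 'i, 'q, 'a) pir \<Rightarrow> bool" where
  "uniform_files K s \<longleftrightarrow>
     0 < file_len s \<and>
     (\<forall>k\<in>{1..K}. simple_function (sample s) (file_var s k)) \<and>
     (\<forall>k\<in>{1..K}. \<forall>\<omega>\<in>space (sample s). length (file_var s k \<omega>) = file_len s) \<and>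
     prob_space.indep_vars (sample s) (\<lambda>_. count_space UNIV) (file_var s) {1..K} \<and>
     (\<forall>k\<in>{1..K}.
        prob_space.indep_vars (sample s) (\<lambda>_. count_space UNIV)
          (\<lambda>t \<omega>. file_var s k \<omega> ! t) {..<file_len s} \<and>
        (\<forall>t<file_len s. distr (sample s) (count_space UNIV) (\<lambda>\<omega>. file_var s k \<omega> ! t) =
           uniform_count_measure UNIV))"

definition valid_storage ::
  "real \<Rightarrow> nat \<Rightarrow> nat \<Rightarrow> ('w, 'f::finite, 'i, 'q, 'a) pir \<Rightarrow> bool" where
  "valid_storage \<mu> N K s \<longleftrightarrow>
     finite (packets s) \<and>
     (\<forall>k\<in>{1..K}. disjoint_family_on (packet_pos s k) (packets s) \<and>
        (\<Union>i\<in>packets s. packet_pos s k i) = {..<file_len s}) \<and>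
     (\<forall>k\<in>{1..K}. \<forall>k'\<in>{1..K}. \<forall>i\<in>packets s. ent s (packet s k i) = ent s (packet s k' i)) \<and>
     (\<Union>n\<in>{1..N}. stored s n) = packets s \<and>
     (\<forall>n\<in>{1..N}. ent s (content K s n) \<le> \<mu> * real K * real (file_len s))"

definition valid_retrieval :: "nat \<Rightarrow> nat \<Rightarrow> ('w, 'f::finite, 'i, 'q, 'a) pir \<Rightarrow> bool" where
  "valid_retrieval N K s \<longleftrightarrow>
     (\<forall>\<theta>\<in>{1..K}. \<forall>n\<in>{1..N}. simple_function (sample s) (query s \<theta> n) \<and>
        simple_function (sample s) (answer s \<theta> n)) \<and>
     (\<forall>\<theta>\<in>{1..K}. mut_inf s (all_queries N s \<theta>) (all_files K s) = 0) \<and>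
     (\<forall>\<theta>\<in>{1..K}. \<forall>n\<in>{1..N}.
        cond_ent s (answer s \<theta> n) (\<lambda>\<omega>. (query s \<theta> n \<omega>, content K s n \<omega>)) = 0) \<and>
     (\<forall>\<theta>\<in>{1..K}. cond_ent s (file_var s \<theta>)
        (\<lambda>\<omega>. (all_answers N s \<theta> \<omega>, all_queries N s \<theta> \<omega>)) = 0)"

definition private_retrieval :: "nat \<Rightarrow> nat \<Rightarrow> ('w, 'f, 'i, 'q, 'a) pir \<Rightarrow> bool" where
  "private_retrieval N K s \<longleftrightarrow> (\<forall>n\<in>{1..N}. \<forall>\<theta>\<in>{1..K}. \<forall>\<theta>'\<in>{1..K}.
     distr (sample s) (count_space UNIV) (\<lambda>\<omega>. (query s \<theta> n \<omega>, answer s \<theta> n \<omega>, content K s n \<omega>)) =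
     distr (sample s) (count_space UNIV) (\<lambda>\<omega>. (query s \<theta>' n \<omega>, answer s \<theta>' n \<omega>, content K s n \<omega>)))"

definition sc_pir_scheme ::
  "real \<Rightarrow> nat \<Rightarrow> nat \<Rightarrow> ('w, 'f::{field,finite}, 'i, 'q, 'a) pir \<Rightarrow> bool" where
  "sc_pir_scheme \<mu> N K s \<longleftrightarrow> prob_space (sample s) \<and>
     uniform_files K s \<and> valid_storage \<mu> N K s \<and> valid_retrieval N K s \<and> private_retrieval N K s"

definition sf_pir_scheme ::
  "nat \<Rightarrow> nat \<Rightarrow> ('w, 'f::{field,finite}, 'i, 'q, 'a) pir \<Rightarrow> bool" where
  "sf_pir_scheme M K s \<longleftrightarrow> sc_pir_scheme 1 M K s \<and> (\<forall>n\<in>{1..M}. stored s n = packets s)"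

text \<open>
  The download cost is an average over the random queries: the answer of a server to the query \<open>x\<close> costs
  its entropy given that the query is \<open>x\<close>, and averaging over \<open>x\<close> gives the entropy of the answer
  conditioned on the query. (The user knows the queries. The unconditioned entropy of an answer would
  in addition charge for information about the user's own query, and would make the capacity
  unattainable by schemes whose answer length depends on the query.)
\<close>

definition download :: "nat \<Rightarrow> ('w, 'f::finite, 'i, 'q, 'a) pir \<Rightarrow> nat \<Rightarrow> real" where
  "download N s \<theta> = (\<Sum>n\<in>{1..N}. cond_ent s (answer s \<theta> n) (query s \<theta> n))"

text \<open>By privacy, the download cost does not depend on \<open>\<theta>\<close>, so it may be evaluated at \<open>\<theta> = 1\<close>.\<close>

definition rate :: "nat \<Rightarrow> ('w, 'f::finite, 'i, 'q, 'a) pir \<Rightarrow> real" where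
  "rate N s = real (file_len s) / download N s 1"

text \<open>
  The alphabets are finite, so the sample space and the labels of packets, queries and answers can be
  taken from the natural numbers without loss of generality. The file length is not bounded.
\<close>

definition capacity :: "'f::{field,finite} itself \<Rightarrow> real \<Rightarrow> nat \<Rightarrow> nat \<Rightarrow> real" where
  "capacity _ \<mu> N K =
     Sup {rate N s | s :: (nat, 'f, nat, nat, nat) pir. sc_pir_scheme \<mu> N K s}"

definition capacity_achieving ::
  "real \<Rightarrow> nat \<Rightarrow> nat \<Rightarrow> ('w, 'f::{field,finite}, 'i, 'q, 'a) pir \<Rightarrow> bool" where
  "capacity_achieving \<mu> N K s \<longleftrightarrow> rate N s = capacity TYPE('f) \<mu> N K"

definition sub_packetization :: "('w, 'f, 'i, 'q, 'a) pir \<Rightarrow> nat" where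
  "sub_packetization s = card (packets s)"

definition equal_size :: "nat \<Rightarrow> ('w, 'f::finite, 'i, 'q, 'a) pir \<Rightarrow> bool" where
  "equal_size K s \<longleftrightarrow> (\<forall>k\<in>{1..K}. \<forall>i\<in>packets s.
     ent s (packet s k i) = real (file_len s) / real (sub_packetization s))"


section \<open>Linear schemes\<close>

text \<open>Linear combination of the vectors \<open>v x\<close>, zero-padded to the largest dimension among them.\<close>

definition lin_comb :: "'x set \<Rightarrow> ('x \<Rightarrow> 'f) \<Rightarrow> ('x \<Rightarrow> 'f list) \<Rightarrow> 'f::comm_semiring_0 list" where
  "lin_comb X c v = map (\<lambda>t. \<Sum>x\<in>X. c x * nth_default 0 (v x) t)
     [0..<Max (insert 0 ((\<lambda>x. length (v x)) ` X))]"

text \<open>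
  Answer of server \<open>n\<close> to the query \<open>x\<close> when it holds the packets \<open>v k i\<close> with \<open>i \<in> I\<close>. The answer length
  \<open>len n x\<close> and the coefficients \<open>\<beta> n x k i j\<close> depend only on the server and the query.
\<close>

definition lin_answer ::
  "nat \<Rightarrow> (nat \<Rightarrow> 'q \<Rightarrow> nat) \<Rightarrow> (nat \<Rightarrow> 'q \<Rightarrow> nat \<Rightarrow> 'i \<Rightarrow> nat \<Rightarrow> 'f::comm_semiring_0) \<Rightarrow>
   'i set \<Rightarrow> (nat \<Rightarrow> 'i \<Rightarrow> 'f list) \<Rightarrow> nat \<Rightarrow> 'q \<Rightarrow> 'f list list" where
  "lin_answer K len \<beta> I v n x =
     map (\<lambda>j. lin_comb ({1..K} \<times> I) (\<lambda>(k, i). \<beta> n x k i j) (\<lambda>(k, i). v k i)) [1..<Suc (len n x)]"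

definition linear_with ::
  "nat \<Rightarrow> nat \<Rightarrow> (nat \<Rightarrow> 'q \<Rightarrow> nat) \<Rightarrow> (nat \<Rightarrow> 'q \<Rightarrow> nat \<Rightarrow> 'i \<Rightarrow> nat \<Rightarrow> 'f::field) \<Rightarrow>
   ('w, 'f, 'i, 'q, 'f list list) pir \<Rightarrow> bool" where
  "linear_with N K len \<beta> s \<longleftrightarrow> (\<forall>\<theta>\<in>{1..K}. \<forall>n\<in>{1..N}. \<forall>\<omega>\<in>space (sample s).
     answer s \<theta> n \<omega> =
       lin_answer K len \<beta> (stored s n) (\<lambda>k i. packet s k i \<omega>) n (query s \<theta> n \<omega>))"


section \<open>SF-SC-PIR schemes\<close>

definition valid_weights :: "real \<Rightarrow> nat \<Rightarrow> nat \<Rightarrow> (nat set \<Rightarrow> real) \<Rightarrow> bool" where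
  "valid_weights \<mu> N M \<alpha> \<longleftrightarrow>
     (\<forall>S. S \<subseteq> {1..N} \<and> card S = M \<longrightarrow> 0 \<le> \<alpha> S \<and> \<alpha> S \<le> 1) \<and>
     (\<forall>n\<in>{1..N}. (\<Sum>S | S \<subseteq> {1..N} \<and> card S = M \<and> n \<in> S. \<alpha> S) = \<mu>)"

definition active :: "nat \<Rightarrow> nat \<Rightarrow> (nat set \<Rightarrow> real) \<Rightarrow> nat set set" where
  "active N M \<alpha> = {S. S \<subseteq> {1..N} \<and> card S = M \<and> 0 < \<alpha> S}"

text \<open>
  \<open>s\<close> results from the weights \<open>\<alpha>\<close> and the linear SF-PIR scheme \<open>sf\<close>. The packet labelled \<open>(S, i)\<close> is the
  \<open>i\<close>-th packet of the part \<open>W\<^bsub>k,S\<^esub>\<close>; the part has \<open>\<alpha> S * file_len s\<close> symbols and is split in the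
  same proportions as the files of \<open>sf\<close>. The bijection \<open>\<sigma> S\<close> says which server in \<open>S\<close> acts as which
  of the \<open>M\<close> servers of \<open>sf\<close>. The query to server \<open>n\<close> (and likewise its answer) is the family, indexed
  by the active sets \<open>S\<close> containing \<open>n\<close>, of the queries of the copy of \<open>sf\<close> employed for \<open>S\<close>: the query
  vector of that copy has the same joint distribution as in \<open>sf\<close>, different copies are independent,
  and each copy answers by the linear rule of \<open>sf\<close> applied to the packets of the parts \<open>W\<^bsub>k,S\<^esub>\<close>.
  Independence of all queries from the files is contained in \<open>sc_pir_scheme\<close>.
\<close>

definition linear_sf_sc_pir_scheme ::
  "real \<Rightarrow> nat \<Rightarrow> nat \<Rightarrow> nat \<Rightarrow> (nat set \<Rightarrow> real) \<Rightarrow>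
   ('v, 'f::{field,finite}, 'i, 'q, 'f list list) pir \<Rightarrow>
   ('w, 'f, nat set \<times> 'i, nat set \<Rightarrow> 'q, nat set \<Rightarrow> 'f list list) pir \<Rightarrow> bool" where
  "linear_sf_sc_pir_scheme \<mu> N K M \<alpha> sf s \<longleftrightarrow>
     valid_weights \<mu> N M \<alpha> \<and>
     sf_pir_scheme M K sf \<and> capacity_achieving 1 M K sf \<and>
     sc_pir_scheme \<mu> N K s \<and>
     packets s = active N M \<alpha> \<times> packets sf \<and>
     (\<forall>n\<in>{1..N}. stored s n = {S \<in> active N M \<alpha>. n \<in> S} \<times> packets sf) \<and>
     (\<forall>k\<in>{1..K}. \<forall>S\<in>active N M \<alpha>.
        real (card (\<Union>i\<in>packets sf. packet_pos s k (S, i))) = \<alpha> S * real (file_len s) \<and>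
        (\<forall>i\<in>packets sf. real (card (packet_pos s k (S, i))) / (\<alpha> S * real (file_len s)) =
           real (card (packet_pos sf k i)) / real (file_len sf))) \<and>
     (\<exists>len \<beta> \<sigma>.
        linear_with M K len \<beta> sf \<and>
        (\<forall>S\<in>active N M \<alpha>. bij_betw (\<sigma> S) {1..M} S) \<and>
        (\<forall>\<theta>\<in>{1..K}.
           (\<forall>n\<in>{1..N}. \<forall>\<omega>\<in>space (sample s).
              query s \<theta> n \<omega> \<in> extensional {S \<in> active N M \<alpha>. n \<in> S} \<and>
              answer s \<theta> n \<omega> \<in> extensional {S \<in> active N M \<alpha>. n \<in> S}) \<and>
           (\<forall>S\<in>active N M \<alpha>.
              distr (sample s) (count_space UNIV) (\<lambda>\<omega>. \<lambda>m\<in>{1..M}. query s \<theta> (\<sigma> S m) \<omega> S) =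
              distr (sample sf) (count_space UNIV) (all_queries M sf \<theta>)) \<and>
           prob_space.indep_vars (sample s) (\<lambda>_. count_space UNIV)
             (\<lambda>S \<omega>. \<lambda>m\<in>{1..M}. query s \<theta> (\<sigma> S m) \<omega> S) (active N M \<alpha>) \<and>
           (\<forall>S\<in>active N M \<alpha>. \<forall>m\<in>{1..M}. \<forall>\<omega>\<in>space (sample s).
              answer s \<theta> (\<sigma> S m) \<omega> S =
                lin_answer K len \<beta> (packets sf) (\<lambda>k i. packet s k (S, i) \<omega>) m
                  (query s \<theta> (\<sigma> S m) \<omega> S))))"

text \<open>
  Sub-packetizations of the capacity-achieving linear SF-SC-PIR schemes with packets of equal size;
  as for \<open>capacity\<close>, finite alphabets are represented by natural numbers.
\<close>

definition equal_size_sub_packetizations ::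
  "'f::{field,finite} itself \<Rightarrow> real \<Rightarrow> nat \<Rightarrow> nat \<Rightarrow> nat \<Rightarrow> nat set" where
  "equal_size_sub_packetizations _ \<mu> N K M =
     {sub_packetization s | \<alpha>
        (sf :: (nat, 'f, nat, nat, 'f list list) pir)
        (s :: (nat, 'f, nat set \<times> nat, nat set \<Rightarrow> nat, nat set \<Rightarrow> 'f list list) pir).
        linear_sf_sc_pir_scheme \<mu> N K M \<alpha> sf s \<and> capacity_achieving \<mu> N K s \<and> equal_size K s}"

end

theory Submission
  imports Defs
begin

text \<open>
  Lower bound. If all packets have the same size, all active sets carry the same weight, and counting the
  sets that contain a given server shows that their number is a multiple of \<open>N / gcd N M\<close>. In a
  linear capacity-achieving storage full scheme the converse bound is tight, so for every vector of
  queries each single answer contains all the interference \<open>h\<close>, while the answers are independent and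
  contain \<open>L + h\<close> in total; hence \<open>(M - 1) * h \<le> L\<close>. By linearity \<open>h\<close> is \<open>0\<close> or at least the size of a
  packet, and it does not always vanish, so a file has at least \<open>M - 1\<close> packets.

  Upper bound. The code of Tian, Sun and Chen has \<open>M - 1\<close> packets and is used on a cyclic family of
  \<open>N / gcd N M\<close> sets of servers.

  Converse. Let \<open>T\<close> be a set of servers and consider the entropy of all answers, given the first \<open>k\<close>
  files and the contents of \<open>T\<close>. By induction it is at least the sum, over the packets not stored in
  \<open>T\<close>, of the packet size times \<open>1 / l + \<dots> + 1 / l ^ (K - k)\<close>, where \<open>l\<close> is the number of servers that
  store the packet: average the chain rule over the first server outside \<open>T\<close>. For \<open>T = {}\<close> and by
  convexity in \<open>l\<close> this yields the capacity for integral \<open>\<mu> * N\<close>.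
\<close>

section \<open>Entropy of functions on a finite set with uniform distribution\<close>

text \<open>Being capacity-achieving refers to a supremum over all schemes, so the value of the
  capacity has to be known for the systems (\<mu>, N) and (1, M) alike. The converse must therefore
  cover every placement of packets, not only those with each packet at M servers. This is why its
  induction records the contents of a set of servers besides the given files, and why each packet
  has its own multiplicity. All entropies are reduced to counting. For fixed queries the answers are
  functions of the array of file symbols, which is uniform on a finite set, and the entropy of an
  answer given its query is a mean of counting entropies. Almost sure statements become statements
  about every array, and equality in a mean inequality becomes equality at each query vector, on
  which the bound M - 1 rests. The code attains the bound because the query vector of server m sums
  to m modulo M. The zero vector can then occur only at server M, where it costs nothing, and the
  expected saving of M / M^K symbols is exactly the difference between M and M - 1 times the inverse
  capacity.\<close>

definition uent :: "real \<Rightarrow> 'w set \<Rightarrow> ('w \<Rightarrow> 'x) \<Rightarrow> real" where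
  "uent b \<Omega> X = (\<Sum>\<omega>\<in>\<Omega>. log b (card \<Omega> / card {\<omega>'\<in>\<Omega>. X \<omega>' = X \<omega>})) / card \<Omega>"

text \<open>Pointwise substitute for vanishing conditional entropy. With it, rewriting the arguments
  of entropies becomes equational reasoning without logarithms.\<close>

definition determines :: "'w set \<Rightarrow> ('w \<Rightarrow> 'y) \<Rightarrow> ('w \<Rightarrow> 'x) \<Rightarrow> bool" where
  "determines \<Omega> Y X \<longleftrightarrow> (\<forall>\<omega>\<in>\<Omega>. \<forall>\<omega>'\<in>\<Omega>. Y \<omega> = Y \<omega>' \<longrightarrow> X \<omega> = X \<omega>')"

lemma determinesI:
  "(\<And>\<omega> \<omega>'. \<omega> \<in> \<Omega> \<Longrightarrow> \<omega>' \<in> \<Omega> \<Longrightarrow> Y \<omega> = Y \<omega>' \<Longrightarrow> X \<omega> = X \<omega>') \<Longrightarrow> determines \<Omega> Y X"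
  unfolding determines_def by blast

lemma determinesD:
  "determines \<Omega> Y X \<Longrightarrow> \<omega> \<in> \<Omega> \<Longrightarrow> \<omega>' \<in> \<Omega> \<Longrightarrow> Y \<omega> = Y \<omega>' \<Longrightarrow> X \<omega> = X \<omega>'"
  unfolding determines_def by blast

lemma card_fiber_pos:
  assumes "finite \<Omega>" "\<omega> \<in> \<Omega>"
  shows "0 < card {\<omega>'\<in>\<Omega>. X \<omega>' = X \<omega>}"
  using assms by (auto simp: card_gt_0_iff)

lemma uent_mono:
  assumes "1 < b" "finite \<Omega>" "determines \<Omega> Y X"
  shows "uent b \<Omega> X \<le> uent b \<Omega> Y"
  unfolding uent_def
proof (rule divide_right_mono, rule sum_mono)
  fix \<omega> assume w: "\<omega> \<in> \<Omega>"
  have "{\<omega>'\<in>\<Omega>. Y \<omega>' = Y \<omega>} \<subseteq> {\<omega>'\<in>\<Omega>. X \<omega>' = X \<omega>}"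
    using determinesD[OF assms(3) _ w] by auto
  then have "card {\<omega>'\<in>\<Omega>. Y \<omega>' = Y \<omega>} \<le> card {\<omega>'\<in>\<Omega>. X \<omega>' = X \<omega>}"
    using assms(2) by (intro card_mono) auto
  moreover have "0 < card {\<omega>'\<in>\<Omega>. Y \<omega>' = Y \<omega>}" using assms(2) w by (rule card_fiber_pos)
  moreover have "0 < card \<Omega>" using assms(2) w by (auto simp: card_gt_0_iff)
  ultimately show "log b (card \<Omega> / card {\<omega>'\<in>\<Omega>. X \<omega>' = X \<omega>}) \<le> log b (card \<Omega> / card {\<omega>'\<in>\<Omega>. Y \<omega>' = Y \<omega>})"
    using assms(1) by (simp add: frac_le)
qed simp

lemma uent_cong:
  assumes "1 < b" "finite \<Omega>" "determines \<Omega> Y X" "determines \<Omega> X Y"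
  shows "uent b \<Omega> X = uent b \<Omega> Y"
  using uent_mono[OF assms(1,2,3)] uent_mono[OF assms(1,2,4)] by simp

text \<open>A fibre with c points contributes c terms 1 / c, hence exactly 1, and an empty one
  contributes 0. Weighted sums over points thereby turn into sums over values.\<close>

lemma sum_inverse_card_fiber_le_1:
  assumes "finite \<Omega>"
  shows "(\<Sum>\<omega> | \<omega> \<in> \<Omega> \<and> U \<omega> = u. 1 / real (card {\<omega>'\<in>\<Omega>. U \<omega>' = U \<omega>})) \<le> 1"
proof -
  have "(\<Sum>\<omega> | \<omega> \<in> \<Omega> \<and> U \<omega> = u. 1 / real (card {\<omega>'\<in>\<Omega>. U \<omega>' = U \<omega>}))
      = (\<Sum>\<omega> | \<omega> \<in> \<Omega> \<and> U \<omega> = u. 1 / real (card {\<omega>'\<in>\<Omega>. U \<omega>' = u}))"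
    by (rule sum.cong) auto
  also have "\<dots> \<le> 1" by simp
  finally show ?thesis .
qed

text \<open>Nonnegativity of the conditional mutual information of \<open>X\<close> and
  \<open>Y\<close> given \<open>Z\<close>. The inequality \<open>ln r \<le> r - 1\<close> is used at
  each point with \<open>r = cxz * cyz / (cxyz * cz)\<close>, so it suffices that these ratios sum
  to at most \<open>card \<Omega>\<close>.\<close>

lemma uent_submodular:
  assumes b: "1 < b" and fin: "finite \<Omega>"
  shows "uent b \<Omega> (\<lambda>\<omega>. (X \<omega>, Y \<omega>, Z \<omega>)) + uent b \<Omega> Z
       \<le> uent b \<Omega> (\<lambda>\<omega>. (X \<omega>, Z \<omega>)) + uent b \<Omega> (\<lambda>\<omega>. (Y \<omega>, Z \<omega>))"
proof (cases "\<Omega> = {}")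
  case True
  then show ?thesis by (simp add: uent_def)
next
  case False
  define cxz where "cxz \<omega> = real (card {\<omega>'\<in>\<Omega>. X \<omega>' = X \<omega> \<and> Z \<omega>' = Z \<omega>})" for \<omega>
  define cyz where "cyz \<omega> = real (card {\<omega>'\<in>\<Omega>. Y \<omega>' = Y \<omega> \<and> Z \<omega>' = Z \<omega>})" for \<omega>
  define cz where "cz \<omega> = real (card {\<omega>'\<in>\<Omega>. Z \<omega>' = Z \<omega>})" for \<omega>
  define cxyz where "cxyz \<omega> = real (card {\<omega>'\<in>\<Omega>. X \<omega>' = X \<omega> \<and> Y \<omega>' = Y \<omega> \<and> Z \<omega>' = Z \<omega>})" for \<omega>
  have n: "0 < real (card \<Omega>)" using False fin by (auto simp: card_gt_0_iff)
  have pos: "0 < cxz \<omega>" "0 < cyz \<omega>" "0 < cz \<omega>" "0 < cxyz \<omega>" if "\<omega> \<in> \<Omega>" for \<omega>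
    using that fin unfolding cxz_def cyz_def cz_def cxyz_def by (auto simp: card_gt_0_iff)
  \<comment> \<open>The product counts pairs of points, the one agreeing with \<omega> in
    \<open>X\<close> and \<open>Z\<close>, the other in \<open>Y\<close> and \<open>Z\<close>. The
    sum over pairs can then be pulled outside.\<close>
  have prod: "cxz \<omega> * cyz \<omega> =
      (\<Sum>\<omega>1\<in>\<Omega>. \<Sum>\<omega>2\<in>\<Omega>. if X \<omega>1 = X \<omega> \<and> Z \<omega>1 = Z \<omega> \<and> Y \<omega>2 = Y \<omega> \<and> Z \<omega>2 = Z \<omega> then 1 else 0)" for \<omega>
  proof -
    have 1: "cxz \<omega> = (\<Sum>\<omega>1\<in>\<Omega>. if X \<omega>1 = X \<omega> \<and> Z \<omega>1 = Z \<omega> then 1 else 0)"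
      unfolding cxz_def using fin by (simp add: sum.If_cases Int_def)
    have 2: "cyz \<omega> = (\<Sum>\<omega>1\<in>\<Omega>. if Y \<omega>1 = Y \<omega> \<and> Z \<omega>1 = Z \<omega> then 1 else 0)"
      unfolding cyz_def using fin by (simp add: sum.If_cases Int_def)
    show ?thesis unfolding 1 2 sum_product by (intro sum.cong) auto
  qed
  have "(\<Sum>\<omega>\<in>\<Omega>. cxz \<omega> * cyz \<omega> / (cxyz \<omega> * cz \<omega>)) =
    (\<Sum>\<omega>\<in>\<Omega>. \<Sum>\<omega>1\<in>\<Omega>. \<Sum>\<omega>2\<in>\<Omega>. if X \<omega>1 = X \<omega> \<and> Z \<omega>1 = Z \<omega> \<and> Y \<omega>2 = Y \<omega> \<and> Z \<omega>2 = Z \<omega>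
        then 1 / (cxyz \<omega> * cz \<omega>) else 0)"
    unfolding prod sum_divide_distrib by (intro sum.cong) auto
  also have "\<dots> = (\<Sum>\<omega>1\<in>\<Omega>. \<Sum>\<omega>2\<in>\<Omega>. \<Sum>\<omega>\<in>\<Omega>. if X \<omega>1 = X \<omega> \<and> Z \<omega>1 = Z \<omega> \<and> Y \<omega>2 = Y \<omega> \<and> Z \<omega>2 = Z \<omega>
        then 1 / (cxyz \<omega> * cz \<omega>) else 0)"
  proof -
    have "(\<Sum>\<omega>\<in>\<Omega>. \<Sum>\<omega>1\<in>\<Omega>. \<Sum>\<omega>2\<in>\<Omega>. h \<omega> \<omega>1 \<omega>2) = (\<Sum>\<omega>1\<in>\<Omega>. \<Sum>\<omega>2\<in>\<Omega>. \<Sum>\<omega>\<in>\<Omega>. h \<omega> \<omega>1 \<omega>2)"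
      for h :: "'a \<Rightarrow> 'a \<Rightarrow> 'a \<Rightarrow> real"
      by (subst sum.swap) (rule sum.cong[OF refl], rule sum.swap)
    then show ?thesis .
  qed
  \<comment> \<open>For a fixed pair the admissible \<omega> form a single fibre of (X, Y, Z), on
    which the weights \<open>1 / cxyz\<close> add up to at most 1.\<close>
  also have "\<dots> \<le> (\<Sum>\<omega>1\<in>\<Omega>. \<Sum>\<omega>2\<in>\<Omega>. if Z \<omega>2 = Z \<omega>1 then 1 / cz \<omega>1 else 0)"
  proof (intro sum_mono)
    fix \<omega>1 \<omega>2 assume w: "\<omega>1 \<in> \<Omega>" "\<omega>2 \<in> \<Omega>"
    show "(\<Sum>\<omega>\<in>\<Omega>. if X \<omega>1 = X \<omega> \<and> Z \<omega>1 = Z \<omega> \<and> Y \<omega>2 = Y \<omega> \<and> Z \<omega>2 = Z \<omega>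
        then 1 / (cxyz \<omega> * cz \<omega>) else 0) \<le> (if Z \<omega>2 = Z \<omega>1 then 1 / cz \<omega>1 else 0)"
    proof (cases "Z \<omega>2 = Z \<omega>1")
      case False
      then show ?thesis by (auto intro!: sum_nonpos)
    next
      case True
      let ?U = "\<lambda>\<omega>. (X \<omega>, Y \<omega>, Z \<omega>)"
      have "(\<Sum>\<omega>\<in>\<Omega>. if X \<omega>1 = X \<omega> \<and> Z \<omega>1 = Z \<omega> \<and> Y \<omega>2 = Y \<omega> \<and> Z \<omega>2 = Z \<omega>
          then 1 / (cxyz \<omega> * cz \<omega>) else 0) =
        (\<Sum>\<omega>\<in>\<Omega>. if ?U \<omega> = (X \<omega>1, Y \<omega>2, Z \<omega>1) then 1 / cxyz \<omega> * (1 / cz \<omega>1) else 0)"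
        using True by (intro sum.cong) (auto simp: cz_def)
      also have "\<dots> = (\<Sum>\<omega> | \<omega> \<in> \<Omega> \<and> ?U \<omega> = (X \<omega>1, Y \<omega>2, Z \<omega>1). 1 / cxyz \<omega> * (1 / cz \<omega>1))"
        using fin by (simp add: sum.If_cases Int_def)
      also have "\<dots> = (\<Sum>\<omega> | \<omega> \<in> \<Omega> \<and> ?U \<omega> = (X \<omega>1, Y \<omega>2, Z \<omega>1). 1 / real (card {\<omega>'\<in>\<Omega>. ?U \<omega>' = ?U \<omega>})) * (1 / cz \<omega>1)"
        by (simp add: sum_distrib_right sum_divide_distrib cxyz_def)
      also have "\<dots> \<le> 1 * (1 / cz \<omega>1)"
        using pos(3)[OF w(1)] by (intro mult_right_mono sum_inverse_card_fiber_le_1 fin) auto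
      finally show ?thesis using True by simp
    qed
  qed
  also have "\<dots> = (\<Sum>\<omega>1\<in>\<Omega>. 1)"
  proof (intro sum.cong refl)
    fix \<omega>1 assume w: "\<omega>1 \<in> \<Omega>"
    have "(\<Sum>\<omega>2\<in>\<Omega>. if Z \<omega>2 = Z \<omega>1 then 1 / cz \<omega>1 else 0) = cz \<omega>1 * (1 / cz \<omega>1)"
      using fin by (simp add: sum.If_cases Int_def cz_def)
    then show "(\<Sum>\<omega>2\<in>\<Omega>. if Z \<omega>2 = Z \<omega>1 then 1 / cz \<omega>1 else 0) = 1" using pos(3)[OF w] by simp
  qed
  finally have key: "(\<Sum>\<omega>\<in>\<Omega>. cxz \<omega> * cyz \<omega> / (cxyz \<omega> * cz \<omega>)) \<le> card \<Omega>" by simp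
  have "0 \<le> (\<Sum>\<omega>\<in>\<Omega>. 1 - cxz \<omega> * cyz \<omega> / (cxyz \<omega> * cz \<omega>)) / ln b"
    using key b by (simp add: sum_subtractf)
  also have "\<dots> = (\<Sum>\<omega>\<in>\<Omega>. (1 - cxz \<omega> * cyz \<omega> / (cxyz \<omega> * cz \<omega>)) / ln b)"
    by (rule sum_divide_distrib)
  also have "\<dots> \<le> (\<Sum>\<omega>\<in>\<Omega>. log b (card \<Omega> / cxz \<omega>) + log b (card \<Omega> / cyz \<omega>) - log b (card \<Omega> / cxyz \<omega>) - log b (card \<Omega> / cz \<omega>))"
  proof (intro sum_mono)
    fix \<omega> assume w: "\<omega> \<in> \<Omega>"
    let ?r = "cxz \<omega> * cyz \<omega> / (cxyz \<omega> * cz \<omega>)"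
    have r: "0 < ?r" using pos[OF w] by simp
    have "1 - ?r \<le> - ln ?r" using ln_le_minus_one[OF r] by simp
    then have "(1 - ?r) / ln b \<le> - log b ?r" 
      using divide_right_mono[of "1 - ?r" "- ln ?r" "ln b"] b by (simp add: log_def)
    also have "\<dots> = log b (card \<Omega> / cxz \<omega>) + log b (card \<Omega> / cyz \<omega>) - log b (card \<Omega> / cxyz \<omega>) - log b (card \<Omega> / cz \<omega>)"
      using pos[OF w] n b by (simp add: log_divide log_mult)
    finally show "(1 - ?r) / ln b \<le> \<dots>" .
  qed
  finally have "0 \<le> (\<Sum>\<omega>\<in>\<Omega>. log b (card \<Omega> / cxz \<omega>) + log b (card \<Omega> / cyz \<omega>) - log b (card \<Omega> / cxyz \<omega>) - log b (card \<Omega> / cz \<omega>)) / card \<Omega>"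
    using n by simp
  then show ?thesis
    unfolding uent_def cxz_def cyz_def cz_def cxyz_def
    by (simp add: sum.distrib sum_subtractf add_divide_distrib diff_divide_distrib)
qed

section \<open>Conditional entropy in the uniform model\<close>

definition cond_uent :: "real \<Rightarrow> 'w set \<Rightarrow> ('w \<Rightarrow> 'x) \<Rightarrow> ('w \<Rightarrow> 'y) \<Rightarrow> real" where
  "cond_uent b \<Omega> X Y = uent b \<Omega> (\<lambda>\<omega>. (X \<omega>, Y \<omega>)) - uent b \<Omega> Y"

lemma cond_uent_nonneg:
  assumes "1 < b" "finite \<Omega>"
  shows "0 \<le> cond_uent b \<Omega> X Y"
  using uent_mono[OF assms, of "\<lambda>\<omega>. (X \<omega>, Y \<omega>)" Y] by (simp add: cond_uent_def determines_def)

text \<open>Adjoining \<open>Y'\<close> to \<open>Y\<close> changes no entropy, because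
  \<open>Y\<close> determines it; what remains is submodularity.\<close>

lemma cond_uent_antimono_cond:
  assumes "1 < b" "finite \<Omega>" "determines \<Omega> Y Y'"
  shows "cond_uent b \<Omega> X Y \<le> cond_uent b \<Omega> X Y'"
proof -
  have "uent b \<Omega> (\<lambda>\<omega>. (X \<omega>, Y \<omega>)) = uent b \<Omega> (\<lambda>\<omega>. (X \<omega>, Y \<omega>, Y' \<omega>))"
    using assms by (intro uent_cong) (auto intro!: determinesI dest: determinesD)
  moreover have "uent b \<Omega> Y = uent b \<Omega> (\<lambda>\<omega>. (Y \<omega>, Y' \<omega>))"
    using assms by (intro uent_cong) (auto intro!: determinesI dest: determinesD)
  ultimately show ?thesis
    using uent_submodular[OF assms(1,2), of X Y Y'] by (simp add: cond_uent_def)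
qed

lemma cond_uent_mono:
  assumes "1 < b" "finite \<Omega>" "determines \<Omega> (\<lambda>\<omega>. (X \<omega>, Y \<omega>)) X'"
  shows "cond_uent b \<Omega> X' Y \<le> cond_uent b \<Omega> X Y"
  using uent_mono[OF assms(1,2), of "\<lambda>\<omega>. (X \<omega>, Y \<omega>)" "\<lambda>\<omega>. (X' \<omega>, Y \<omega>)"] assms(3)
  by (auto simp: cond_uent_def intro!: determinesI dest: determinesD)

lemma cond_uent_chain:
  assumes "1 < b" "finite \<Omega>"
  shows "cond_uent b \<Omega> (\<lambda>\<omega>. (X \<omega>, X' \<omega>)) Y = cond_uent b \<Omega> X Y + cond_uent b \<Omega> X' (\<lambda>\<omega>. (X \<omega>, Y \<omega>))"
proof -
  have "uent b \<Omega> (\<lambda>\<omega>. ((X \<omega>, X' \<omega>), Y \<omega>)) = uent b \<Omega> (\<lambda>\<omega>. (X' \<omega>, X \<omega>, Y \<omega>))"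
    using assms by (intro uent_cong) (auto intro!: determinesI dest: determinesD)
  then show ?thesis by (simp add: cond_uent_def)
qed

lemma cond_uent_cong:
  assumes "1 < b" "finite \<Omega>" "determines \<Omega> (\<lambda>\<omega>. (X \<omega>, Y \<omega>)) X'" "determines \<Omega> (\<lambda>\<omega>. (X' \<omega>, Y \<omega>)) X"
    "determines \<Omega> Y Y'" "determines \<Omega> Y' Y"
  shows "cond_uent b \<Omega> X Y = cond_uent b \<Omega> X' Y'"
proof -
  have "cond_uent b \<Omega> X Y = cond_uent b \<Omega> X' Y"
    using cond_uent_mono[OF assms(1,2,3)] cond_uent_mono[OF assms(1,2,4)] by simp
  then show ?thesis
    using cond_uent_antimono_cond[OF assms(1,2,5), of X'] cond_uent_antimono_cond[OF assms(1,2,6), of X'] by simp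
qed

lemma cond_uent_eq_0:
  assumes "1 < b" "finite \<Omega>" "determines \<Omega> Y X"
  shows "cond_uent b \<Omega> X Y = 0"
proof -
  have "uent b \<Omega> (\<lambda>\<omega>. (X \<omega>, Y \<omega>)) = uent b \<Omega> Y"
    using assms by (intro uent_cong) (auto intro!: determinesI dest: determinesD)
  then show ?thesis by (simp add: cond_uent_def)
qed

lemma cond_uent_le_sum:
  assumes "1 < b" "finite \<Omega>" "finite A"
  shows "cond_uent b \<Omega> (\<lambda>\<omega>. \<lambda>n\<in>A. X n \<omega>) Y \<le> (\<Sum>n\<in>A. cond_uent b \<Omega> (X n) Y)"
  using assms(3)
proof induction
  case empty
  then show ?case by (simp add: cond_uent_eq_0[OF assms(1,2)] determinesI)
next
  case (insert a A)
  have "cond_uent b \<Omega> (\<lambda>\<omega>. \<lambda>n\<in>insert a A. X n \<omega>) Y \<le> cond_uent b \<Omega> (\<lambda>\<omega>. (X a \<omega>, \<lambda>n\<in>A. X n \<omega>)) Y"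
  proof (intro cond_uent_mono assms determinesI)
    fix \<omega> \<omega>' assume *: "((X a \<omega>, \<lambda>n\<in>A. X n \<omega>), Y \<omega>) = ((X a \<omega>', \<lambda>n\<in>A. X n \<omega>'), Y \<omega>')"
    then have "X n \<omega> = X n \<omega>'" if "n \<in> A" for n
      using that by (metis prod.inject restrict_apply')
    then show "(\<lambda>n\<in>insert a A. X n \<omega>) = (\<lambda>n\<in>insert a A. X n \<omega>')" using * by auto
  qed
  also have "\<dots> = cond_uent b \<Omega> (X a) Y + cond_uent b \<Omega> (\<lambda>\<omega>. \<lambda>n\<in>A. X n \<omega>) (\<lambda>\<omega>. (X a \<omega>, Y \<omega>))"
    by (rule cond_uent_chain[OF assms(1,2)])
  also have "cond_uent b \<Omega> (\<lambda>\<omega>. \<lambda>n\<in>A. X n \<omega>) (\<lambda>\<omega>. (X a \<omega>, Y \<omega>)) \<le> cond_uent b \<Omega> (\<lambda>\<omega>. \<lambda>n\<in>A. X n \<omega>) Y"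
    by (intro cond_uent_antimono_cond assms) (auto simp: determines_def)
  finally show ?case
    using insert.IH sum.insert[OF insert.hyps, of "\<lambda>n. cond_uent b \<Omega> (X n) Y"] by linarith
qed

lemma cond_uent_const_cond:
  assumes "1 < b" "finite \<Omega>" "\<And>\<omega> \<omega>'. \<omega> \<in> \<Omega> \<Longrightarrow> \<omega>' \<in> \<Omega> \<Longrightarrow> Y \<omega> = Y \<omega>'"
  shows "cond_uent b \<Omega> X Y = uent b \<Omega> X"
proof -
  have "uent b \<Omega> (\<lambda>\<omega>. (X \<omega>, Y \<omega>)) = uent b \<Omega> X"
    using assms by (intro uent_cong) (auto intro!: determinesI dest: determinesD)
  moreover have "uent b \<Omega> Y = uent b \<Omega> (\<lambda>_. ())"
    using assms by (intro uent_cong) (auto intro!: determinesI dest: determinesD)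
  moreover have "uent b \<Omega> (\<lambda>_. ()) = 0"
    using assms(1) by (cases "\<Omega> = {}") (auto simp: uent_def assms(2))
  ultimately show ?thesis by (simp add: cond_uent_def)
qed

section \<open>Entropies of coordinate projections\<close>

lemma card_PiE_fiber:
  fixes w :: "'i \<Rightarrow> 'f::finite"
  assumes "finite I" "C \<subseteq> I" "w \<in> I \<rightarrow>\<^sub>E UNIV"
  shows "card {w'\<in>I \<rightarrow>\<^sub>E UNIV. restrict w' C = restrict w C} = CARD('f) ^ (card I - card C)"
proof -
  have "{w'\<in>I \<rightarrow>\<^sub>E UNIV. restrict w' C = restrict w C} = PiE I (\<lambda>i. if i \<in> C then {w i} else UNIV)"
  proof (intro set_eqI iffI)
    fix w' assume a: "w' \<in> {w'\<in>I \<rightarrow>\<^sub>E UNIV. restrict w' C = restrict w C}"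
    then have "w' i = w i" if "i \<in> C" for i using that by (metis (mono_tags, lifting) mem_Collect_eq restrict_apply')
    then show "w' \<in> PiE I (\<lambda>i. if i \<in> C then {w i} else UNIV)" using a by (auto simp: PiE_iff)
  next
    fix w' assume a: "w' \<in> PiE I (\<lambda>i. if i \<in> C then {w i} else UNIV)"
    then have "w' i = w i" if "i \<in> C" for i using that assms(2) by (auto simp: PiE_iff split: if_splits)
    then show "w' \<in> {w'\<in>I \<rightarrow>\<^sub>E UNIV. restrict w' C = restrict w C}" using a by (auto simp: PiE_iff)
  qed
  also have "card \<dots> = (\<Prod>i\<in>I. if i \<in> C then 1 else CARD('f))"
    using assms(1) by (subst card_PiE) (auto intro!: prod.cong)
  also have "\<dots> = CARD('f) ^ card (I - C)"
    using assms(1) by (simp add: prod.If_cases Diff_eq)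
  also have "card (I - C) = card I - card C" using assms by (meson card_Diff_subset finite_subset)
  finally show ?thesis .
qed

text \<open>All fibres of a projection have the same number of points, a power of q. In base q the
  entropy of a collection of file symbols is therefore just the number of their positions.\<close>

lemma uent_restrict:
  fixes C :: "'i set"
  assumes "finite I" "C \<subseteq> I" "1 < CARD('f::finite)"
  shows "uent (CARD('f)) (I \<rightarrow>\<^sub>E (UNIV :: 'f set)) (\<lambda>w. restrict w C) = card C"
proof -
  let ?O = "I \<rightarrow>\<^sub>E (UNIV :: 'f set)" and ?b = "real CARD('f)"
  have c: "card ?O = CARD('f) ^ card I" using assms(1) by (simp add: card_PiE)
  have le: "card C \<le> card I" using assms by (intro card_mono)
  have "log ?b (card ?O / card {w'\<in>?O. restrict w' C = restrict w C}) = card C" if "w \<in> ?O" for w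
  proof -
    have "real (card ?O) / card {w'\<in>?O. restrict w' C = restrict w C} = ?b ^ card C"
      using le by (simp add: c card_PiE_fiber[OF assms(1,2) that] flip: power_add of_nat_power)
        (metis le_add_diff_inverse nonzero_mult_div_cancel_right of_nat_mult of_nat_eq_0_iff power_add
          power_not_zero zero_less_card_finite less_numeral_extra(3))
    then show ?thesis using assms(3) by (simp add: log_nat_power)
  qed
  then have "uent ?b ?O (\<lambda>w. restrict w C) = card ?O * card C / card ?O"
    by (simp add: uent_def)
  then show ?thesis by (simp add: c)
qed

section \<open>The download lower bound for a fixed family of answer functions\<close>

lemma one_less_card_field: "1 < CARD('f::{field,finite})"
proof -
  have "card {0, 1 :: 'f} \<le> CARD('f)" by (rule card_mono) auto
  then show ?thesis by simp
qed

text \<open>\<open>1 + geo (K - 1) M\<close> is the inverse of the capacity. The term 1 is kept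
  apart since it stands for the desired file, while \<open>geo\<close> measures the interference of
  the other files per desired symbol.\<close>

definition geo :: "nat \<Rightarrow> real \<Rightarrow> real" where
  "geo m x = (\<Sum>j=1..m. (1 / x) ^ j)"

lemma geo_0 [simp]: "geo 0 x = 0"
  by (simp add: geo_def)

lemma geo_Suc:
  assumes "x \<noteq> 0"
  shows "x * geo (Suc m) x = 1 + geo m x"
proof -
  have "geo (Suc m) x = (1 / x) ^ 1 + (\<Sum>j=Suc 1..Suc m. (1 / x) ^ j)"
    unfolding geo_def by (rule sum.atLeast_Suc_atMost) simp
  also have "(\<Sum>j=Suc 1..Suc m. (1 / x) ^ j) = (\<Sum>j=1..m. (1 / x) ^ j * (1 / x))"
    by (subst sum.shift_bounds_cl_Suc_ivl) (simp add: mult.commute)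
  also have "\<dots> = geo m x * (1 / x)"
    by (simp add: geo_def sum_distrib_right sum_divide_distrib)
  finally show ?thesis using assms by (simp add: field_simps)
qed

lemma geo_pos: "0 < x \<Longrightarrow> 0 < m \<Longrightarrow> 0 < geo m x"
  unfolding geo_def by (intro sum_pos) auto

lemma geo_nonneg: "0 \<le> x \<Longrightarrow> 0 \<le> geo m x"
  unfolding geo_def by (intro sum_nonneg) auto

text \<open>The left side is the tangent at \<open>M\<close> of the convex function
  \<open>(1 / x) ^ j\<close>. Bernoulli's inequality for \<open>M / x\<close> gives a bound in
  \<open>M / x - 1\<close>, which dominates \<open>1 - x / M\<close>.\<close>

lemma inverse_power_tangent:
  fixes x M :: real
  assumes "0 < x" "0 < M"
  shows "(1 / M) ^ j * (1 + real j * (1 - x / M)) \<le> (1 / x) ^ j"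
proof -
  have "1 + real j * (1 - x / M) \<le> 1 + real j * (M / x - 1)"
  proof -
    have "0 \<le> (M - x)\<^sup>2 / (M * x)" using assms by simp
    also have "\<dots> = (M / x - 1) - (1 - x / M)" using assms by (simp add: field_simps power2_eq_square)
    finally have "1 - x / M \<le> M / x - 1" by simp
    then show ?thesis by (intro add_left_mono mult_left_mono) auto
  qed
  also have "\<dots> \<le> (1 + (M / x - 1)) ^ j"
    using assms by (intro Bernoulli_inequality) simp
  finally have "(1 / M) ^ j * (1 + real j * (1 - x / M)) \<le> (1 / M) ^ j * (M / x) ^ j"
    using assms by (intro mult_left_mono) auto
  also have "\<dots> = (1 / x) ^ j" using assms by (simp flip: power_mult_distrib)
  finally show ?thesis .
qed

text \<open>Jensen's inequality for a decreasing convex function. The tangent is taken at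
  \<open>M\<close> and not at the weighted mean: as its slope is negative, an upper bound
  \<open>M\<close> on the mean is enough, which is all that a storage constraint provides.\<close>

lemma geo_weighted_ge:
  fixes w x :: "'i \<Rightarrow> real"
  assumes "0 < M" "\<And>i. i \<in> P \<Longrightarrow> 0 \<le> w i" "\<And>i. i \<in> P \<Longrightarrow> 0 < x i"
    and "(\<Sum>i\<in>P. w i * x i) \<le> M * (\<Sum>i\<in>P. w i)"
  shows "(\<Sum>i\<in>P. w i) * geo m M \<le> (\<Sum>i\<in>P. w i * geo m (x i))"
proof -
  have "(\<Sum>i\<in>P. w i) * (1 / M) ^ j \<le> (\<Sum>i\<in>P. w i * (1 / x i) ^ j)" for j
  proof -
    have "0 \<le> real j * ((\<Sum>i\<in>P. w i) - (\<Sum>i\<in>P. w i * x i) / M)"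
      using assms(1,4) by (intro mult_nonneg_nonneg) (auto simp: divide_le_eq mult.commute)
    then have "(\<Sum>i\<in>P. w i) * (1 / M) ^ j
        \<le> (1 / M) ^ j * ((\<Sum>i\<in>P. w i) + real j * ((\<Sum>i\<in>P. w i) - (\<Sum>i\<in>P. w i * x i) / M))"
      using assms(1) by (subst mult.commute) (rule mult_left_mono, auto)
    also have "\<dots> = (\<Sum>i\<in>P. w i * ((1 / M) ^ j * (1 + real j * (1 - x i / M))))"
      by (simp add: sum.distrib sum_subtractf sum_distrib_left sum_distrib_right sum_divide_distrib algebra_simps)
    also have "\<dots> \<le> (\<Sum>i\<in>P. w i * (1 / x i) ^ j)"
      using assms(1-3) by (intro sum_mono mult_left_mono inverse_power_tangent) auto
    finally show ?thesis .
  qed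
  then have "(\<Sum>j=1..m. (\<Sum>i\<in>P. w i) * (1 / M) ^ j) \<le> (\<Sum>j=1..m. \<Sum>i\<in>P. w i * (1 / x i) ^ j)"
    by (intro sum_mono)
  also have "\<dots> = (\<Sum>i\<in>P. \<Sum>j=1..m. w i * (1 / x i) ^ j)" by (rule sum.swap)
  finally show ?thesis by (simp add: geo_def sum_distrib_left)
qed

text \<open>A scheme without its probability space. An array \<open>w\<close> holds the symbols of
  all files, \<open>\<phi> n x w\<close> is the answer of server \<open>n\<close> to query
  \<open>x\<close>, and \<open>Q \<theta>\<close> are the query vectors of positive probability.
  Privacy appears only as equality of means of functions of a single query; it will be applied to
  entropies of single answers.\<close>

locale pir_model =
  fixes N K L :: nat and P :: "'i set" and pos :: "nat \<Rightarrow> 'i \<Rightarrow> nat set" and sz :: "'i \<Rightarrow> nat"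
    and st :: "nat \<Rightarrow> 'i set"
    and \<phi> :: "nat \<Rightarrow> 'q \<Rightarrow> (nat \<times> nat \<Rightarrow> 'f::{field,finite}) \<Rightarrow> 'a"
    and Q :: "nat \<Rightarrow> (nat \<Rightarrow> 'q) set" and p :: "nat \<Rightarrow> (nat \<Rightarrow> 'q) \<Rightarrow> real"
  assumes K_pos: "1 \<le> K"
    and finite_P: "finite P"
    and pos_disjoint: "k \<in> {1..K} \<Longrightarrow> disjoint_family_on (pos k) P"
    and pos_union: "k \<in> {1..K} \<Longrightarrow> (\<Union>i\<in>P. pos k i) = {..<L}"
    and card_pos: "k \<in> {1..K} \<Longrightarrow> i \<in> P \<Longrightarrow> card (pos k i) = sz i"
    and st_union: "(\<Union>n\<in>{1..N}. st n) = P"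
    and answer_dep: "\<theta> \<in> {1..K} \<Longrightarrow> n \<in> {1..N} \<Longrightarrow> q \<in> Q \<theta> \<Longrightarrow>
      determines ({1..K} \<times> {..<L} \<rightarrow>\<^sub>E UNIV)
        (\<lambda>w. restrict w {(j, t). j \<in> {1..K} \<and> t \<in> (\<Union>i\<in>st n. pos j i)}) (\<phi> n (q n))"
    and decodable: "\<theta> \<in> {1..K} \<Longrightarrow> q \<in> Q \<theta> \<Longrightarrow>
      determines ({1..K} \<times> {..<L} \<rightarrow>\<^sub>E UNIV)
        (\<lambda>w. \<lambda>n\<in>{1..N}. \<phi> n (q n) w) (\<lambda>w. restrict w ({\<theta>} \<times> {..<L}))"
    and finite_Q: "\<theta> \<in> {1..K} \<Longrightarrow> finite (Q \<theta>)"
    and p_pos: "\<theta> \<in> {1..K} \<Longrightarrow> q \<in> Q \<theta> \<Longrightarrow> 0 < p \<theta> q"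
    and p_sum: "\<theta> \<in> {1..K} \<Longrightarrow> (\<Sum>q\<in>Q \<theta>. p \<theta> q) = 1"
    and p_private: "\<And>(g :: 'q \<Rightarrow> real) \<theta> \<theta>' n. \<theta> \<in> {1..K} \<Longrightarrow> \<theta>' \<in> {1..K} \<Longrightarrow> n \<in> {1..N} \<Longrightarrow>
      (\<Sum>q\<in>Q \<theta>. p \<theta> q * g (q n)) = (\<Sum>q\<in>Q \<theta>'. p \<theta>' q * g (q n))"
begin

section \<open>The converse: induction over files and servers\<close>

abbreviation "I \<equiv> {1..K} \<times> {..<L}"
abbreviation "\<Omega> \<equiv> I \<rightarrow>\<^sub>E (UNIV :: 'f set)"
abbreviation "H \<equiv> cond_uent (real CARD('f)) \<Omega>"
abbreviation "U \<equiv> uent (real CARD('f)) \<Omega>"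

text \<open>
  Notation of the induction: \<open>V T k\<close> consists of the files \<open>1..k\<close> and of everything the servers in \<open>T\<close>
  store; \<open>f \<theta> T k\<close> is the mean entropy of all answers given \<open>V T k\<close> when file \<open>\<theta>\<close> is desired; \<open>u T\<close> is
  the part of a single file that no server in \<open>T\<close> stores; \<open>S T k\<close> is the lower bound for \<open>f k T k\<close>.
\<close>

definition "known T = (\<Union>n\<in>T. st n)"
definition "C T k = {(j, t). (j, t) \<in> I \<and> (j \<le> k \<or> t \<in> (\<Union>i\<in>known T. pos j i))}"
definition "V T k w = restrict w (C T k)"
definition "A q w = (\<lambda>n\<in>{1..N}. \<phi> n (q n) w)"
definition "f \<theta> T k = (\<Sum>q\<in>Q \<theta>. p \<theta> q * H (A q) (V T k))"
definition "u T = (\<Sum>i\<in>P - known T. real (sz i))"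
definition "ns i = card {n \<in> {1..N}. i \<in> st n}"
definition "S T k = (\<Sum>i\<in>P - known T. real (sz i) * geo (K - k) (real (ns i)))"

lemma b1: "1 < real CARD('f)"
  using one_less_card_field[where 'f='f] by simp

lemma fin\<Omega>: "finite \<Omega>"
  by (intro finite_PiE) auto

lemmas bf = b1 fin\<Omega>

lemma st_sub: "n \<in> {1..N} \<Longrightarrow> st n \<subseteq> P"
  using st_union by blast

lemma pos_sub: "j \<in> {1..K} \<Longrightarrow> i \<in> P \<Longrightarrow> pos j i \<subseteq> {..<L}"
  using pos_union by blast

lemma ns_pos: "i \<in> P \<Longrightarrow> 0 < ns i"
  using st_union by (auto simp: ns_def card_gt_0_iff)

lemma restrict_determines: "D \<subseteq> E \<Longrightarrow> determines O' (\<lambda>w. restrict w E) (\<lambda>w. restrict w D)"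
  by (rule determinesI) (metis inf.absorb_iff2 restrict_restrict)

lemma determines_trans: "determines O' X Y \<Longrightarrow> determines O' Y Z \<Longrightarrow> determines O' X Z"
  unfolding determines_def by blast

lemma determines_Pair: "determines O' X Y \<Longrightarrow> determines O' X Z \<Longrightarrow> determines O' X (\<lambda>w. (Y w, Z w))"
  unfolding determines_def by blast

lemma V_determines_phi:
  assumes "T \<subseteq> {1..N}" "n \<in> T" "\<theta> \<in> {1..K}" "q \<in> Q \<theta>"
  shows "determines \<Omega> (V T k) (\<phi> n (q n))"
proof -
  have n: "n \<in> {1..N}" using assms by blast
  have "{(j, t). j \<in> {1..K} \<and> t \<in> (\<Union>i\<in>st n. pos j i)} \<subseteq> C T k"
    using pos_sub st_sub[OF n] assms(2) by (fastforce simp: C_def known_def)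
  then have "determines \<Omega> (V T k) (\<lambda>w. restrict w {(j, t). j \<in> {1..K} \<and> t \<in> (\<Union>i\<in>st n. pos j i)})"
    unfolding V_def by (rule restrict_determines)
  then show ?thesis using answer_dep[OF assms(3) n assms(4)] by (rule determines_trans)
qed

lemma finite_C: "finite (C T k)"
  by (rule finite_subset[of _ I]) (auto simp: C_def)

text \<open>Only the symbols of file \<open>k + 1\<close> outside the packets known from
  \<open>T\<close> are new. Corresponding packets have equal sizes in all files, so the increment
  does not depend on \<open>k\<close>.\<close>

lemma card_C:
  assumes "k < K" "T \<subseteq> {1..N}"
  shows "real (card (C T (Suc k))) = real (card (C T k)) + u T"
proof -
  let ?R = "{Suc k} \<times> (\<Union>i\<in>P - known T. pos (Suc k) i)"
  have k: "Suc k \<in> {1..K}" using assms by simp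
  have kn: "known T \<subseteq> P" using assms(2) st_sub unfolding known_def by blast
  have ex: "\<exists>i\<in>P - known T. t \<in> pos (Suc k) i"
    if "t < L" "\<forall>i\<in>known T. t \<notin> pos (Suc k) i" for t
    using that pos_union[OF k] by blast
  have "C T (Suc k) = C T k \<union> ?R"
  proof (intro set_eqI iffI)
    fix x assume "x \<in> C T (Suc k)"
    then show "x \<in> C T k \<union> ?R" using ex by (cases x) (auto simp: C_def le_Suc_eq)
  next
    fix x assume "x \<in> C T k \<union> ?R"
    then show "x \<in> C T (Suc k)" using pos_union[OF k] k by (cases x) (auto simp: C_def le_Suc_eq)
  qed
  moreover have "C T k \<inter> ?R = {}"
    using pos_disjoint[OF k] kn by (fastforce simp: C_def disjoint_family_on_def)
  moreover have "finite ?R" using pos_sub[OF k] finite_P by (auto intro: finite_subset)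
  ultimately have "card (C T (Suc k)) = card (C T k) + card ?R"
    using finite_C by (simp add: card_Un_disjoint)
  also have "card ?R = card (\<Union>i\<in>P - known T. pos (Suc k) i)"
    by (subst card_cartesian_product) simp
  also have "\<dots> = (\<Sum>i\<in>P - known T. card (pos (Suc k) i))"
    using finite_P pos_sub[OF k] pos_disjoint[OF k]
    by (intro card_UN_disjoint) (auto intro: finite_subset simp: disjoint_family_on_def)
  also have "\<dots> = (\<Sum>i\<in>P - known T. sz i)" using card_pos[OF k] by simp
  finally show ?thesis by (simp add: u_def)
qed

lemma U_V: "U (V T k) = card (C T k)"
  unfolding V_def by (intro uent_restrict one_less_card_field) (auto simp: C_def)

text \<open>When file \<open>k + 1\<close> is desired, the answers determine it. Of its symbols
  exactly \<open>u T\<close> are unknown given \<open>V T k\<close>, and once they are revealed the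
  condition has become \<open>V T (Suc k)\<close>; this is the chain rule for the decoded
  file.\<close>

lemma H_A_split:
  assumes k: "k < K" and T: "T \<subseteq> {1..N}" and q: "q \<in> Q (Suc k)"
  shows "H (A q) (V T k) = u T + H (A q) (V T (Suc k))"
proof -
  let ?W = "\<lambda>w. restrict w ({Suc k} \<times> {..<L})"
  have dec: "determines \<Omega> (A q) ?W" unfolding A_def using k q by (intro decodable) auto
  have eqv: "C T (Suc k) = C T k \<union> {Suc k} \<times> {..<L}" using k by (auto simp: C_def le_Suc_eq)
  have d1: "determines \<Omega> (\<lambda>w. (?W w, V T k w)) (V T (Suc k))"
  proof (rule determinesI)
    fix w w' assume "(?W w, V T k w) = (?W w', V T k w')"
    then have "restrict w ({Suc k} \<times> {..<L}) x = restrict w' ({Suc k} \<times> {..<L}) x"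
      "restrict w (C T k) x = restrict w' (C T k) x" for x by (simp_all add: V_def)
    then have "w x = w' x" if "x \<in> C T (Suc k)" for x using that unfolding eqv by (metis UnE restrict_apply')
    then show "V T (Suc k) w = V T (Suc k) w'" by (auto simp: V_def)
  qed
  have d2: "determines \<Omega> (V T (Suc k)) (\<lambda>w. (?W w, V T k w))"
    unfolding V_def eqv by (intro determines_Pair restrict_determines) auto
  have "H (A q) (V T k) = H (\<lambda>w. (?W w, A q w)) (V T k)"
    using dec by (intro cond_uent_cong bf) (auto intro!: determinesI dest: determinesD)
  also have "\<dots> = H ?W (V T k) + H (A q) (\<lambda>w. (?W w, V T k w))"
    by (rule cond_uent_chain[OF bf])
  also have "H (A q) (\<lambda>w. (?W w, V T k w)) = H (A q) (V T (Suc k))"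
    using d1 d2 by (intro cond_uent_cong bf) (auto intro!: determinesI dest: determinesD)
  also have "H ?W (V T k) = U (V T (Suc k)) - U (V T k)"
    unfolding cond_uent_def using uent_cong[OF bf d1 d2] by simp
  also have "\<dots> = u T" using card_C[OF k T] unfolding U_V by simp
  finally show ?thesis .
qed

lemma H_A_le_sum:
  assumes T: "T \<subseteq> {1..N}" and \<theta>: "\<theta> \<in> {1..K}" and q: "q \<in> Q \<theta>"
  shows "H (A q) (V T k) \<le> (\<Sum>n\<in>{1..N} - T. H (\<phi> n (q n)) (V T k))"
proof -
  have "H (A q) (V T k) \<le> (\<Sum>n\<in>{1..N}. H (\<phi> n (q n)) (V T k))"
    unfolding A_def by (intro cond_uent_le_sum bf) simp
  also have "\<dots> = (\<Sum>n\<in>{1..N} - T. H (\<phi> n (q n)) (V T k))"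
    using cond_uent_eq_0[OF bf V_determines_phi[OF T _ \<theta> q]] by (intro sum.mono_neutral_right) auto
  finally show ?thesis .
qed

text \<open>The unknown symbols of the desired file and the remaining interference must all come
  from answers of servers outside \<open>T\<close>. The right side contains single queries only, so
  privacy can later change the desired file in it.\<close>

lemma sum_H_ge:
  assumes k: "k < K" and T: "T \<subseteq> {1..N}"
  shows "u T + f (Suc k) T (Suc k) \<le> (\<Sum>n\<in>{1..N} - T. \<Sum>q\<in>Q (Suc k). p (Suc k) q * H (\<phi> n (q n)) (V T k))"
proof -
  have \<theta>: "Suc k \<in> {1..K}" using k by simp
  have "u T + f (Suc k) T (Suc k) = (\<Sum>q\<in>Q (Suc k). p (Suc k) q * (u T + H (A q) (V T (Suc k))))"
    using p_sum[OF \<theta>] by (simp add: f_def distrib_left sum.distrib flip: sum_distrib_right)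
  also have "\<dots> = (\<Sum>q\<in>Q (Suc k). p (Suc k) q * H (A q) (V T k))"
    using H_A_split[OF k T] by simp
  also have "\<dots> \<le> (\<Sum>q\<in>Q (Suc k). p (Suc k) q * (\<Sum>n\<in>{1..N} - T. H (\<phi> n (q n)) (V T k)))"
    using p_pos[OF \<theta>] H_A_le_sum[OF T \<theta>] by (intro sum_mono mult_left_mono) (auto intro: less_imp_le)
  also have "\<dots> = (\<Sum>n\<in>{1..N} - T. \<Sum>q\<in>Q (Suc k). p (Suc k) q * H (\<phi> n (q n)) (V T k))"
    by (simp add: sum_distrib_left) (rule sum.swap)
  finally show ?thesis .
qed

text \<open>Chain rule with the answer of server \<open>n\<close> first. Afterwards that answer is
  replaced in the condition by everything the server stores, which can only lower the remaining
  entropy.\<close>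

lemma H_A_ge:
  assumes T: "T \<subseteq> {1..N}" and n: "n \<in> {1..N} - T" and \<theta>: "\<theta> \<in> {1..K}" and q: "q \<in> Q \<theta>"
  shows "H (\<phi> n (q n)) (V T k) + H (A q) (V (insert n T) k) \<le> H (A q) (V T k)"
proof -
  have An: "A q w n = \<phi> n (q n) w" for w using n by (simp add: A_def)
  have "determines \<Omega> (V (insert n T) k) (V T k)"
    unfolding V_def by (rule restrict_determines) (auto simp: C_def known_def)
  moreover have "determines \<Omega> (V (insert n T) k) (\<phi> n (q n))"
    using T n by (intro V_determines_phi[OF _ _ \<theta> q]) auto
  ultimately have "H (A q) (V (insert n T) k) \<le> H (A q) (\<lambda>w. (\<phi> n (q n) w, V T k w))"
    by (intro cond_uent_antimono_cond bf determines_Pair)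
  then have "H (\<phi> n (q n)) (V T k) + H (A q) (V (insert n T) k) \<le> H (\<lambda>w. (\<phi> n (q n) w, A q w)) (V T k)"
    unfolding cond_uent_chain[OF bf] by simp
  also have "\<dots> \<le> H (A q) (V T k)"
    by (intro cond_uent_mono bf determinesI) (auto simp flip: An)
  finally show ?thesis .
qed

lemma f_ge:
  assumes T: "T \<subseteq> {1..N}" and \<theta>: "\<theta> \<in> {1..K}"
  shows "(\<Sum>n\<in>{1..N} - T. \<Sum>q\<in>Q \<theta>. p \<theta> q * H (\<phi> n (q n)) (V T k)) + (\<Sum>n\<in>{1..N} - T. f \<theta> (insert n T) k)
    \<le> real (card ({1..N} - T)) * f \<theta> T k"
proof -
  have "(\<Sum>q\<in>Q \<theta>. p \<theta> q * H (\<phi> n (q n)) (V T k)) + f \<theta> (insert n T) k \<le> f \<theta> T k" if "n \<in> {1..N} - T" for n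
    unfolding f_def sum.distrib[symmetric] distrib_left[symmetric]
    using p_pos[OF \<theta>] H_A_ge[OF T that \<theta>] by (intro sum_mono mult_left_mono) (auto intro: less_imp_le)
  then have "(\<Sum>n\<in>{1..N} - T. (\<Sum>q\<in>Q \<theta>. p \<theta> q * H (\<phi> n (q n)) (V T k)) + f \<theta> (insert n T) k)
      \<le> (\<Sum>n\<in>{1..N} - T. f \<theta> T k)" by (intro sum_mono)
  then show ?thesis by (simp add: sum.distrib)
qed

lemma f_nonneg: "\<theta> \<in> {1..K} \<Longrightarrow> 0 \<le> f \<theta> T k"
  unfolding f_def using p_pos by (intro sum_nonneg mult_nonneg_nonneg cond_uent_nonneg bf) (auto intro: less_imp_le)

text \<open>
  Each packet \<open>i\<close> outside \<open>T\<close> remains outside \<open>insert n T\<close> for all but \<open>ns i\<close> of the servers \<open>n\<close>, and the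
  deficit \<open>ns i * geo (K - k) (ns i)\<close> is exactly its share \<open>1 + geo (K - Suc k) (ns i)\<close> of the other terms.
\<close>

lemma S_step:
  assumes k: "k < K" and T: "T \<subseteq> {1..N}"
  shows "u T + S T (Suc k) + (\<Sum>n\<in>{1..N} - T. S (insert n T) k) = real (card ({1..N} - T)) * S T k"
proof -
  define G where "G i = real (sz i) * geo (K - k) (real (ns i))" for i
  let ?R = "P - known T"
  have S': "S (insert n T) k = (\<Sum>i\<in>?R. if i \<in> st n then 0 else G i)" for n
  proof -
    have "P - known (insert n T) = ?R \<inter> {i. i \<notin> st n}" by (auto simp: known_def)
    then show ?thesis using finite_P by (auto simp: S_def G_def sum.inter_restrict intro!: sum.cong)
  qed
  have cnt: "real (card {n \<in> {1..N} - T. i \<notin> st n}) = real (card ({1..N} - T)) - real (ns i)" if "i \<in> ?R" for i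
  proof -
    have "{n \<in> {1..N}. i \<in> st n} = {n \<in> {1..N} - T. i \<in> st n}" using that by (auto simp: known_def)
    moreover have "card ({1..N} - T) = card {n \<in> {1..N} - T. i \<in> st n} + card {n \<in> {1..N} - T. i \<notin> st n}"
      by (subst card_Un_disjoint[symmetric]) (auto intro: arg_cong[where f=card])
    ultimately show ?thesis by (simp add: ns_def)
  qed
  have "(\<Sum>n\<in>{1..N} - T. S (insert n T) k) = (\<Sum>i\<in>?R. \<Sum>n\<in>{1..N} - T. if i \<in> st n then 0 else G i)"
    unfolding S' by (rule sum.swap)
  also have "\<dots> = (\<Sum>i\<in>?R. G i * (real (card ({1..N} - T)) - real (ns i)))"
  proof (intro sum.cong refl)
    fix i assume i: "i \<in> ?R"
    have "(\<Sum>n\<in>{1..N} - T. if i \<in> st n then 0 else G i) = (\<Sum>n\<in>{n \<in> {1..N} - T. i \<notin> st n}. G i)"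
      by (rule sum.mono_neutral_cong_right) auto
    then show "(\<Sum>n\<in>{1..N} - T. if i \<in> st n then 0 else G i) = G i * (real (card ({1..N} - T)) - real (ns i))"
      using cnt[OF i] by (simp add: mult.commute)
  qed
  finally have 1: "(\<Sum>n\<in>{1..N} - T. S (insert n T) k) = real (card ({1..N} - T)) * S T k - (\<Sum>i\<in>?R. G i * real (ns i))"
    by (simp add: S_def G_def right_diff_distrib sum_subtractf sum_distrib_left mult_ac)
  have "u T + S T (Suc k) = (\<Sum>i\<in>?R. real (sz i) * (1 + geo (K - Suc k) (real (ns i))))"
    by (simp add: u_def S_def distrib_left sum.distrib)
  also have "\<dots> = (\<Sum>i\<in>?R. G i * real (ns i))"
  proof (intro sum.cong refl)
    fix i assume i: "i \<in> ?R"
    have "1 + geo (K - Suc k) (real (ns i)) = real (ns i) * geo (K - k) (real (ns i))"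
      using geo_Suc[of "real (ns i)" "K - Suc k"] ns_pos[of i] i k by (simp add: Suc_diff_Suc)
    then show "real (sz i) * (1 + geo (K - Suc k) (real (ns i))) = G i * real (ns i)" by (simp add: G_def)
  qed
  finally show ?thesis using 1 by simp
qed

text \<open>The measure counts the files not yet given and the servers outside \<open>T\<close>. The
  recursion calls two kinds of smaller instances: one more file given with the same
  \<open>T\<close>, and the same file with one more server in \<open>T\<close>.\<close>

lemma f_ge_S:
  assumes "k \<in> {1..K}" "T \<subseteq> {1..N}"
  shows "S T k \<le> f k T k"
  using assms
proof (induction "(K - k) + card ({1..N} - T)" arbitrary: k T rule: less_induct)
  case less
  note k = less.prems(1) and T = less.prems(2)
  show ?case
  proof (cases "k = K \<or> T = {1..N}")
    case True
    \<comment> \<open>With all files given the sum \<open>geo 0\<close> is empty, and with all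
      servers in \<open>T\<close> no packet is left.\<close>
    then have "S T k = 0" using st_union by (auto simp: S_def known_def)
    then show ?thesis using f_nonneg[OF k] by simp
  next
    case False
    then have kK: "k < K" and ne: "{1..N} - T \<noteq> {}" using k T by auto
    have c: "0 < card ({1..N} - T)" using ne by (simp add: card_gt_0_iff)
    have ih1: "S T (Suc k) \<le> f (Suc k) T (Suc k)"
      using kK k T by (intro less.hyps) auto
    have ih2: "S (insert n T) k \<le> f k (insert n T) k" if n: "n \<in> {1..N} - T" for n
    proof (rule less.hyps)
      have "{1..N} - insert n T = ({1..N} - T) - {n}" by auto
      then have "card ({1..N} - insert n T) < card ({1..N} - T)" using n c by (simp add: card_Diff_singleton)
      then show "K - k + card ({1..N} - insert n T) < K - k + card ({1..N} - T)" by simp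
    qed (use k T n in auto)
    \<comment> \<open>Average the chain rule over the first server outside \<open>T\<close>; privacy turns file \<open>k\<close> into file \<open>k + 1\<close>.\<close>
    have "real (card ({1..N} - T)) * S T k = u T + S T (Suc k) + (\<Sum>n\<in>{1..N} - T. S (insert n T) k)"
      using S_step[OF kK T] by simp
    also have "\<dots> \<le> u T + f (Suc k) T (Suc k) + (\<Sum>n\<in>{1..N} - T. f k (insert n T) k)"
      using ih1 ih2 by (intro add_mono sum_mono) auto
    also have "u T + f (Suc k) T (Suc k) \<le> (\<Sum>n\<in>{1..N} - T. \<Sum>q\<in>Q (Suc k). p (Suc k) q * H (\<phi> n (q n)) (V T k))"
      by (rule sum_H_ge[OF kK T])
    also have "\<dots> = (\<Sum>n\<in>{1..N} - T. \<Sum>q\<in>Q k. p k q * H (\<phi> n (q n)) (V T k))"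
    proof (rule sum.cong[OF refl])
      fix n assume "n \<in> {1..N} - T"
      then show "(\<Sum>q\<in>Q (Suc k). p (Suc k) q * H (\<phi> n (q n)) (V T k)) = (\<Sum>q\<in>Q k. p k q * H (\<phi> n (q n)) (V T k))"
        using k kK p_private[of "Suc k" k n "\<lambda>x. H (\<phi> n x) (V T k)"] by auto
    qed
    also have "\<dots> + (\<Sum>n\<in>{1..N} - T. f k (insert n T) k) \<le> real (card ({1..N} - T)) * f k T k"
      by (rule f_ge[OF T k])
    finally show ?thesis using c by simp
  qed
qed

section \<open>Download cost and the case of equality\<close>

definition "D = (\<Sum>n\<in>{1..N}. \<Sum>q\<in>Q 1. p 1 q * U (\<phi> n (q n)))"

lemma sum_sz: "(\<Sum>i\<in>P. real (sz i)) = L"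
proof -
  have k: "1 \<in> {1..K}" using K_pos by simp
  have "(\<Sum>i\<in>P. card (pos 1 i)) = card (\<Union>i\<in>P. pos 1 i)"
    using finite_P pos_sub[OF k] pos_disjoint[OF k]
    by (intro card_UN_disjoint[symmetric]) (auto intro: finite_subset simp: disjoint_family_on_def)
  also have "\<dots> = L" using pos_union[OF k] by simp
  finally show ?thesis using card_pos[OF k] by (simp flip: of_nat_sum)
qed

lemma u_empty: "u {} = L"
  using sum_sz by (simp add: u_def known_def)

lemma H_V_empty: "H X (V {} 0) = U X"
  by (rule cond_uent_const_cond[OF bf]) (auto simp: V_def C_def known_def)

lemma U_A_le: "q \<in> Q 1 \<Longrightarrow> U (A q) \<le> (\<Sum>n\<in>{1..N}. U (\<phi> n (q n)))"
  using H_A_le_sum[of "{}" 1 q 0] K_pos unfolding H_V_empty by simp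

lemma U_A_eq: "q \<in> Q 1 \<Longrightarrow> U (A q) = L + H (A q) (V {} 1)"
  using H_A_split[of 0 "{}" q] K_pos unfolding H_V_empty u_empty by simp

lemma D_ge_f: "L + f 1 {} 1 \<le> D"
  using sum_H_ge[of 0 "{}"] K_pos unfolding H_V_empty u_empty D_def by simp

lemma D_ge:
  fixes M :: real
  assumes M: "0 < M" and "(\<Sum>n\<in>{1..N}. \<Sum>i\<in>st n. real (sz i)) \<le> M * L"
  shows "L * (1 + geo (K - 1) M) \<le> D"
proof -
  \<comment> \<open>Double counting of the stored symbols: the mean multiplicity of a packet,
    weighted by size, is at most \<open>M\<close>, as the convexity argument requires.\<close>
  have "(\<Sum>i\<in>P. real (sz i) * real (ns i)) = (\<Sum>i\<in>P. \<Sum>n\<in>{1..N}. if i \<in> st n then real (sz i) else 0)"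
    by (intro sum.cong refl) (simp add: ns_def sum.If_cases Int_def mult.commute)
  also have "\<dots> = (\<Sum>n\<in>{1..N}. \<Sum>i\<in>P. if i \<in> st n then real (sz i) else 0)" by (rule sum.swap)
  also have "\<dots> = (\<Sum>n\<in>{1..N}. \<Sum>i\<in>st n. real (sz i))"
    using finite_P st_sub by (intro sum.cong refl sum.mono_neutral_cong_right) auto
  finally have "(\<Sum>i\<in>P. real (sz i) * real (ns i)) \<le> M * (\<Sum>i\<in>P. real (sz i))"
    using assms(2) sum_sz by simp
  then have "L * geo (K - 1) M \<le> (\<Sum>i\<in>P. real (sz i) * geo (K - 1) (real (ns i)))"
    using geo_weighted_ge[OF M, of P "\<lambda>i. real (sz i)" "\<lambda>i. real (ns i)" "K - 1"] ns_pos sum_sz by simp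
  also have "\<dots> = S {} 1" by (simp add: S_def known_def)
  also have "\<dots> \<le> f 1 {} 1" using K_pos by (intro f_ge_S) auto
  finally show ?thesis using D_ge_f by (simp add: distrib_left)
qed

text \<open>All query vectors in \<open>Q \<theta>\<close> have positive weight, so a nonnegative
  quantity whose mean is not positive vanishes at each of them. Tightness on average thus becomes
  tightness for every query vector.\<close>

lemma sum_eq_0_weighted:
  assumes "\<theta> \<in> {1..K}" "\<And>q. q \<in> Q \<theta> \<Longrightarrow> 0 \<le> (h q :: real)" "(\<Sum>q\<in>Q \<theta>. p \<theta> q * h q) \<le> 0" "q \<in> Q \<theta>"
  shows "h q = 0"
proof -
  have "(\<Sum>q\<in>Q \<theta>. p \<theta> q * h q) = 0"
    using assms(2,3) p_pos[OF assms(1)] by (intro antisym sum_nonneg) (auto intro: mult_nonneg_nonneg less_imp_le)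
  then have "p \<theta> q * h q = 0"
    using assms p_pos[OF assms(1)] finite_Q[OF assms(1)]
    by (subst (asm) sum_nonneg_eq_0_iff) (auto intro: mult_nonneg_nonneg less_imp_le)
  then show ?thesis using p_pos[OF assms(1,4)] by auto
qed

text \<open>
  When the bound is attained, for every vector of queries the answers are independent and each of them
  alone has the same interference entropy \<open>h\<close> as all of them together. So the sum of the \<open>N\<close> answer
  entropies equals \<open>L + h\<close> and is at least \<open>N * h\<close>; moreover \<open>h > 0\<close> for some query vector.
\<close>

lemma tight_packet_bound:
  assumes K2: "2 \<le> K" and N: "0 < N" and L: "0 < L"
    and full: "\<And>n. n \<in> {1..N} \<Longrightarrow> st n = P"
    and tight: "D = L * (1 + geo (K - 1) N)"
    and quant: "\<And>q n. q \<in> Q 1 \<Longrightarrow> n \<in> {1..N} \<Longrightarrow> 0 < H (\<phi> n (q n)) (V {} 1) \<Longrightarrow> s \<le> H (\<phi> n (q n)) (V {} 1)"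
  shows "(real N - 1) * s \<le> L"
proof -
  have one: "1 \<in> {1..K}" using K_pos by simp
  have ns: "ns i = N" if "i \<in> P" for i
  proof -
    have "{n \<in> {1..N}. i \<in> st n} = {1..N}" using that full by auto
    then show ?thesis by (simp add: ns_def)
  qed
  have S2: "S {} 2 = L * geo (K - 2) N"
    using ns sum_sz by (simp add: S_def known_def flip: sum_distrib_right)
  \<comment> \<open>The converse with file 2 desired and file 1 given bounds the interference in
    single answers from below. Privacy then moves the bound to the queries for file 1.\<close>
  have "L * geo (K - 1) N * N = L * (1 + geo (K - 2) N)"
    using geo_Suc[of "real N" "K - 2"] N K2 by (simp add: Suc_diff_Suc numeral_2_eq_2 mult.commute)
  also have "\<dots> \<le> L + f 2 {} 2"
    using f_ge_S[of 2 "{}"] K2 S2 by (simp add: distrib_left)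
  also have "\<dots> \<le> (\<Sum>n\<in>{1..N}. \<Sum>q\<in>Q 2. p 2 q * H (\<phi> n (q n)) (V {} 1))"
    using sum_H_ge[of 1 "{}"] K2 by (simp add: u_empty numeral_2_eq_2)
  also have "\<dots> = (\<Sum>n\<in>{1..N}. \<Sum>q\<in>Q 1. p 1 q * H (\<phi> n (q n)) (V {} 1))"
  proof (rule sum.cong[OF refl])
    fix n assume "n \<in> {1..N}"
    then show "(\<Sum>q\<in>Q 2. p 2 q * H (\<phi> n (q n)) (V {} 1)) = (\<Sum>q\<in>Q 1. p 1 q * H (\<phi> n (q n)) (V {} 1))"
      using K2 p_private[of 2 1 n "\<lambda>x. H (\<phi> n x) (V {} 1)"] by auto
  qed
  finally have lower: "L * geo (K - 1) N * N \<le> (\<Sum>n\<in>{1..N}. \<Sum>q\<in>Q 1. p 1 q * H (\<phi> n (q n)) (V {} 1))" .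
  have upper: "f 1 {} 1 \<le> L * geo (K - 1) N" using D_ge_f tight by (simp add: distrib_left)
  have le: "H (\<phi> n (q n)) (V {} 1) \<le> H (A q) (V {} 1)" if "q \<in> Q 1" "n \<in> {1..N}" for q n
    using H_A_ge[of "{}" n 1 q 1] that one cond_uent_nonneg[OF bf, of "A q" "V {n} 1"] by auto
  \<comment> \<open>The gaps are nonnegative by the chain rule, and \<open>lower\<close> and
    \<open>upper\<close> together make the mean of their sum at most 0.\<close>
  have eqH: "H (\<phi> n (q n)) (V {} 1) = H (A q) (V {} 1)" if q: "q \<in> Q 1" and n: "n \<in> {1..N}" for q n
  proof -
    let ?h = "\<lambda>q. \<Sum>n\<in>{1..N}. H (A q) (V {} 1) - H (\<phi> n (q n)) (V {} 1)"
    have "(\<Sum>q\<in>Q 1. p 1 q * ?h q) = N * f 1 {} 1 - (\<Sum>n\<in>{1..N}. \<Sum>q\<in>Q 1. p 1 q * H (\<phi> n (q n)) (V {} 1))"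
      by (subst sum.swap) (simp add: f_def sum_distrib_left sum_subtractf right_diff_distrib mult_ac)
    also have "\<dots> \<le> 0" using lower mult_left_mono[OF upper, of "real N"] by (simp add: mult_ac)
    finally have "?h q = 0"
      using le q one by (intro sum_eq_0_weighted[of 1 ?h]) (auto intro!: sum_nonneg)
    then show ?thesis using le[OF q] n by (subst (asm) sum_nonneg_eq_0_iff) auto
  qed
  have f1: "f 1 {} 1 = L * geo (K - 1) N"
  proof -
    have "L * geo (K - 1) N * N \<le> N * f 1 {} 1"
      using lower f_ge[of "{}" 1 1] one f_nonneg[OF one] sum_nonneg[of "{1..N}" "\<lambda>n. f 1 {n} 1"] by simp
    then show ?thesis using upper N by simp
  qed
  have eqU: "(\<Sum>n\<in>{1..N}. U (\<phi> n (q n))) = U (A q)" if q: "q \<in> Q 1" for q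
  proof -
    let ?h = "\<lambda>q. (\<Sum>n\<in>{1..N}. U (\<phi> n (q n))) - U (A q)"
    have "(\<Sum>q\<in>Q 1. p 1 q * U (A q)) = (\<Sum>q\<in>Q 1. p 1 q * (L + H (A q) (V {} 1)))"
      using U_A_eq by simp
    also have "\<dots> = L + f 1 {} 1"
      using p_sum[OF one] by (simp add: f_def distrib_left sum.distrib flip: sum_distrib_right)
    finally have "(\<Sum>q\<in>Q 1. p 1 q * U (A q)) = D" using f1 tight by (simp add: distrib_left)
    moreover have "(\<Sum>q\<in>Q 1. p 1 q * ?h q) = D - (\<Sum>q\<in>Q 1. p 1 q * U (A q))"
      unfolding D_def by (subst sum.swap) (simp add: sum_distrib_left sum_subtractf right_diff_distrib)
    ultimately have "?h q = 0"
      using U_A_le q one by (intro sum_eq_0_weighted[of 1 ?h]) auto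
    then show ?thesis by simp
  qed
  \<comment> \<open>\<open>K \<ge> 2\<close> makes \<open>geo (K - 1) N\<close> positive, hence the
    interference cannot vanish at all query vectors.\<close>
  have "0 < f 1 {} 1" using f1 L N K2 geo_pos[of "real N" "K - 1"] by simp
  then obtain q where q: "q \<in> Q 1" "0 < p 1 q * H (A q) (V {} 1)"
    unfolding f_def by (metis (no_types, lifting) not_le sum_nonpos)
  let ?h = "H (A q) (V {} 1)"
  have h: "0 < ?h" using q p_pos[OF one q(1)] by (simp add: zero_less_mult_iff)
  have "s \<le> ?h" using quant[OF q(1), of 1] eqH[OF q(1), of 1] h N by simp
  have "U (\<phi> n (q n)) \<ge> ?h" if "n \<in> {1..N}" for n
  proof -
    have "H (\<phi> n (q n)) (V {} 1) \<le> H (\<phi> n (q n)) (V {} 0)"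
      unfolding V_def by (intro cond_uent_antimono_cond bf restrict_determines) (auto simp: C_def)
    then show ?thesis using eqH[OF q(1) that] unfolding H_V_empty by simp
  qed
  then have "(\<Sum>n\<in>{1..N}. ?h) \<le> (\<Sum>n\<in>{1..N}. U (\<phi> n (q n)))" by (intro sum_mono)
  then have "real N * ?h \<le> L + ?h" using eqU[OF q(1)] U_A_eq[OF q(1)] by simp
  then have "(real N - 1) * ?h \<le> L" by (simp add: algebra_simps)
  moreover have "(real N - 1) * s \<le> (real N - 1) * ?h"
    using \<open>s \<le> ?h\<close> N by (intro mult_left_mono) auto
  ultimately show ?thesis by linarith
qed

text \<open>The set \<open>J\<close> avoids file 1, so all symbols outside \<open>J\<close> form a
  stronger condition than file 1 alone. Under it \<open>J\<close> still has full entropy, and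
  \<open>X\<close> reveals \<open>J\<close>. This yields the quantum \<open>s\<close> of the
  preceding bound.\<close>

lemma H_ge_card:
  assumes J: "J \<subseteq> I - {1} \<times> {..<L}"
    and det: "determines \<Omega> (\<lambda>w. (X w, restrict w (I - J))) (\<lambda>w. restrict w J)"
  shows "card J \<le> H X (V {} 1)"
proof -
  have sub: "C {} 1 \<subseteq> I - J" using J by (auto simp: C_def known_def)
  have J': "J \<subseteq> I" using J by blast
  have "real (card J) = real (card I) - real (card (I - J))"
    using card_Diff_subset[OF finite_subset[OF J'] J'] card_mono[OF _ J'] by (simp add: of_nat_diff)
  also have "\<dots> = U (\<lambda>w. restrict w I) - U (\<lambda>w. restrict w (I - J))"
    by (simp add: uent_restrict[OF _ _ one_less_card_field] del: card_cartesian_product)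
  also have "U (\<lambda>w. restrict w I) = U (\<lambda>w. (restrict w J, restrict w (I - J)))"
  proof (rule uent_cong[OF bf])
    show "determines \<Omega> (\<lambda>w. (restrict w J, restrict w (I - J))) (\<lambda>w. restrict w I)"
    proof (rule determinesI)
      fix w w' assume "(restrict w J, restrict w (I - J)) = (restrict w' J, restrict w' (I - J))"
      then have "restrict w J x = restrict w' J x" "restrict w (I - J) x = restrict w' (I - J) x" for x by simp_all
      then have "w x = w' x" if "x \<in> I" for x using that by (metis DiffI restrict_apply')
      then show "restrict w I = restrict w' I" by (auto intro: restrict_ext)
    qed
    show "determines \<Omega> (\<lambda>w. restrict w I) (\<lambda>w. (restrict w J, restrict w (I - J)))"
      by (intro determines_Pair restrict_determines J') auto
  qed
  finally have "real (card J) = H (\<lambda>w. restrict w J) (\<lambda>w. restrict w (I - J))"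
    unfolding cond_uent_def .
  also have "\<dots> \<le> H X (\<lambda>w. restrict w (I - J))" by (rule cond_uent_mono[OF bf det])
  also have "\<dots> \<le> H X (V {} 1)"
    unfolding V_def by (intro cond_uent_antimono_cond bf restrict_determines sub)
  finally show ?thesis .
qed

end

section \<open>Entropies of simple random variables\<close>

definition pr :: "'w measure \<Rightarrow> ('w \<Rightarrow> 'x) \<Rightarrow> 'x \<Rightarrow> real" where
  "pr M X x = measure M {\<omega> \<in> space M. X \<omega> = x}"

lemma pr_nonneg: "0 \<le> pr M X x"
  by (simp add: pr_def)

lemma pr_eq_0: "x \<notin> X ` space M \<Longrightarrow> pr M X x = 0"
  unfolding pr_def by (metis (mono_tags, lifting) Collect_empty_eq image_eqI measure_empty)

lemma vimage_singleton: "X -` {x} \<inter> space M = {\<omega> \<in> space M. X \<omega> = x}"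
  by auto

lemma simple_function_events: "simple_function M X \<Longrightarrow> {\<omega> \<in> space M. R (X \<omega>)} \<in> sets M"
  using simple_functionD(2)[of M X "{x. R x}"] by (simp add: vimage_def Int_def conj_commute)

lemma measure_distr_singleton:
  "simple_function M X \<Longrightarrow> measure (distr M (count_space UNIV) X) {x} = pr M X x"
  by (subst measure_distr) (auto simp: pr_def measurable_simple_function intro!: arg_cong[where f="measure M"])

context prob_space
begin

lemma simple_distributed_pr: "simple_function M X \<Longrightarrow> simple_distributed M X (pr M X)"
  by (rule simple_distributedI) (auto simp: pr_def vimage_singleton)

lemma pr_marginal:
  assumes X: "simple_function M X"
  shows "pr M (\<lambda>\<omega>. g (X \<omega>)) y = (\<Sum>x | x \<in> X ` space M \<and> g x = y. pr M X x)"
proof -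
  have fin: "finite (X ` space M)" using X by (rule simple_functionD)
  have "{\<omega> \<in> space M. g (X \<omega>) = y} = (\<Union>x\<in>{x. x \<in> X ` space M \<and> g x = y}. {\<omega> \<in> space M. X \<omega> = x})" by auto
  moreover have "prob \<dots> = (\<Sum>x | x \<in> X ` space M \<and> g x = y. prob {\<omega> \<in> space M. X \<omega> = x})"
    using fin simple_function_events[OF X]
    by (intro finite_measure_finite_Union) (auto simp: disjoint_family_on_def)
  ultimately show ?thesis by (simp add: pr_def)
qed

lemma sum_pr: "simple_function M X \<Longrightarrow> (\<Sum>x\<in>X ` space M. pr M X x) = 1"
  using pr_marginal[of X "\<lambda>_. ()" "()"] prob_space by (simp add: pr_def)

lemma sum_pr_compose:
  fixes h :: "'c \<Rightarrow> real"
  assumes X: "simple_function M X"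
  shows "(\<Sum>x\<in>X ` space M. pr M X x * h (g x)) = (\<Sum>y\<in>(\<lambda>\<omega>. g (X \<omega>)) ` space M. pr M (\<lambda>\<omega>. g (X \<omega>)) y * h y)"
proof -
  have fin: "finite (X ` space M)" using X by (rule simple_functionD)
  have "(\<Sum>y\<in>(\<lambda>\<omega>. g (X \<omega>)) ` space M. pr M (\<lambda>\<omega>. g (X \<omega>)) y * h y)
      = (\<Sum>y\<in>g ` X ` space M. \<Sum>x\<in>{x \<in> X ` space M. g x = y}. pr M X x * h (g x))"
    unfolding pr_marginal[OF X] image_image sum_distrib_right by (intro sum.cong) auto
  also have "\<dots> = (\<Sum>x\<in>X ` space M. pr M X x * h (g x))"
    using fin by (intro sum.group) auto
  finally show ?thesis by simp
qed

lemma AE_pr_pos: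
  assumes X: "simple_function M X"
  shows "AE \<omega> in M. 0 < pr M X (X \<omega>)"
proof -
  have "AE \<omega> in M. \<forall>x\<in>{x \<in> X ` space M. pr M X x = 0}. X \<omega> \<noteq> x"
  proof (rule AE_finite_allI)
    show "finite {x \<in> X ` space M. pr M X x = 0}" using simple_functionD(1)[OF X] by simp
    fix x assume "x \<in> {x \<in> X ` space M. pr M X x = 0}"
    then show "AE \<omega> in M. X \<omega> \<noteq> x"
      using prob_Collect_eq_0[of "\<lambda>\<omega>. X \<omega> = x"] simple_function_events[OF X, of "\<lambda>y. y = x"] by (simp add: pr_def)
  qed
  moreover have "AE \<omega> in M. \<omega> \<in> space M" by simp
  ultimately show ?thesis
  proof eventually_elim
    case (elim \<omega>)
    then have "pr M X (X \<omega>) \<noteq> 0" by blast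
    then show ?case using pr_nonneg[of M X "X \<omega>"] by linarith
  qed
qed

lemma AE_pr_pos_ex:
  assumes "AE \<omega> in M. R \<omega>" "0 < pr M X x" "simple_function M X"
  shows "\<exists>\<omega>\<in>space M. X \<omega> = x \<and> R \<omega>"
proof (rule ccontr)
  assume no: "\<not> ?thesis"
  have "AE \<omega> in M. \<omega> \<in> space M" by simp
  with assms(1) have "AE \<omega> in M. X \<omega> \<noteq> x"
    by eventually_elim (use no in blast)
  then have "pr M X x = 0"
    using prob_Collect_eq_0[of "\<lambda>\<omega>. X \<omega> = x"] simple_function_events[OF assms(3), of "\<lambda>y. y = x"] by (simp add: pr_def)
  then show False using assms(2) by simp
qed

lemma pr_Pair_le:
  assumes "simple_function M X" "simple_function M Y"
  shows "pr M (\<lambda>\<omega>. (X \<omega>, Y \<omega>)) (x, y) \<le> pr M Y y"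
  unfolding pr_def using simple_function_events[OF assms(2), of "\<lambda>z. z = y"]
  by (intro finite_measure_mono) auto

lemma pr_Pair_add_le:
  assumes X: "simple_function M X" and Y: "simple_function M Y" and "x \<noteq> x'"
  shows "pr M (\<lambda>\<omega>. (X \<omega>, Y \<omega>)) (x, y) + pr M (\<lambda>\<omega>. (X \<omega>, Y \<omega>)) (x', y) \<le> pr M Y y"
proof -
  let ?E = "\<lambda>x. {\<omega> \<in> space M. (X \<omega>, Y \<omega>) = (x, y)}"
  have ev: "?E z \<in> sets M" for z
    using simple_function_events[OF simple_function_Pair[OF X Y], of "\<lambda>v. v = (z, y)"] by simp
  have "prob (?E x) + prob (?E x') = prob (?E x \<union> ?E x')"
    using ev assms(3) by (intro finite_measure_Union[symmetric]) auto
  also have "\<dots> \<le> pr M Y y"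
    unfolding pr_def using simple_function_events[OF Y, of "\<lambda>z. z = y"] by (intro finite_measure_mono) auto
  finally show ?thesis by (simp add: pr_def)
qed

end

context information_space
begin

lemma conditional_entropy_pr:
  assumes X: "simple_function M X" and Y: "simple_function M Y"
  shows "\<H>(X | Y) = - (\<Sum>(x, y)\<in>X ` space M \<times> Y ` space M.
     pr M (\<lambda>\<omega>. (X \<omega>, Y \<omega>)) (x, y) * log b (pr M (\<lambda>\<omega>. (X \<omega>, Y \<omega>)) (x, y) / pr M Y y))"
proof -
  have fin: "finite (X ` space M \<times> Y ` space M)" using simple_functionD(1)[OF X] simple_functionD(1)[OF Y] by simp
  show ?thesis
    unfolding conditional_entropy_eq[OF simple_distributed_pr[OF Y] simple_distributed_pr[OF simple_function_Pair[OF X Y]]]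
    using fin by (intro arg_cong[where f=uminus] sum.mono_neutral_left) (auto simp: pr_eq_0)
qed

text \<open>Each summand is nonnegative since the joint probability never exceeds that of
  \<open>y\<close>, so all vanish. A positive joint probability then equals the probability of
  \<open>y\<close> and leaves no mass for a second value.\<close>

lemma conditional_entropy_eq_0D:
  assumes X: "simple_function M X" and Y: "simple_function M Y" and 0: "\<H>(X | Y) = 0"
    and "0 < pr M (\<lambda>\<omega>. (X \<omega>, Y \<omega>)) (x, y)" "0 < pr M (\<lambda>\<omega>. (X \<omega>, Y \<omega>)) (x', y)"
  shows "x = x'"
proof (rule ccontr)
  assume ne: "x \<noteq> x'"
  let ?P = "pr M (\<lambda>\<omega>. (X \<omega>, Y \<omega>))"
  let ?t = "\<lambda>(x, y). - (?P (x, y) * log b (?P (x, y) / pr M Y y))"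
  have xy: "(x, y) \<in> X ` space M \<times> Y ` space M"
    using assms(4) pr_eq_0[of "(x, y)" "\<lambda>\<omega>. (X \<omega>, Y \<omega>)" M] by auto
  have t: "0 \<le> ?t z" for z
  proof (cases z)
    case (Pair x y)
    show ?thesis
    proof (cases "?P (x, y) = 0")
      case False
      then have P: "0 < ?P (x, y)" using pr_nonneg[of M _ "(x, y)"] by (simp add: less_le)
      then have "?P (x, y) / pr M Y y \<le> 1" "0 < ?P (x, y) / pr M Y y"
        using pr_Pair_le[OF X Y, of x y] by (auto simp: divide_le_eq)
      then have "log b (?P (x, y) / pr M Y y) \<le> 0" using b_gt_1 by (simp add: log_le_zero_cancel_iff)
      then show ?thesis using P Pair by (simp add: mult_nonneg_nonpos)
    qed (simp add: Pair)
  qed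
  have "(\<Sum>z\<in>X ` space M \<times> Y ` space M. ?t z) = 0"
    using 0 unfolding conditional_entropy_pr[OF X Y] by (simp add: sum_negf split_beta)
  then have "?t (x, y) = 0"
    using t xy simple_functionD(1)[OF X] simple_functionD(1)[OF Y]
    by (subst (asm) sum_nonneg_eq_0_iff) auto
  then have "log b (?P (x, y) / pr M Y y) = 0" using assms(4) by simp
  moreover have "0 < pr M Y y" using pr_Pair_le[OF X Y, of x y] assms(4) by simp
  ultimately have "?P (x, y) = pr M Y y" using assms(4) b_gt_1 by (simp add: log_def)
  then show False using pr_Pair_add_le[OF X Y ne, of y] assms(5) by simp
qed

lemma conditional_entropy_eq_0I:
  assumes X: "simple_function M X" and Y: "simple_function M Y" and g: "\<And>\<omega>. \<omega> \<in> space M \<Longrightarrow> X \<omega> = g (Y \<omega>)"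
  shows "\<H>(X | Y) = 0"
proof -
  let ?P = "pr M (\<lambda>\<omega>. (X \<omega>, Y \<omega>))"
  have "?P (x, y) * log b (?P (x, y) / pr M Y y) = 0" for x y
  proof (cases "x = g y")
    case True
    then have "?P (x, y) = pr M Y y" unfolding pr_def using g by (intro arg_cong[where f=prob]) auto
    then show ?thesis by simp
  next
    case False
    then have "{\<omega> \<in> space M. (X \<omega>, Y \<omega>) = (x, y)} = {}" using g by auto
    then have "?P (x, y) = 0" unfolding pr_def by (metis measure_empty)
    then show ?thesis by simp
  qed
  then show ?thesis unfolding conditional_entropy_pr[OF X Y] by (auto intro!: sum.neutral)
qed

text \<open>The equality case of Gibbs' inequality, for the joint law \<open>P\<close> and the
  product law \<open>R\<close>. It has to be proved on the support of \<open>P\<close> first; there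
  \<open>R\<close> turns out to have full mass, so it vanishes elsewhere.\<close>

lemma mutual_information_eq_0D:
  assumes X: "simple_function M X" and Y: "simple_function M Y" and 0: "\<I>(X ; Y) = 0"
  shows "pr M (\<lambda>\<omega>. (X \<omega>, Y \<omega>)) (x, y) = pr M X x * pr M Y y"
proof -
  define P where "P = pr M (\<lambda>\<omega>. (X \<omega>, Y \<omega>))"
  define R where "R = (\<lambda>(x, y). pr M X x * pr M Y y)"
  let ?A = "X ` space M \<times> Y ` space M"
  let ?S = "{z \<in> (\<lambda>\<omega>. (X \<omega>, Y \<omega>)) ` space M. 0 < P z}"
  note XY = simple_function_Pair[OF X Y]
  have finXY: "finite ((\<lambda>\<omega>. (X \<omega>, Y \<omega>)) ` space M)" using XY by (rule simple_functionD)
  have finA: "finite ?A" using simple_functionD(1)[OF X] simple_functionD(1)[OF Y] by simp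
  have sub: "?S \<subseteq> ?A" by auto
  have P0: "0 \<le> P z" for z by (simp add: P_def pr_nonneg)
  have R0: "0 \<le> R z" for z by (cases z) (simp add: R_def pr_nonneg)
  have PS: "P z = 0" if "z \<notin> ?S" for z
    using that P0[of z] pr_eq_0[of z "\<lambda>\<omega>. (X \<omega>, Y \<omega>)" M] unfolding P_def by (force simp: less_le)
  have Rpos: "0 < R z" if "0 < P z" for z
  proof (cases z)
    case (Pair x y)
    have "P (x, y) \<le> pr M Y y" unfolding P_def by (rule pr_Pair_le[OF X Y])
    moreover have "P (x, y) \<le> pr M X x" unfolding P_def pr_def
      using simple_function_events[OF X, of "\<lambda>z. z = x"] by (intro finite_measure_mono) auto
    ultimately show ?thesis using that Pair by (simp add: R_def)
  qed
  have sumP: "sum P ?S = 1"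
  proof -
    have "sum P ?S = sum P ((\<lambda>\<omega>. (X \<omega>, Y \<omega>)) ` space M)"
      using finXY PS by (intro sum.mono_neutral_left) auto
    then show ?thesis using sum_pr[OF XY] by (simp add: P_def)
  qed
  have sumR: "sum R ?A = 1"
    using sum_pr[OF X] sum_pr[OF Y] by (simp add: R_def sum.cartesian_product[symmetric] flip: sum_product)
  have "(\<Sum>z\<in>?S. P z * log b (P z / R z)) = (\<Sum>z\<in>(\<lambda>\<omega>. (X \<omega>, Y \<omega>)) ` space M. P z * log b (P z / R z))"
    using finXY PS by (intro sum.mono_neutral_left) auto
  also have "\<dots> = 0"
    using 0 mutual_information_simple_distributed[OF simple_distributed_pr[OF X] simple_distributed_pr[OF Y] simple_distributed_pr[OF XY]]
    by (simp add: P_def R_def split_beta')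
  finally have "(\<Sum>z\<in>?S. P z * ln (P z / R z)) / ln b = 0"
    by (simp add: log_def sum_divide_distrib)
  then have ln0: "(\<Sum>z\<in>?S. P z * ln (P z / R z)) = 0" using b_gt_1 by simp
  \<comment> \<open>Adding \<open>R z - P z\<close> makes each term nonnegative, with equality only
    for \<open>P z = R z\<close>, while over the support the sum changes by \<open>R\<close> of the
    support minus 1, which is at most 0.\<close>
  let ?t = "\<lambda>z. P z * ln (P z / R z) + R z - P z"
  have t: "0 \<le> ?t z" and teq: "?t z = 0 \<Longrightarrow> P z = R z" if z: "z \<in> ?S" for z
  proof -
    have pz: "0 < P z" "0 < R z" using z Rpos by auto
    have eq: "?t z = P z * (R z / P z - 1 - ln (R z / P z))"
      using pz by (simp add: ln_div field_simps)
    show "0 \<le> ?t z" unfolding eq using pz ln_le_minus_one[of "R z / P z"] by simp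
    assume "?t z = 0"
    then have "ln (R z / P z) = R z / P z - 1" using pz unfolding eq by simp
    then have "R z / P z = 1" using pz by (intro ln_eq_minus_one) auto
    then show "P z = R z" using pz by simp
  qed
  have SR: "sum R ?S \<le> 1" using sum_mono2[OF finA sub, of R] R0 sumR by simp
  have "(\<Sum>z\<in>?S. ?t z) = sum R ?S - 1" using ln0 sumP by (simp add: sum.distrib sum_subtractf)
  then have "(\<Sum>z\<in>?S. ?t z) = 0" using SR sum_nonneg[of ?S ?t, OF t] by simp
  then have tz: "?t z = 0" if "z \<in> ?S" for z
    using that t finXY by (subst (asm) sum_nonneg_eq_0_iff) auto
  have eqS: "P z = R z" if "z \<in> ?S" for z using teq[OF that tz[OF that]] .
  have "sum R ?S = sum P ?S" using eqS by (intro sum.cong) auto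
  then have "sum R (?A - ?S) = 0" using sumR sumP sum_diff[OF finA sub, of R] by simp
  then have Rout: "R z = 0" if "z \<in> ?A - ?S" for z
    using that R0 finA by (subst (asm) sum_nonneg_eq_0_iff) auto
  have "P z = R z" for z
  proof (cases "z \<in> ?S")
    case False
    have "R z = 0"
    proof (cases "z \<in> ?A")
      case False
      then show ?thesis using pr_eq_0[of _ X M] pr_eq_0[of _ Y M] by (cases z) (auto simp: R_def)
    qed (use False Rout in blast)
    then show ?thesis using PS[OF False] by simp
  qed (rule eqS)
  then show ?thesis by (simp add: P_def R_def)
qed

lemma mutual_information_eq_0I:
  assumes X: "simple_function M X" and Y: "simple_function M Y"
    and "\<And>x y. pr M (\<lambda>\<omega>. (X \<omega>, Y \<omega>)) (x, y) = pr M X x * pr M Y y"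
  shows "\<I>(X ; Y) = 0"
  using assms(3) X Y
  by (intro mutual_information_eq_0_simple[OF simple_distributed_pr simple_distributed_pr simple_distributed_pr]) auto

lemma uent_eq_sum:
  assumes "finite \<Omega>" "g ` \<Omega> \<subseteq> B" "finite B"
  shows "uent b \<Omega> g = - (\<Sum>x\<in>B. card {w\<in>\<Omega>. g w = x} / card \<Omega> * log b (card {w\<in>\<Omega>. g w = x} / card \<Omega>))"
proof -
  let ?c = "\<lambda>x. real (card {w\<in>\<Omega>. g w = x})" and ?n = "real (card \<Omega>)"
  have "(\<Sum>w\<in>\<Omega>. log b (?n / ?c (g w))) = (\<Sum>x\<in>B. \<Sum>w\<in>{w\<in>\<Omega>. g w = x}. log b (?n / ?c (g w)))"
    using assms by (intro sum.group[symmetric]) auto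
  also have "\<dots> = (\<Sum>x\<in>B. \<Sum>w\<in>{w\<in>\<Omega>. g w = x}. log b (?n / ?c x))" by (intro sum.cong) auto
  also have "\<dots> = (\<Sum>x\<in>B. ?c x * log b (?n / ?c x))" by simp
  also have "\<dots> = (\<Sum>x\<in>B. - (?c x * log b (?c x / ?n)))"
  proof (intro sum.cong refl)
    fix x assume "x \<in> B"
    show "?c x * log b (?n / ?c x) = - (?c x * log b (?c x / ?n))"
    proof (cases "?c x = 0")
      case False
      then have "\<Omega> \<noteq> {}" by auto
      then have "0 < ?n" using assms(1) by (auto simp: card_gt_0_iff)
      then show ?thesis using False by (simp add: log_divide right_diff_distrib)
    qed simp
  qed
  finally show ?thesis
    by (simp add: uent_def sum_divide_distrib sum_negf mult_ac)
qed

lemma entropy_uniform_pr: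
  assumes X: "simple_function M X" and \<Omega>: "finite \<Omega>"
    and P: "\<And>x. pr M X x = card {w\<in>\<Omega>. g w = x} / card \<Omega>"
  shows "\<H>(X) = uent b \<Omega> g"
proof -
  have "g w \<in> X ` space M" if "w \<in> \<Omega>" for w
  proof (rule ccontr)
    assume "g w \<notin> X ` space M"
    then have "card {w'\<in>\<Omega>. g w' = g w} / card \<Omega> = 0" using pr_eq_0[of "g w" X M] P by simp
    then show False using that \<Omega> by auto
  qed
  then have "uent b \<Omega> g = - (\<Sum>x\<in>X ` space M. pr M X x * log b (pr M X x))"
    using uent_eq_sum[OF \<Omega>, of g "X ` space M"] simple_functionD(1)[OF X] P by auto
  then show ?thesis using entropy_simple_distributed[OF simple_distributed_pr[OF X]] by simp
qed

text \<open>Bridge from library entropies to counting entropies. For \<open>y\<close> of probability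
  0 the assumption says nothing about \<open>g y\<close>, but such terms carry weight 0.\<close>

lemma conditional_entropy_uniform_pr:
  assumes X: "simple_function M X" and Y: "simple_function M Y" and \<Omega>: "finite \<Omega>"
    and P: "\<And>x y. pr M (\<lambda>\<omega>. (X \<omega>, Y \<omega>)) (x, y) = pr M Y y * (card {w\<in>\<Omega>. g y w = x} / card \<Omega>)"
  shows "\<H>(X | Y) = (\<Sum>y\<in>Y ` space M. pr M Y y * uent b \<Omega> (g y))"
proof -
  let ?c = "\<lambda>x y. card {w\<in>\<Omega>. g y w = x} / real (card \<Omega>)"
  have "\<H>(X | Y) = - (\<Sum>x\<in>X ` space M. \<Sum>y\<in>Y ` space M. pr M Y y * ?c x y * log b (pr M Y y * ?c x y / pr M Y y))"
    unfolding conditional_entropy_pr[OF X Y] P by (simp add: sum.cartesian_product)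
  also have "\<dots> = - (\<Sum>y\<in>Y ` space M. \<Sum>x\<in>X ` space M. pr M Y y * ?c x y * log b (pr M Y y * ?c x y / pr M Y y))"
    by (subst sum.swap) simp
  also have "\<dots> = (\<Sum>y\<in>Y ` space M. - (\<Sum>x\<in>X ` space M. pr M Y y * ?c x y * log b (pr M Y y * ?c x y / pr M Y y)))"
    by (simp add: sum_negf)
  also have "\<dots> = (\<Sum>y\<in>Y ` space M. pr M Y y * uent b \<Omega> (g y))"
  proof (intro sum.cong refl)
    fix y
    show "- (\<Sum>x\<in>X ` space M. pr M Y y * ?c x y * log b (pr M Y y * ?c x y / pr M Y y)) = pr M Y y * uent b \<Omega> (g y)"
    proof (cases "pr M Y y = 0")
      case False
      have "g y w \<in> X ` space M" if "w \<in> \<Omega>" for w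
      proof (rule ccontr)
        assume *: "g y w \<notin> X ` space M"
        have "(g y w, y) \<notin> (\<lambda>\<omega>. (X \<omega>, Y \<omega>)) ` space M" using * by auto
        then have "pr M (\<lambda>\<omega>. (X \<omega>, Y \<omega>)) (g y w, y) = 0" by (rule pr_eq_0)
        then have "?c (g y w) y = 0" using P False by simp
        then show False using that \<Omega> by auto
      qed
      then have "uent b \<Omega> (g y) = - (\<Sum>x\<in>X ` space M. ?c x y * log b (?c x y))"
        using simple_functionD(1)[OF X] by (intro uent_eq_sum \<Omega>) auto
      then show ?thesis using False by (simp add: sum_distrib_left mult_ac)
    qed simp
  qed
  finally show ?thesis .
qed

end

section \<open>From schemes to answer functions\<close>

lemma simple_function_restrict:
  assumes "finite A" "\<And>i. i \<in> A \<Longrightarrow> simple_function M (X i)"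
  shows "simple_function M (\<lambda>\<omega>. \<lambda>i\<in>A. X i \<omega>)"
  using assms
proof induction
  case empty
  show ?case by simp
next
  case (insert a A)
  define h where "h x g = (\<lambda>i\<in>insert a A. if i = a then x else g i)" for x and g :: "'a \<Rightarrow> 'c"
  have "simple_function M (\<lambda>\<omega>. h (X a \<omega>) (\<lambda>i\<in>A. X i \<omega>))"
  proof (rule simple_function_compose2[where h=h])
    show "simple_function M (X a)" using insert.prems by blast
    show "simple_function M (\<lambda>\<omega>. \<lambda>i\<in>A. X i \<omega>)" using insert.prems by (intro insert.IH) blast
  qed
  moreover have "h (X a \<omega>) (\<lambda>i\<in>A. X i \<omega>) = (\<lambda>i\<in>insert a A. X i \<omega>)" for \<omega>
    unfolding h_def by (rule restrict_ext) auto
  ultimately show ?case by (simp only:)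
qed

lemma restrict_eq_iff: "(\<lambda>i\<in>A. f i) = (\<lambda>i\<in>A. g i) \<longleftrightarrow> (\<forall>i\<in>A. f i = g i)"
  by (metis restrict_apply' restrict_ext)

lemma nths_map_upt: "nths (map h [0..<n]) S = map h (filter (\<lambda>t. t \<in> S) [0..<n])"
  by (induction n) (simp_all add: nths_append)

lemma (in prob_space) indep_vars_pr:
  assumes "indep_vars (\<lambda>_. count_space UNIV) X J" "finite J" "J \<noteq> {}"
  shows "prob {\<omega> \<in> space M. \<forall>i\<in>J. X i \<omega> = x i} = (\<Prod>i\<in>J. pr M (X i) (x i))"
proof -
  have "{\<omega> \<in> space M. \<forall>i\<in>J. X i \<omega> = x i} = (\<Inter>i\<in>J. X i -` {x i} \<inter> space M)"
    using assms(3) by auto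
  then show ?thesis
    using indep_varsD_finite[OF assms(1,3,2), of "\<lambda>i. {x i}"] by (simp add: pr_def vimage_singleton)
qed

text \<open>Only the assumptions on the files are collected, since the resulting packet and content
  entropies are used both for arbitrary schemes and for verifying the storage condition of
  constructed ones. \<open>Wt\<close> below is the random array of all symbols.\<close>

locale file_source =
  fixes K :: nat and s :: "('w, 'f::{field,finite}, 'i, 'q, 'a) pir"
  assumes sample_prob: "prob_space (sample s)" and files: "uniform_files K s" and K_pos: "1 \<le> K"
begin

abbreviation "M \<equiv> sample s"
abbreviation "L \<equiv> file_len s"
abbreviation "I \<equiv> {1..K} \<times> {..<L}"
abbreviation "\<Omega> \<equiv> I \<rightarrow>\<^sub>E (UNIV :: 'f set)"

definition "Wt \<omega> = (\<lambda>x\<in>I. file_var s (fst x) \<omega> ! snd x)"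
definition "file_of w k = map (\<lambda>t. w (k, t)) [0..<L]"
definition "stored_of n w = restrict (\<lambda>(k, i). nths (file_of w k) (packet_pos s k i)) ({1..K} \<times> stored s n)"

end

sublocale file_source \<subseteq> information_space "sample s" "real CARD('f)"
  using sample_prob one_less_card_field[where 'f='f]
  by (auto simp: information_space_def information_space_axioms_def)

context file_source
begin

lemma L_pos: "0 < L" using files by (simp add: uniform_files_def)

lemma one_K: "1 \<in> {1..K}" using K_pos by simp

lemma fin\<Omega>: "finite \<Omega>" by (intro finite_PiE) auto

lemma card\<Omega>: "card \<Omega> = CARD('f) ^ (K * L)"
  by (subst card_PiE) (simp_all add: card_cartesian_product)

lemma card\<Omega>_pos: "0 < real (card \<Omega>)"
  unfolding card\<Omega> by simp

lemma file_simple: "k \<in> {1..K} \<Longrightarrow> simple_function M (file_var s k)"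
  using files by (auto simp: uniform_files_def)

lemma all_files_simple: "simple_function M (all_files K s)"
  unfolding all_files_def[abs_def] by (intro simple_function_restrict file_simple) auto

lemma Wt_simple: "simple_function M Wt"
  unfolding Wt_def[abs_def]
proof (rule simple_function_restrict)
  fix x assume "x \<in> I"
  then show "simple_function M (\<lambda>\<omega>. file_var s (fst x) \<omega> ! snd x)"
    by (intro simple_function_compose1[OF file_simple, of "fst x" "\<lambda>l. l ! snd x"]) auto
qed simp

lemma file_length: "k \<in> {1..K} \<Longrightarrow> \<omega> \<in> space M \<Longrightarrow> length (file_var s k \<omega>) = L"
  using files by (auto simp: uniform_files_def)

lemma file_var_Wt: "k \<in> {1..K} \<Longrightarrow> \<omega> \<in> space M \<Longrightarrow> file_var s k \<omega> = file_of (Wt \<omega>) k"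
  using file_length by (intro nth_equalityI) (auto simp: file_of_def Wt_def)

lemma Wt_in: "Wt \<omega> \<in> \<Omega>"
  by (auto simp: Wt_def)

lemma content_Wt: "\<omega> \<in> space M \<Longrightarrow> content K s n \<omega> = stored_of n (Wt \<omega>)"
  unfolding content_def stored_of_def by (auto simp: packet_def file_var_Wt)

lemma content_simple: "simple_function M (content K s n)"
  using simple_function_compose1[OF Wt_simple, of "stored_of n"] content_Wt
  by (subst simple_function_cong[where g="\<lambda>\<omega>. stored_of n (Wt \<omega>)"]) auto

lemma Wt_eq_iff:
  assumes "\<omega> \<in> space M" "w \<in> \<Omega>"
  shows "Wt \<omega> = w \<longleftrightarrow> all_files K s \<omega> = (\<lambda>k\<in>{1..K}. file_of w k)"
proof
  assume "Wt \<omega> = w"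
  then show "all_files K s \<omega> = (\<lambda>k\<in>{1..K}. file_of w k)"
    using file_var_Wt[OF _ assms(1)] by (auto simp: all_files_def)
next
  assume *: "all_files K s \<omega> = (\<lambda>k\<in>{1..K}. file_of w k)"
  show "Wt \<omega> = w"
  proof (rule PiE_ext[OF Wt_in assms(2)])
    fix x assume x: "x \<in> I"
    have "file_var s (fst x) \<omega> = file_of w (fst x)"
      using fun_cong[OF *, of "fst x"] x by (auto simp: all_files_def split: if_splits)
    then show "Wt \<omega> x = w x" using x by (cases x) (auto simp: Wt_def file_of_def)
  qed
qed

text \<open>Independence of the files gives a product over \<open>k\<close>, independence of the
  symbols one over \<open>t\<close>. From here on uniformity of the array is the only fact needed
  about the distribution of the files.\<close>

lemma pr_Wt:
  assumes w: "w \<in> \<Omega>"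
  shows "pr M Wt w = 1 / card \<Omega>"
proof -
  have sym: "pr M (\<lambda>\<omega>. file_var s k \<omega> ! t) x = 1 / CARD('f)" if k: "k \<in> {1..K}" and t: "t < L" for k t x
  proof -
    have "distr M (count_space UNIV) (\<lambda>\<omega>. file_var s k \<omega> ! t) = uniform_count_measure UNIV"
      using files k t by (simp add: uniform_files_def)
    then have "measure (distr M (count_space UNIV) (\<lambda>\<omega>. file_var s k \<omega> ! t)) {x} = 1 / CARD('f)"
      by (simp add: measure_uniform_count_measure)
    then show ?thesis
      using measure_distr_singleton[OF simple_function_compose1[OF file_simple[OF k], of "\<lambda>l. l ! t"]] by simp
  qed
  have fl: "pr M (file_var s k) (file_of w k) = (1 / CARD('f)) ^ L" if k: "k \<in> {1..K}" for k
  proof -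
    have ind: "indep_vars (\<lambda>_. count_space UNIV) (\<lambda>t \<omega>. file_var s k \<omega> ! t) {..<L}"
      using files k by (auto simp: uniform_files_def)
    have "{\<omega> \<in> space M. file_var s k \<omega> = file_of w k} = {\<omega> \<in> space M. \<forall>t\<in>{..<L}. file_var s k \<omega> ! t = w (k, t)}"
      using file_length[OF k] by (auto simp: list_eq_iff_nth_eq file_of_def)
    then have "pr M (file_var s k) (file_of w k) = (\<Prod>t<L. pr M (\<lambda>\<omega>. file_var s k \<omega> ! t) (w (k, t)))"
      using indep_vars_pr[OF ind, of "\<lambda>t. w (k, t)"] L_pos by (auto simp: pr_def)
    then show ?thesis using sym[OF k] by simp
  qed
  have ind: "indep_vars (\<lambda>_. count_space UNIV) (file_var s) {1..K}"
    using files by (auto simp: uniform_files_def)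
  have "{\<omega> \<in> space M. Wt \<omega> = w} = {\<omega> \<in> space M. \<forall>k\<in>{1..K}. file_var s k \<omega> = file_of w k}"
    using Wt_eq_iff[OF _ w] unfolding all_files_def restrict_eq_iff by blast
  then have "pr M Wt w = (\<Prod>k\<in>{1..K}. pr M (file_var s k) (file_of w k))"
    using indep_vars_pr[OF ind, of "file_of w"] K_pos by (simp add: pr_def)
  also have "\<dots> = (1 / CARD('f)) ^ (K * L)"
    using fl by (simp add: power_mult mult.commute[of K])
  finally show ?thesis unfolding card\<Omega> by (simp add: power_one_over)
qed

lemma Wt_image: "Wt ` space M = \<Omega>"
proof
  show "Wt ` space M \<subseteq> \<Omega>" using Wt_in by blast
  show "\<Omega> \<subseteq> Wt ` space M"
  proof
    fix w assume "w \<in> \<Omega>"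
    then have "pr M Wt w \<noteq> 0" using card\<Omega>_pos by (simp add: pr_Wt)
    then show "w \<in> Wt ` space M" using pr_eq_0 by fast
  qed
qed

lemma ent_Wt: "ent s (\<lambda>\<omega>. g (Wt \<omega>)) = uent CARD('f) \<Omega> g"
proof -
  have "pr M (\<lambda>\<omega>. g (Wt \<omega>)) x = card {w\<in>\<Omega>. g w = x} / card \<Omega>" for x
    unfolding pr_marginal[OF Wt_simple] Wt_image by (simp add: pr_Wt)
  then show ?thesis
    unfolding ent_def by (intro entropy_uniform_pr fin\<Omega> simple_function_compose1[OF Wt_simple])
qed

lemma ent_function_of_Wt:
  assumes "\<And>\<omega>. \<omega> \<in> space M \<Longrightarrow> X \<omega> = g (Wt \<omega>)"
  shows "ent s X = uent CARD('f) \<Omega> g"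
proof -
  have im: "X ` space M = (\<lambda>\<omega>. g (Wt \<omega>)) ` space M" using assms by auto
  have "ent s X = ent s (\<lambda>\<omega>. g (Wt \<omega>))"
    unfolding ent_def entropy_def im using assms
    by (intro arg_cong[where f=uminus] arg_cong[where f="KL_divergence _ _"] distr_cong) auto
  then show ?thesis by (simp add: ent_Wt)
qed

lemma restrict_nths_eq:
  assumes "S \<subseteq> {..<L}"
  shows "nths (file_of w k) S = nths (file_of w' k) S \<longleftrightarrow> (\<forall>t\<in>S. w (k, t) = w' (k, t))"
  using assms by (auto simp: file_of_def nths_map_upt)

lemma ent_packet:
  assumes k: "k \<in> {1..K}" and S: "packet_pos s k i \<subseteq> {..<L}"
  shows "ent s (packet s k i) = card (packet_pos s k i)"
proof -
  let ?S = "packet_pos s k i"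
  have "ent s (packet s k i) = uent CARD('f) \<Omega> (\<lambda>w. nths (file_of w k) ?S)"
    by (rule ent_function_of_Wt) (simp add: packet_def file_var_Wt[OF k])
  also have "\<dots> = uent CARD('f) \<Omega> (\<lambda>w. restrict w ({k} \<times> ?S))"
    using one_less_card_field[where 'f='f] fin\<Omega>
  proof (intro uent_cong determinesI)
    fix w w' :: "nat \<times> nat \<Rightarrow> 'f"
    assume "restrict w ({k} \<times> ?S) = restrict w' ({k} \<times> ?S)"
    then show "nths (file_of w k) ?S = nths (file_of w' k) ?S" unfolding restrict_nths_eq[OF S] restrict_eq_iff by blast
  next
    fix w w' :: "nat \<times> nat \<Rightarrow> 'f"
    assume "nths (file_of w k) ?S = nths (file_of w' k) ?S"
    then show "restrict w ({k} \<times> ?S) = restrict w' ({k} \<times> ?S)" unfolding restrict_nths_eq[OF S] by auto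
  qed auto
  also have "\<dots> = card ({k} \<times> ?S)"
    using S k by (intro uent_restrict one_less_card_field) auto
  finally show ?thesis by (simp only: card_cartesian_product) simp
qed

definition "cells n = {(j, t). j \<in> {1..K} \<and> t \<in> (\<Union>i\<in>stored s n. packet_pos s j i)}"

lemma stored_of_eq_iff:
  assumes sub: "\<And>k i. k \<in> {1..K} \<Longrightarrow> i \<in> stored s n \<Longrightarrow> packet_pos s k i \<subseteq> {..<L}"
  shows "stored_of n w = stored_of n w' \<longleftrightarrow> restrict w (cells n) = restrict w' (cells n)"
proof -
  have "stored_of n w = stored_of n w' \<longleftrightarrow>
      (\<forall>k\<in>{1..K}. \<forall>i\<in>stored s n. nths (file_of w k) (packet_pos s k i) = nths (file_of w' k) (packet_pos s k i))"
    unfolding stored_of_def restrict_eq_iff by auto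
  also have "\<dots> \<longleftrightarrow> (\<forall>k\<in>{1..K}. \<forall>i\<in>stored s n. \<forall>t\<in>packet_pos s k i. w (k, t) = w' (k, t))"
    using sub by (intro ball_cong refl restrict_nths_eq)
  also have "\<dots> \<longleftrightarrow> restrict w (cells n) = restrict w' (cells n)"
    unfolding restrict_eq_iff cells_def by blast
  finally show ?thesis .
qed

text \<open>The conditions are stated separately, and not as \<open>valid_storage\<close>, because
  the lemma also helps to establish \<open>valid_storage\<close> for constructed schemes.\<close>

lemma ent_content:
  assumes fin: "finite (stored s n)"
    and sub: "\<And>k i. k \<in> {1..K} \<Longrightarrow> i \<in> stored s n \<Longrightarrow> packet_pos s k i \<subseteq> {..<L}"
    and disj: "\<And>k. k \<in> {1..K} \<Longrightarrow> disjoint_family_on (packet_pos s k) (stored s n)"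
    and size: "\<And>k i. k \<in> {1..K} \<Longrightarrow> i \<in> stored s n \<Longrightarrow> card (packet_pos s k i) = card (packet_pos s 1 i)"
  shows "ent s (content K s n) = K * (\<Sum>i\<in>stored s n. real (card (packet_pos s 1 i)))"
proof -
  have cells: "cells n \<subseteq> I" unfolding cells_def using sub by blast
  have finpos: "finite (packet_pos s k i)" if "k \<in> {1..K}" "i \<in> stored s n" for k i
    using sub[OF that] finite_subset by blast
  have "ent s (content K s n) = uent CARD('f) \<Omega> (stored_of n)"
    by (rule ent_function_of_Wt) (rule content_Wt)
  also have "\<dots> = uent CARD('f) \<Omega> (\<lambda>w. restrict w (cells n))"
    using one_less_card_field[where 'f='f] fin\<Omega>
    by (intro uent_cong determinesI) (simp_all only: stored_of_eq_iff[OF sub] of_nat_1 flip: of_nat_less_iff)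
  also have "\<dots> = card (cells n)"
    using cells by (intro uent_restrict one_less_card_field) auto
  also have "cells n = Sigma {1..K} (\<lambda>k. \<Union>i\<in>stored s n. packet_pos s k i)"
    by (auto simp: cells_def)
  also have "card \<dots> = (\<Sum>k\<in>{1..K}. card (\<Union>i\<in>stored s n. packet_pos s k i))"
    using fin finpos by (intro card_SigmaI ballI finite_UN_I) auto
  also have "\<dots> = (\<Sum>k\<in>{1..K}. \<Sum>i\<in>stored s n. card (packet_pos s 1 i))"
  proof (rule sum.cong[OF refl])
    fix k assume k: "k \<in> {1..K}"
    have "card (\<Union>i\<in>stored s n. packet_pos s k i) = (\<Sum>i\<in>stored s n. card (packet_pos s k i))"
      using fin finpos[OF k] disj[OF k] by (intro card_UN_disjoint) (auto simp: disjoint_family_on_def)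
    then show "card (\<Union>i\<in>stored s n. packet_pos s k i) = (\<Sum>i\<in>stored s n. card (packet_pos s 1 i))"
      using size[OF k] by simp
  qed
  finally show ?thesis by simp
qed

end

section \<open>Arbitrary schemes as instances of the counting model\<close>

locale sc_scheme =
  fixes \<mu> :: real and N K :: nat and s :: "('w, 'f::{field,finite}, 'i, 'q, 'a) pir"
  assumes scheme: "sc_pir_scheme \<mu> N K s" and K_pos': "1 \<le> K"

sublocale sc_scheme \<subseteq> file_source K s
  using scheme K_pos' unfolding sc_pir_scheme_def by (intro file_source.intro) blast+

context sc_scheme
begin

text \<open>
  The answer is almost surely a function of query and stored content, and by privacy one function serves
  all desired files, so reading it off at \<open>\<theta> = 1\<close> is enough. It is unspecified (an arbitrary \<open>SOME\<close>)
  on queries of probability zero.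
\<close>

definition "\<phi> n x w = (SOME a. 0 < pr M (\<lambda>\<omega>. (query s 1 n \<omega>, answer s 1 n \<omega>, content K s n \<omega>)) (x, a, stored_of n w))"
definition "Q \<theta> = {q \<in> all_queries N s \<theta> ` space M. 0 < pr M (all_queries N s \<theta>) q}"

lemma storage: "valid_storage \<mu> N K s"
  and retrieval: "valid_retrieval N K s" and private': "private_retrieval N K s"
  using scheme by (auto simp: sc_pir_scheme_def)

lemma query_simple: "\<theta> \<in> {1..K} \<Longrightarrow> n \<in> {1..N} \<Longrightarrow> simple_function M (query s \<theta> n)"
  and answer_simple: "\<theta> \<in> {1..K} \<Longrightarrow> n \<in> {1..N} \<Longrightarrow> simple_function M (answer s \<theta> n)"
  using retrieval by (auto simp: valid_retrieval_def)

lemma all_queries_simple: "\<theta> \<in> {1..K} \<Longrightarrow> simple_function M (all_queries N s \<theta>)"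
  unfolding all_queries_def[abs_def] by (intro simple_function_restrict query_simple) auto

lemma all_answers_simple: "\<theta> \<in> {1..K} \<Longrightarrow> simple_function M (all_answers N s \<theta>)"
  unfolding all_answers_def[abs_def] by (intro simple_function_restrict answer_simple) auto

text \<open>Vanishing mutual information means that the joint law factors, and the array takes a
  value exactly when the files take the corresponding values. Hence every array occurs together with
  every query vector of positive probability.\<close>

lemma pr_query_Wt:
  assumes \<theta>: "\<theta> \<in> {1..K}" and w: "w \<in> \<Omega>"
  shows "pr M (\<lambda>\<omega>. (all_queries N s \<theta> \<omega>, Wt \<omega>)) (q, w) = pr M (all_queries N s \<theta>) q / card \<Omega>"
proof -
  let ?af = "\<lambda>k\<in>{1..K}. file_of w k"
  have "mut_inf s (all_queries N s \<theta>) (all_files K s) = 0"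
    using retrieval \<theta> by (auto simp: valid_retrieval_def)
  then have "pr M (\<lambda>\<omega>. (all_queries N s \<theta> \<omega>, all_files K s \<omega>)) (q, ?af)
      = pr M (all_queries N s \<theta>) q * pr M (all_files K s) ?af"
    unfolding mut_inf_def by (rule mutual_information_eq_0D[OF all_queries_simple[OF \<theta>] all_files_simple])
  moreover have "pr M (all_files K s) ?af = pr M Wt w"
    unfolding pr_def using Wt_eq_iff[OF _ w] by (intro arg_cong[where f=prob]) auto
  moreover have "pr M (\<lambda>\<omega>. (all_queries N s \<theta> \<omega>, all_files K s \<omega>)) (q, ?af)
      = pr M (\<lambda>\<omega>. (all_queries N s \<theta> \<omega>, Wt \<omega>)) (q, w)"
    unfolding pr_def using Wt_eq_iff[OF _ w] by (intro arg_cong[where f=prob]) auto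
  ultimately show ?thesis by (simp add: pr_Wt[OF w])
qed

lemma all_queries_nth: "n \<in> {1..N} \<Longrightarrow> all_queries N s \<theta> \<omega> n = query s \<theta> n \<omega>"
  by (simp add: all_queries_def)

lemma pr_query_Wt_compose:
  assumes \<theta>: "\<theta> \<in> {1..K}"
  shows "pr M (\<lambda>\<omega>. G (all_queries N s \<theta> \<omega>) (Wt \<omega>)) v
    = (\<Sum>q\<in>all_queries N s \<theta> ` space M. pr M (all_queries N s \<theta>) q * (card {w\<in>\<Omega>. G q w = v} / card \<Omega>))"
proof -
  let ?Z = "\<lambda>\<omega>. (all_queries N s \<theta> \<omega>, Wt \<omega>)"
  let ?B = "all_queries N s \<theta> ` space M \<times> \<Omega>"
  have Z: "simple_function M ?Z" by (rule simple_function_Pair[OF all_queries_simple[OF \<theta>] Wt_simple])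
  have finB: "finite ?B" using simple_functionD(1)[OF all_queries_simple[OF \<theta>]] fin\<Omega> by blast
  have "pr M (\<lambda>\<omega>. G (all_queries N s \<theta> \<omega>) (Wt \<omega>)) v = (\<Sum>z | z \<in> ?Z ` space M \<and> (\<lambda>(q, w). G q w) z = v. pr M ?Z z)"
    using pr_marginal[OF Z, of "\<lambda>(q, w). G q w"] by simp
  also have "\<dots> = (\<Sum>z | z \<in> ?B \<and> (\<lambda>(q, w). G q w) z = v. pr M ?Z z)"
  proof (rule sum.mono_neutral_left)
    show "finite {z. z \<in> ?B \<and> (\<lambda>(q, w). G q w) z = v}" using finB by simp
    show "{z. z \<in> ?Z ` space M \<and> (\<lambda>(q, w). G q w) z = v} \<subseteq> {z. z \<in> ?B \<and> (\<lambda>(q, w). G q w) z = v}"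
      using Wt_in by blast
    show "\<forall>z\<in>{z. z \<in> ?B \<and> (\<lambda>(q, w). G q w) z = v} - {z. z \<in> ?Z ` space M \<and> (\<lambda>(q, w). G q w) z = v}. pr M ?Z z = 0"
      by (intro ballI pr_eq_0) blast
  qed
  also have "\<dots> = (\<Sum>z\<in>?B. if (\<lambda>(q, w). G q w) z = v then pr M ?Z z else 0)"
    using finB by (simp add: sum.inter_filter)
  also have "\<dots> = (\<Sum>q\<in>all_queries N s \<theta> ` space M. \<Sum>w\<in>\<Omega>. if G q w = v then pr M ?Z (q, w) else 0)"
    unfolding sum.cartesian_product by (intro sum.cong) auto
  also have "\<dots> = (\<Sum>q\<in>all_queries N s \<theta> ` space M. \<Sum>w\<in>\<Omega>. if G q w = v then pr M (all_queries N s \<theta>) q / card \<Omega> else 0)"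
    by (intro sum.cong) (auto simp: pr_query_Wt[OF \<theta>])
  also have "\<dots> = (\<Sum>q\<in>all_queries N s \<theta> ` space M. pr M (all_queries N s \<theta>) q * (card {w\<in>\<Omega>. G q w = v} / card \<Omega>))"
    using fin\<Omega> by (intro sum.cong refl) (simp add: sum.If_cases Int_def)
  finally show ?thesis .
qed

lemma triple_simple:
  "\<theta> \<in> {1..K} \<Longrightarrow> n \<in> {1..N} \<Longrightarrow> simple_function M (\<lambda>\<omega>. (query s \<theta> n \<omega>, answer s \<theta> n \<omega>, content K s n \<omega>))"
  by (intro simple_function_Pair query_simple answer_simple content_simple)

lemma pr_triple:
  assumes "\<theta> \<in> {1..K}" "\<theta>' \<in> {1..K}" "n \<in> {1..N}"
  shows "pr M (\<lambda>\<omega>. (query s \<theta> n \<omega>, answer s \<theta> n \<omega>, content K s n \<omega>))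
    = pr M (\<lambda>\<omega>. (query s \<theta>' n \<omega>, answer s \<theta>' n \<omega>, content K s n \<omega>))"
proof
  fix v
  have "distr M (count_space UNIV) (\<lambda>\<omega>. (query s \<theta> n \<omega>, answer s \<theta> n \<omega>, content K s n \<omega>))
    = distr M (count_space UNIV) (\<lambda>\<omega>. (query s \<theta>' n \<omega>, answer s \<theta>' n \<omega>, content K s n \<omega>))"
    using private' assms unfolding private_retrieval_def by blast
  then show "pr M (\<lambda>\<omega>. (query s \<theta> n \<omega>, answer s \<theta> n \<omega>, content K s n \<omega>)) v
    = pr M (\<lambda>\<omega>. (query s \<theta>' n \<omega>, answer s \<theta>' n \<omega>, content K s n \<omega>)) v"
    using measure_distr_singleton[OF triple_simple[OF assms(1,3)], of v]
      measure_distr_singleton[OF triple_simple[OF assms(2,3)], of v] by simp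
qed

text \<open>Marginal of the law of query, answer and content. The two sample images may differ, so
  both sums are extended to their union by terms of probability 0.\<close>

lemma pr_query_private:
  assumes "\<theta> \<in> {1..K}" "\<theta>' \<in> {1..K}" "n \<in> {1..N}"
  shows "pr M (query s \<theta> n) x = pr M (query s \<theta>' n) x"
proof -
  have "(\<Sum>v | v \<in> X ` space M \<and> fst v = x. pr M X v) = (\<Sum>v | v \<in> X ` space M \<union> Y ` space M \<and> fst v = x. pr M X v)"
    if "simple_function M X" "simple_function M Y" for X Y :: "'w \<Rightarrow> 'q \<times> 'a \<times> (nat \<times> 'i \<Rightarrow> 'f list)"
  proof (rule sum.mono_neutral_left)
    show "finite {v. v \<in> X ` space M \<union> Y ` space M \<and> fst v = x}"
      using simple_functionD(1)[OF that(1)] simple_functionD(1)[OF that(2)] by simp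
    show "\<forall>v\<in>{v. v \<in> X ` space M \<union> Y ` space M \<and> fst v = x} - {v. v \<in> X ` space M \<and> fst v = x}. pr M X v = 0"
      by (intro ballI pr_eq_0) blast
  qed blast
  note * = this[OF triple_simple[OF assms(1,3)] triple_simple[OF assms(2,3)]]
    this[OF triple_simple[OF assms(2,3)] triple_simple[OF assms(1,3)]]
  show ?thesis
    using * pr_marginal[OF triple_simple[OF assms(1,3)], of fst x] pr_marginal[OF triple_simple[OF assms(2,3)], of fst x]
    unfolding pr_triple[OF assms] by (simp add: Un_commute)
qed

text \<open>For desired file 1, query and content leave only one answer of positive probability. By
  privacy the triple seen for \<theta> almost surely has positive probability there too, so its
  answer is the one picked by \<open>\<phi>\<close>.\<close>

lemma answer_AE:
  assumes \<theta>: "\<theta> \<in> {1..K}" and n: "n \<in> {1..N}"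
  shows "AE \<omega> in M. answer s \<theta> n \<omega> = \<phi> n (query s \<theta> n \<omega>) (Wt \<omega>)"
proof -
  let ?T = "\<lambda>\<theta> \<omega>. (query s \<theta> n \<omega>, answer s \<theta> n \<omega>, content K s n \<omega>)"
  have c0: "cond_ent s (answer s 1 n) (\<lambda>\<omega>. (query s 1 n \<omega>, content K s n \<omega>)) = 0"
    using retrieval one_K n unfolding valid_retrieval_def by blast
  have swap: "pr M (\<lambda>\<omega>. (answer s 1 n \<omega>, query s 1 n \<omega>, content K s n \<omega>)) (a, x, c) = pr M (?T 1) (x, a, c)" for x a c
    unfolding pr_def by (intro arg_cong[where f=prob]) auto
  have fn: "a = a'" if "0 < pr M (?T 1) (x, a, c)" "0 < pr M (?T 1) (x, a', c)" for x a a' c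
    using conditional_entropy_eq_0D[OF answer_simple[OF one_K n] simple_function_Pair[OF query_simple[OF one_K n] content_simple]
        c0[unfolded cond_ent_def], of a "(x, c)" a'] that unfolding swap by simp
  have "AE \<omega> in M. 0 < pr M (?T \<theta>) (?T \<theta> \<omega>)" by (rule AE_pr_pos[OF triple_simple[OF \<theta> n]])
  moreover have "AE \<omega> in M. \<omega> \<in> space M" by simp
  ultimately show ?thesis
  proof eventually_elim
    case (elim \<omega>)
    have pos: "0 < pr M (?T 1) (query s \<theta> n \<omega>, answer s \<theta> n \<omega>, stored_of n (Wt \<omega>))"
      using elim content_Wt[of \<omega> n] unfolding pr_triple[OF one_K \<theta> n] by simp
    have "0 < pr M (?T 1) (query s \<theta> n \<omega>, \<phi> n (query s \<theta> n \<omega>) (Wt \<omega>), stored_of n (Wt \<omega>))"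
      unfolding \<phi>_def by (rule someI[where P="\<lambda>a. 0 < pr M (?T 1) (query s \<theta> n \<omega>, a, stored_of n (Wt \<omega>))", OF pos])
    then show ?case using fn pos by blast
  qed
qed

lemma sum_Q:
  assumes \<theta>: "\<theta> \<in> {1..K}"
  shows "(\<Sum>q\<in>Q \<theta>. pr M (all_queries N s \<theta>) q * h q) = (\<Sum>q\<in>all_queries N s \<theta> ` space M. pr M (all_queries N s \<theta>) q * h q)"
proof -
  have fin: "finite (all_queries N s \<theta> ` space M)" by (rule simple_functionD(1)[OF all_queries_simple[OF \<theta>]])
  have sub: "Q \<theta> \<subseteq> all_queries N s \<theta> ` space M" unfolding Q_def by blast
  have zero: "\<forall>q\<in>all_queries N s \<theta> ` space M - Q \<theta>. pr M (all_queries N s \<theta>) q * h q = 0"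
  proof
    fix q assume "q \<in> all_queries N s \<theta> ` space M - Q \<theta>"
    then have "\<not> 0 < pr M (all_queries N s \<theta>) q" unfolding Q_def by blast
    then have "pr M (all_queries N s \<theta>) q = 0" using pr_nonneg[of M "all_queries N s \<theta>" q] by linarith
    then show "pr M (all_queries N s \<theta>) q * h q = 0" by simp
  qed
  show ?thesis by (rule sum.mono_neutral_left[OF fin sub zero])
qed

lemma sum_Q_nth:
  assumes \<theta>: "\<theta> \<in> {1..K}" and n: "n \<in> {1..N}"
  shows "(\<Sum>q\<in>Q \<theta>. pr M (all_queries N s \<theta>) q * h (q n)) = (\<Sum>x\<in>query s \<theta> n ` space M. pr M (query s \<theta> n) x * h x)"
  unfolding sum_Q[OF \<theta>]
  using sum_pr_compose[OF all_queries_simple[OF \<theta>], of h "\<lambda>q. q n"] by (simp add: all_queries_nth[OF n])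

text \<open>Replacing the answer by \<open>\<phi>\<close> changes events by null sets only. Given
  the query \<open>x\<close> the answer is then distributed like \<open>\<phi> n x\<close> on
  uniform arrays, and its conditional entropy is a mean of counting entropies.\<close>

lemma cond_ent_answer:
  assumes \<theta>: "\<theta> \<in> {1..K}" and n: "n \<in> {1..N}"
  shows "cond_ent s (answer s \<theta> n) (query s \<theta> n)
    = (\<Sum>q\<in>Q \<theta>. pr M (all_queries N s \<theta>) q * uent CARD('f) \<Omega> (\<phi> n (q n)))"
proof -
  have "pr M (\<lambda>\<omega>. (answer s \<theta> n \<omega>, query s \<theta> n \<omega>)) (a, x) =
      pr M (query s \<theta> n) x * (card {w\<in>\<Omega>. \<phi> n x w = a} / card \<Omega>)" for a x
  proof -
    let ?G = "\<lambda>q w. (\<phi> n (q n) w, q n)"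
    have "pr M (\<lambda>\<omega>. (answer s \<theta> n \<omega>, query s \<theta> n \<omega>)) (a, x) = pr M (\<lambda>\<omega>. ?G (all_queries N s \<theta> \<omega>) (Wt \<omega>)) (a, x)"
      unfolding pr_def
    proof (rule finite_measure_eq_AE)
      show "AE \<omega> in M. (\<omega> \<in> {\<omega> \<in> space M. (answer s \<theta> n \<omega>, query s \<theta> n \<omega>) = (a, x)}) =
         (\<omega> \<in> {\<omega> \<in> space M. ?G (all_queries N s \<theta> \<omega>) (Wt \<omega>) = (a, x)})"
        using answer_AE[OF \<theta> n] by eventually_elim (auto simp: all_queries_nth[OF n])
      show "{\<omega> \<in> space M. (answer s \<theta> n \<omega>, query s \<theta> n \<omega>) = (a, x)} \<in> events"
        using simple_function_events[OF simple_function_Pair[OF answer_simple[OF \<theta> n] query_simple[OF \<theta> n]], of "\<lambda>v. v = (a, x)"] .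
      show "{\<omega> \<in> space M. ?G (all_queries N s \<theta> \<omega>) (Wt \<omega>) = (a, x)} \<in> events"
        using simple_function_events[OF simple_function_Pair[OF all_queries_simple[OF \<theta>] Wt_simple],
          of "\<lambda>v. ?G (fst v) (snd v) = (a, x)"] by simp
    qed
    also have "\<dots> = (\<Sum>q\<in>all_queries N s \<theta> ` space M. pr M (all_queries N s \<theta>) q * (card {w\<in>\<Omega>. ?G q w = (a, x)} / card \<Omega>))"
      by (rule pr_query_Wt_compose[OF \<theta>])
    also have "\<dots> = (\<Sum>q\<in>all_queries N s \<theta> ` space M. pr M (all_queries N s \<theta>) q * (if q n = x then card {w\<in>\<Omega>. \<phi> n x w = a} / card \<Omega> else 0))"
      by (intro sum.cong refl arg_cong2[where f="(*)"]) (auto intro!: arg_cong[where f=card])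
    also have "\<dots> = (\<Sum>y\<in>query s \<theta> n ` space M. pr M (query s \<theta> n) y * (if y = x then card {w\<in>\<Omega>. \<phi> n x w = a} / card \<Omega> else 0))"
      using sum_Q_nth[OF \<theta> n, of "\<lambda>y. if y = x then card {w\<in>\<Omega>. \<phi> n x w = a} / card \<Omega> else 0"]
        sum_Q[OF \<theta>, of "\<lambda>q. if q n = x then card {w\<in>\<Omega>. \<phi> n x w = a} / card \<Omega> else 0"] by simp
    also have "\<dots> = (\<Sum>y\<in>query s \<theta> n ` space M. if y = x then pr M (query s \<theta> n) x * (card {w\<in>\<Omega>. \<phi> n x w = a} / card \<Omega>) else 0)"
      by (intro sum.cong) auto
    also have "\<dots> = pr M (query s \<theta> n) x * (card {w\<in>\<Omega>. \<phi> n x w = a} / card \<Omega>)"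
      using simple_functionD(1)[OF query_simple[OF \<theta> n]] pr_eq_0[of x "query s \<theta> n" M] by (simp add: sum.delta)
    finally show ?thesis .
  qed
  then show ?thesis
    unfolding cond_ent_def sum_Q_nth[OF \<theta> n, of "\<lambda>x. uent CARD('f) \<Omega> (\<phi> n x)"]
    by (intro conditional_entropy_uniform_pr answer_simple query_simple \<theta> n fin\<Omega>)
qed

text \<open>Realizes a possible query vector together with an arbitrary array at one sample point
  where the almost sure properties hold. It converts them into statements about all arrays.\<close>

lemma obtain_sample:
  assumes \<theta>: "\<theta> \<in> {1..K}" and q: "q \<in> Q \<theta>" and w: "w \<in> \<Omega>" and R: "AE \<omega> in M. R \<omega>"
  obtains \<omega> where "\<omega> \<in> space M" "all_queries N s \<theta> \<omega> = q" "Wt \<omega> = w"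
    "\<And>n. n \<in> {1..N} \<Longrightarrow> answer s \<theta> n \<omega> = \<phi> n (q n) w" "R \<omega>"
proof -
  have "AE \<omega> in M. \<forall>n\<in>{1..N}. answer s \<theta> n \<omega> = \<phi> n (query s \<theta> n \<omega>) (Wt \<omega>)"
    by (rule AE_finite_allI[OF finite_atLeastAtMost answer_AE[OF \<theta>]])
  with R have AE: "AE \<omega> in M. R \<omega> \<and> (\<forall>n\<in>{1..N}. answer s \<theta> n \<omega> = \<phi> n (query s \<theta> n \<omega>) (Wt \<omega>))"
    by eventually_elim blast
  have "0 < pr M (\<lambda>\<omega>. (all_queries N s \<theta> \<omega>, Wt \<omega>)) (q, w)"
    unfolding pr_query_Wt[OF \<theta> w] using q card\<Omega>_pos by (simp add: Q_def)
  from AE_pr_pos_ex[OF AE this simple_function_Pair[OF all_queries_simple[OF \<theta>] Wt_simple]]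
  obtain \<omega> where \<omega>: "\<omega> \<in> space M" "all_queries N s \<theta> \<omega> = q" "Wt \<omega> = w" "R \<omega>"
    "\<forall>n\<in>{1..N}. answer s \<theta> n \<omega> = \<phi> n (query s \<theta> n \<omega>) (Wt \<omega>)" by auto
  show thesis
  proof (rule that[OF \<omega>(1-3) _ \<omega>(4)])
    fix n assume n: "n \<in> {1..N}"
    then show "answer s \<theta> n \<omega> = \<phi> n (q n) w" using \<omega>(5) all_queries_nth[OF n, of \<theta> \<omega>] \<omega>(2,3) by simp
  qed
qed

lemma packet_pos_sub: "k \<in> {1..K} \<Longrightarrow> i \<in> packets s \<Longrightarrow> packet_pos s k i \<subseteq> {..<L}"
  using storage unfolding valid_storage_def by blast

lemma card_packet_pos:
  assumes "k \<in> {1..K}" "i \<in> packets s"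
  shows "card (packet_pos s k i) = card (packet_pos s 1 i)"
proof -
  have "ent s (packet s k i) = ent s (packet s 1 i)"
    using storage assms one_K unfolding valid_storage_def by blast
  then show ?thesis
    using ent_packet[OF _ packet_pos_sub] assms one_K by simp
qed

lemma packets_disjoint: "k \<in> {1..K} \<Longrightarrow> disjoint_family_on (packet_pos s k) (packets s)"
  and packets_union: "k \<in> {1..K} \<Longrightarrow> (\<Union>i\<in>packets s. packet_pos s k i) = {..<L}"
  and finite_packets: "finite (packets s)"
  and stored_union: "(\<Union>n\<in>{1..N}. stored s n) = packets s"
  using storage unfolding valid_storage_def by blast+

lemma stored_packet_pos_sub:
  "n \<in> {1..N} \<Longrightarrow> k \<in> {1..K} \<Longrightarrow> i \<in> stored s n \<Longrightarrow> packet_pos s k i \<subseteq> {..<L}"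
  using packet_pos_sub stored_union by blast

lemma ent_stored_content:
  assumes n: "n \<in> {1..N}"
  shows "ent s (content K s n) = K * (\<Sum>i\<in>stored s n. real (card (packet_pos s 1 i)))"
proof (rule ent_content)
  have sub: "stored s n \<subseteq> packets s" using stored_union n by blast
  then show "finite (stored s n)" using finite_packets finite_subset by blast
  show "disjoint_family_on (packet_pos s k) (stored s n)" if "k \<in> {1..K}" for k
    using packets_disjoint[OF that] sub unfolding disjoint_family_on_def by blast
  show "card (packet_pos s k i) = card (packet_pos s 1 i)" if "k \<in> {1..K}" "i \<in> stored s n" for k i
    using card_packet_pos that sub by blast
qed (rule stored_packet_pos_sub[OF n])

lemma phi_depends: "stored_of n w = stored_of n w' \<Longrightarrow> \<phi> n x w = \<phi> n x w'"
  by (simp add: \<phi>_def)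

lemma phi_eqI:
  assumes "\<theta> \<in> {1..K}" "q \<in> Q \<theta>" "w \<in> \<Omega>" "n \<in> {1..N}"
    and "\<And>\<omega>. \<omega> \<in> space M \<Longrightarrow> answer s \<theta> n \<omega> = G (query s \<theta> n \<omega>) (Wt \<omega>)"
  shows "\<phi> n (q n) w = G (q n) w"
proof -
  obtain \<omega> where \<omega>: "\<omega> \<in> space M" "all_queries N s \<theta> \<omega> = q" "Wt \<omega> = w"
    "\<And>n. n \<in> {1..N} \<Longrightarrow> answer s \<theta> n \<omega> = \<phi> n (q n) w"
    using obtain_sample[OF assms(1-3), of "\<lambda>_. True"] by auto
  then show ?thesis using assms(4) assms(5)[OF \<omega>(1)] all_queries_nth[OF assms(4), of \<theta> \<omega>] by simp
qed

text \<open>Both arrays are realized with the same queries, hence with the same answers, at points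
  of positive joint probability. Vanishing conditional entropy of the desired file then forbids two
  different files.\<close>

lemma decode_aux:
  assumes \<theta>: "\<theta> \<in> {1..K}" and q: "q \<in> Q \<theta>" and w: "w \<in> \<Omega>" "w' \<in> \<Omega>"
    and eq: "\<And>n. n \<in> {1..N} \<Longrightarrow> \<phi> n (q n) w = \<phi> n (q n) w'"
  shows "file_of w \<theta> = file_of w' \<theta>"
proof -
  let ?Y = "\<lambda>\<omega>. (all_answers N s \<theta> \<omega>, all_queries N s \<theta> \<omega>)"
  let ?Z = "\<lambda>\<omega>. (file_var s \<theta> \<omega>, ?Y \<omega>)"
  have Y: "simple_function M ?Y" by (rule simple_function_Pair[OF all_answers_simple[OF \<theta>] all_queries_simple[OF \<theta>]])
  have AE: "AE \<omega> in M. 0 < pr M ?Z (?Z \<omega>)"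
    by (rule AE_pr_pos[OF simple_function_Pair[OF file_simple[OF \<theta>] Y]])
  obtain \<omega> where \<omega>: "\<omega> \<in> space M" "all_queries N s \<theta> \<omega> = q" "Wt \<omega> = w"
    "\<And>n. n \<in> {1..N} \<Longrightarrow> answer s \<theta> n \<omega> = \<phi> n (q n) w" "0 < pr M ?Z (?Z \<omega>)"
    using obtain_sample[OF \<theta> q w(1) AE] by blast
  obtain \<omega>' where \<omega>': "\<omega>' \<in> space M" "all_queries N s \<theta> \<omega>' = q" "Wt \<omega>' = w'"
    "\<And>n. n \<in> {1..N} \<Longrightarrow> answer s \<theta> n \<omega>' = \<phi> n (q n) w'" "0 < pr M ?Z (?Z \<omega>')"
    using obtain_sample[OF \<theta> q w(2) AE] by blast
  have YY: "?Y \<omega> = ?Y \<omega>'"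
    using \<omega>(2,4) \<omega>'(2,4) eq unfolding all_answers_def prod.inject restrict_eq_iff by simp
  have "cond_ent s (file_var s \<theta>) ?Y = 0"
    using retrieval \<theta> unfolding valid_retrieval_def by blast
  then have "file_var s \<theta> \<omega> = file_var s \<theta> \<omega>'"
    using conditional_entropy_eq_0D[OF file_simple[OF \<theta>] Y _ \<omega>(5)] \<omega>'(5) unfolding cond_ent_def YY by blast
  then show ?thesis using file_var_Wt[OF \<theta> \<omega>(1)] file_var_Wt[OF \<theta> \<omega>'(1)] \<omega>(3) \<omega>'(3) by simp
qed

end

sublocale sc_scheme \<subseteq> model: pir_model N K L "packets s" "packet_pos s" "\<lambda>i. card (packet_pos s 1 i)"
  "stored s" \<phi> Q "\<lambda>\<theta>. pr M (all_queries N s \<theta>)"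
proof
  fix \<theta> n q assume a: "\<theta> \<in> {1..K}" "n \<in> {1..N}" "q \<in> Q \<theta>"
  show "determines \<Omega> (\<lambda>w. restrict w {(j, t). j \<in> {1..K} \<and> t \<in> (\<Union>i\<in>stored s n. packet_pos s j i)}) (\<phi> n (q n))"
    unfolding cells_def[symmetric]
    by (intro determinesI phi_depends) (simp only: stored_of_eq_iff[OF stored_packet_pos_sub[OF a(2)]])
next
  fix \<theta> q assume a: "\<theta> \<in> {1..K}" "q \<in> Q \<theta>"
  show "determines \<Omega> (\<lambda>w. \<lambda>n\<in>{1..N}. \<phi> n (q n) w) (\<lambda>w. restrict w ({\<theta>} \<times> {..<L}))"
  proof (rule determinesI)
    fix w w' :: "nat \<times> nat \<Rightarrow> 'f" assume w: "w \<in> \<Omega>" "w' \<in> \<Omega>" and "(\<lambda>n\<in>{1..N}. \<phi> n (q n) w) = (\<lambda>n\<in>{1..N}. \<phi> n (q n) w')"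
    then have "file_of w \<theta> = file_of w' \<theta>" unfolding restrict_eq_iff by (intro decode_aux[OF a w]) blast
    then show "restrict w ({\<theta>} \<times> {..<L}) = restrict w' ({\<theta>} \<times> {..<L})"
      unfolding restrict_eq_iff file_of_def by simp
  qed
next
  fix \<theta> assume a: "\<theta> \<in> {1..K}"
  show "finite (Q \<theta>)" using simple_functionD(1)[OF all_queries_simple[OF a]] by (simp add: Q_def)
  show "(\<Sum>q\<in>Q \<theta>. pr M (all_queries N s \<theta>) q) = 1"
    using sum_Q[OF a, of "\<lambda>_. 1"] sum_pr[OF all_queries_simple[OF a]] by simp
next
  fix \<theta> q assume "\<theta> \<in> {1..K}" "q \<in> Q \<theta>"
  then show "0 < pr M (all_queries N s \<theta>) q" by (simp add: Q_def)
next
  fix g :: "'q \<Rightarrow> real" and \<theta> \<theta>' n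
  assume a: "\<theta> \<in> {1..K}" "\<theta>' \<in> {1..K}" "n \<in> {1..N}"
  have fin: "finite (query s \<theta> n ` space M)" if "\<theta> \<in> {1..K}" for \<theta>
    using simple_functionD(1)[OF query_simple[OF that a(3)]] .
  have ext: "(\<Sum>x\<in>query s \<theta> n ` space M. pr M (query s \<theta> n) x * g x)
      = (\<Sum>x\<in>query s \<theta> n ` space M \<union> query s \<theta>' n ` space M. pr M (query s \<theta> n) x * g x)"
    if "\<theta> \<in> {1..K}" "\<theta>' \<in> {1..K}" for \<theta> \<theta>'
    using fin that by (intro sum.mono_neutral_left) (auto simp: pr_eq_0)
  show "(\<Sum>q\<in>Q \<theta>. pr M (all_queries N s \<theta>) q * g (q n)) = (\<Sum>q\<in>Q \<theta>'. pr M (all_queries N s \<theta>') q * g (q n))"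
    unfolding sum_Q_nth[OF a(1,3)] sum_Q_nth[OF a(2,3)]
    using ext[OF a(1,2)] ext[OF a(2,1)] by (simp add: Un_commute pr_query_private[OF a(1,2,3)])
qed (fact K_pos finite_packets packets_disjoint packets_union card_packet_pos stored_union)+

context sc_scheme
begin

lemma download_eq: "download N s 1 = model.D"
  unfolding download_def model.D_def by (intro sum.cong refl cond_ent_answer one_K)

lemma storage_le: "(\<Sum>n\<in>{1..N}. \<Sum>i\<in>stored s n. real (card (packet_pos s 1 i))) \<le> \<mu> * real N * real L"
proof -
  have "(\<Sum>i\<in>stored s n. real (card (packet_pos s 1 i))) \<le> \<mu> * real L" if n: "n \<in> {1..N}" for n
  proof -
    have "ent s (content K s n) \<le> \<mu> * real K * real L" using storage n unfolding valid_storage_def by blast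
    then have "real K * (\<Sum>i\<in>stored s n. real (card (packet_pos s 1 i))) \<le> real K * (\<mu> * real L)"
      unfolding ent_stored_content[OF n] by (simp add: mult_ac)
    then show ?thesis using K_pos by simp
  qed
  then have "(\<Sum>n\<in>{1..N}. \<Sum>i\<in>stored s n. real (card (packet_pos s 1 i))) \<le> (\<Sum>n\<in>{1..N}. \<mu> * real L)"
    by (intro sum_mono)
  then show ?thesis by (simp add: mult_ac)
qed

lemma download_ge:
  assumes "0 < \<mu> * real N"
  shows "L * (1 + geo (K - 1) (\<mu> * N)) \<le> download N s 1"
  unfolding download_eq using assms storage_le by (intro model.D_ge)

lemma rate_le:
  assumes "0 < \<mu> * real N"
  shows "rate N s \<le> 1 / (1 + geo (K - 1) (\<mu> * N))"
proof -
  have g: "0 < 1 + geo (K - 1) (\<mu> * N)" using geo_nonneg[of "\<mu> * N" "K - 1"] assms by simp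
  then have "0 < L * (1 + geo (K - 1) (\<mu> * N))" using L_pos by simp
  then have "rate N s \<le> L / (L * (1 + geo (K - 1) (\<mu> * N)))"
    unfolding rate_def using download_ge[OF assms] by (intro divide_left_mono) auto
  then show ?thesis using L_pos by simp
qed

end

section \<open>Lower bound on the sub-packetization\<close>

text \<open>Lengths have to agree also where the coefficient is 0, because zero-padding extends to
  the maximum over all vectors.\<close>

lemma lin_comb_cong:
  assumes "\<And>x. x \<in> X \<Longrightarrow> length (v x) = length (v' x)"
    and "\<And>x. x \<in> X \<Longrightarrow> c x \<noteq> 0 \<Longrightarrow> v x = v' x"
  shows "lin_comb X c v = lin_comb X c v'"
proof -
  have "(\<lambda>x. length (v x)) ` X = (\<lambda>x. length (v' x)) ` X"
    using assms(1) by (intro image_cong) auto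
  moreover have "(\<Sum>x\<in>X. c x * nth_default 0 (v x) t) = (\<Sum>x\<in>X. c x * nth_default 0 (v' x) t)" for t
    using assms(2) by (intro sum.cong refl) (metis mult_zero_left)
  ultimately show ?thesis by (simp add: lin_comb_def)
qed

text \<open>In a field one nonzero coefficient suffices to solve for its vector when all other
  vectors are known. Padding does no harm, since the combination is at least as long as each of
  them.\<close>

lemma lin_comb_cancel:
  fixes c :: "'x \<Rightarrow> 'f::field"
  assumes X: "finite X" "x0 \<in> X" and c: "c x0 \<noteq> 0"
    and len: "\<And>x. x \<in> X \<Longrightarrow> length (v x) = length (v' x)"
    and eq: "\<And>x. x \<in> X - {x0} \<Longrightarrow> v x = v' x"
    and lc: "lin_comb X c v = lin_comb X c v'"
  shows "v x0 = v' x0"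
proof (rule nth_equalityI)
  show "length (v x0) = length (v' x0)" using len X by auto
  fix t assume t: "t < length (v x0)"
  let ?m = "Max (insert 0 ((\<lambda>x. length (v x)) ` X))"
  have im: "(\<lambda>x. length (v x)) ` X = (\<lambda>x. length (v' x)) ` X"
    using len by (intro image_cong) auto
  have "length (v x0) \<le> ?m" using X by (intro Max_ge) auto
  then have tm: "t < ?m" using t by simp
  have "lin_comb X c v ! t = lin_comb X c v' ! t" using lc by simp
  then have "(\<Sum>x\<in>X. c x * nth_default 0 (v x) t) = (\<Sum>x\<in>X. c x * nth_default 0 (v' x) t)"
    using tm im by (simp add: lin_comb_def)
  moreover have "(\<Sum>x\<in>X - {x0}. c x * nth_default 0 (v x) t) = (\<Sum>x\<in>X - {x0}. c x * nth_default 0 (v' x) t)"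
    using eq by (intro sum.cong) auto
  ultimately have "c x0 * nth_default 0 (v x0) t = c x0 * nth_default 0 (v' x0) t"
    using X by (simp add: sum.remove)
  then show "v x0 ! t = v' x0 ! t"
    using c t len[OF X(2)] by (simp add: nth_default_def)
qed


text \<open>Linearity makes the interference in a single answer come in quanta of a whole packet,
  that is \<open>p\<close> symbols. As the file length is \<open>p\<close> times the number of
  packets, \<open>p\<close> cancels in the bound \<open>(M - 1) * p \<le> L\<close>.\<close>

lemma linear_tight_packets:
  fixes sf :: "('w, 'f::{field,finite}, 'i, 'q, 'f list list) pir"
  assumes sf: "sf_pir_scheme M K sf" and M: "0 < M" and K: "2 \<le> K"
    and rate: "rate M sf = 1 / (1 + geo (K - 1) M)"
    and lin: "linear_with M K len \<beta> sf"
    and size: "\<And>k i. k \<in> {1..K} \<Longrightarrow> i \<in> packets sf \<Longrightarrow> card (packet_pos sf k i) = p"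
  shows "M - 1 \<le> card (packets sf)"
proof -
  interpret sc_scheme 1 M K sf
    using sf K unfolding sf_pir_scheme_def by (intro sc_scheme.intro) auto
  have full: "stored sf n = packets sf" if "n \<in> {1..M}" for n
    using sf that by (simp add: sf_pir_scheme_def)
  let ?pk = "\<lambda>w k i. nths (file_of w k) (packet_pos sf k i)"
  let ?X = "{1..K} \<times> packets sf"
  have finX: "finite ?X" using finite_packets by simp
  have one: "1 \<in> {1..K}" using K by simp
  have phi: "\<phi> n (q n) w = lin_answer K len \<beta> (packets sf) (?pk w) n (q n)"
    if q: "q \<in> Q 1" and n: "n \<in> {1..M}" and w: "w \<in> \<Omega>" for q n w
  proof (rule phi_eqI[OF one q w n, of "\<lambda>x w. lin_answer K len \<beta> (packets sf) (?pk w) n x"])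
    fix \<omega> assume \<omega>: "\<omega> \<in> space (sample sf)"
    have "answer sf 1 n \<omega> = lin_answer K len \<beta> (packets sf) (\<lambda>k i. packet sf k i \<omega>) n (query sf 1 n \<omega>)"
      using lin one n \<omega> full unfolding linear_with_def by metis
    also have "\<dots> = lin_answer K len \<beta> (packets sf) (?pk (Wt \<omega>)) n (query sf 1 n \<omega>)"
      unfolding lin_answer_def
    proof (intro map_cong refl)
      fix j
      show "lin_comb ?X (\<lambda>(k, i). \<beta> n (query sf 1 n \<omega>) k i j) (\<lambda>(k, i). packet sf k i \<omega>)
        = lin_comb ?X (\<lambda>(k, i). \<beta> n (query sf 1 n \<omega>) k i j) (\<lambda>(k, i). ?pk (Wt \<omega>) k i)"
        using file_var_Wt[OF _ \<omega>] by (intro lin_comb_cong) (auto simp: packet_def)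
    qed
    finally show "answer sf 1 n \<omega> = lin_answer K len \<beta> (packets sf) (?pk (Wt \<omega>)) n (query sf 1 n \<omega>)" .
  qed
  have lenpk: "length (?pk w k i) = length (?pk w' k i)" for w w' :: "nat \<times> nat \<Rightarrow> 'f" and k i
    by (simp add: file_of_def nths_map_upt)
  have quant: "real p \<le> model.H (\<phi> n (q n)) (model.V {} 1)"
    if q: "q \<in> Q 1" and n: "n \<in> {1..M}" and pos: "0 < model.H (\<phi> n (q n)) (model.V {} 1)" for q n
  proof -
    \<comment> \<open>If only packets of file 1 had nonzero coefficients, file 1 would determine the
      answer and its conditional entropy would be 0.\<close>
    have "\<exists>k i j. k \<in> {1..K} \<and> k \<noteq> 1 \<and> i \<in> packets sf \<and> j \<in> set [1..<Suc (len n (q n))] \<and> \<beta> n (q n) k i j \<noteq> 0"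
    proof (rule ccontr)
      assume no: "\<not> ?thesis"
      have "determines \<Omega> (model.V {} 1) (\<phi> n (q n))"
      proof (rule determinesI)
        fix w w' :: "nat \<times> nat \<Rightarrow> 'f" assume w: "w \<in> \<Omega>" "w' \<in> \<Omega>" and "model.V {} 1 w = model.V {} 1 w'"
        then have agree: "w x = w' x" if "x \<in> model.C {} 1" for x
          using that unfolding model.V_def restrict_eq_iff by blast
        have f1: "file_of w 1 = file_of w' 1"
          using agree one by (auto simp: file_of_def model.C_def)
        show "\<phi> n (q n) w = \<phi> n (q n) w'"
          unfolding phi[OF q n w(1)] phi[OF q n w(2)] lin_answer_def
        proof (rule map_cong[OF refl], rule lin_comb_cong)
          fix j x assume j: "j \<in> set [1..<Suc (len n (q n))]" and x: "x \<in> ?X"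
          show "length ((\<lambda>(k, i). ?pk w k i) x) = length ((\<lambda>(k, i). ?pk w' k i) x)"
            using lenpk by (simp add: split_beta)
          assume "(\<lambda>(k, i). \<beta> n (q n) k i j) x \<noteq> 0"
          moreover obtain k' i' where x': "x = (k', i')" "k' \<in> {1..K}" "i' \<in> packets sf" using x by blast
          ultimately have "fst x = 1" using no j by fastforce
          then show "(\<lambda>(k, i). ?pk w k i) x = (\<lambda>(k, i). ?pk w' k i) x"
            using f1 by (simp add: split_beta)
        qed
      qed
      then have "model.H (\<phi> n (q n)) (model.V {} 1) = 0" by (rule cond_uent_eq_0[OF model.bf])
      then show False using pos by simp
    qed
    then obtain k i j where k: "k \<in> {1..K}" "k \<noteq> 1" and i: "i \<in> packets sf"
      and j: "j \<in> set [1..<Suc (len n (q n))]" and \<beta>: "\<beta> n (q n) k i j \<noteq> 0" by blast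
    \<comment> \<open>With all other symbols fixed, the combination with the nonzero coefficient
      reveals this packet entirely.\<close>
    let ?J = "{k} \<times> packet_pos sf k i"
    have sub: "packet_pos sf k i \<subseteq> {..<L}" using packet_pos_sub[OF k(1) i] .
    have "real (card ?J) \<le> model.H (\<phi> n (q n)) (model.V {} 1)"
    proof (rule model.H_ge_card)
      show "?J \<subseteq> I - {1} \<times> {..<L}" using k sub by auto
      show "determines \<Omega> (\<lambda>w. (\<phi> n (q n) w, restrict w (I - ?J))) (\<lambda>w. restrict w ?J)"
      proof (rule determinesI)
        fix w w' :: "nat \<times> nat \<Rightarrow> 'f" assume w: "w \<in> \<Omega>" "w' \<in> \<Omega>"
          and eq: "(\<phi> n (q n) w, restrict w (I - ?J)) = (\<phi> n (q n) w', restrict w' (I - ?J))"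
        have agree: "w x = w' x" if "x \<in> I - ?J" for x
          using eq that unfolding prod.inject restrict_eq_iff by blast
        have "lin_comb ?X (\<lambda>(k, i). \<beta> n (q n) k i j) (\<lambda>(k, i). ?pk w k i)
            = lin_comb ?X (\<lambda>(k, i). \<beta> n (q n) k i j) (\<lambda>(k, i). ?pk w' k i)"
          using eq j unfolding prod.inject phi[OF q n w(1)] phi[OF q n w(2)] lin_answer_def map_eq_conv by blast
        then have "(\<lambda>(k, i). ?pk w k i) (k, i) = (\<lambda>(k, i). ?pk w' k i) (k, i)"
        proof (rule lin_comb_cancel[OF finX, rotated -1])
          show "(k, i) \<in> ?X" using k i by simp
          show "(\<lambda>(k, i). \<beta> n (q n) k i j) (k, i) \<noteq> 0" using \<beta> by simp
          show "length ((\<lambda>(k, i). ?pk w k i) x) = length ((\<lambda>(k, i). ?pk w' k i) x)" for x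
            using lenpk by (simp add: split_beta)
          fix x assume x: "x \<in> ?X - {(k, i)}"
          obtain k' i' where "x = (k', i')" by (cases x)
          with x have x': "x = (k', i')" "k' \<in> {1..K}" "i' \<in> packets sf" "(k', i') \<noteq> (k, i)"
            by simp_all
          have "packet_pos sf k' i' \<inter> packet_pos sf k i = {}" if "k' = k"
            using packets_disjoint[OF k(1)] x' i that unfolding disjoint_family_on_def by blast
          then have "(k', t) \<in> I - ?J" if "t \<in> packet_pos sf k' i'" for t
            using that packet_pos_sub[OF x'(2,3)] x'(2) by auto
          then have "?pk w k' i' = ?pk w' k' i'"
            unfolding restrict_nths_eq[OF packet_pos_sub[OF x'(2,3)]] using agree by blast
          then show "(\<lambda>(k, i). ?pk w k i) x = (\<lambda>(k, i). ?pk w' k i) x" using x'(1) by simp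
        qed
        then have "?pk w k i = ?pk w' k i" by simp
        then show "restrict w ?J = restrict w' ?J"
          unfolding restrict_nths_eq[OF sub] restrict_eq_iff by blast
      qed
    qed
    moreover have "card ?J = p" using size[OF k(1) i] by (subst card_cartesian_product) simp
    ultimately show ?thesis by simp
  qed
  have g: "0 < 1 + geo (K - 1) M" using geo_nonneg[of "real M" "K - 1"] by simp
  have "download M sf 1 = L * (1 + geo (K - 1) M)"
    using rate g L_pos by (cases "download M sf 1 = 0") (auto simp: rate_def field_simps)
  then have tight: "model.D = L * (1 + geo (K - 1) M)" by (simp only: download_eq)
  have "(real M - 1) * real p \<le> L"
  proof (rule model.tight_packet_bound[OF K M L_pos full tight])
    fix q n assume "q \<in> Q 1" "n \<in> {1..M}" "0 < model.H (\<phi> n (q n)) (model.V {} 1)"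
    then show "real p \<le> model.H (\<phi> n (q n)) (model.V {} 1)" by (rule quant)
  qed
  also have "real L = card (packets sf) * p"
    using model.sum_sz size[OF one] by simp
  finally have le: "(real M - 1) * real p \<le> card (packets sf) * real p" by simp
  have "0 < p"
    using \<open>real L = card (packets sf) * p\<close> L_pos by (cases "p = 0") auto
  then have "real M - 1 \<le> card (packets sf)" using le by simp
  then show ?thesis using M by linarith
qed

text \<open>The capacity of the full storage system enters as the hypothesis \<open>cap\<close>,
  because its value rests also on the achievability part that follows.\<close>

lemma sub_packetization_ge:
  fixes sf :: "('v, 'f::{field,finite}, 'i, 'q, 'f list list) pir"
    and s :: "('w, 'f, nat set \<times> 'i, nat set \<Rightarrow> 'q, nat set \<Rightarrow> 'f list list) pir"
  assumes K: "2 \<le> K" and M: "2 \<le> M" "M \<le> N" and \<mu>: "\<mu> * real N = real M"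
    and cap: "capacity TYPE('f) 1 M K = 1 / (1 + geo (K - 1) M)"
    and s: "linear_sf_sc_pir_scheme \<mu> N K M \<alpha> sf s" and eq: "equal_size K s"
  shows "N * (M - 1) div gcd N M \<le> sub_packetization s"
proof -
  note sd = s[unfolded linear_sf_sc_pir_scheme_def]
  have sc: "sc_pir_scheme \<mu> N K s" using sd by (elim conjE)
  have sf: "sf_pir_scheme M K sf" using sd by (elim conjE)
  interpret S: sc_scheme \<mu> N K s using sc K by (intro sc_scheme.intro) auto
  interpret F: sc_scheme 1 M K sf using sf K unfolding sf_pir_scheme_def by (intro sc_scheme.intro) auto
  let ?A = "active N M \<alpha>"
  have parts: "\<forall>k\<in>{1..K}. \<forall>S\<in>?A.
      real (card (\<Union>i\<in>packets sf. packet_pos s k (S, i))) = \<alpha> S * real (file_len s) \<and>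
      (\<forall>i\<in>packets sf. real (card (packet_pos s k (S, i))) / (\<alpha> S * real (file_len s)) =
         real (card (packet_pos sf k i)) / real (file_len sf))"
    using sd by (elim conjE)
  have weights: "valid_weights \<mu> N M \<alpha>" using sd by (elim conjE)
  have achieving: "capacity_achieving 1 M K sf" using sd by (elim conjE)
  have pk: "packets s = ?A \<times> packets sf" using sd by (elim conjE)
  have finA: "finite ?A" by (rule finite_subset[of _ "Pow {1..N}"]) (auto simp: active_def)
  have sub: "sub_packetization s = card ?A * card (packets sf)"
    unfolding sub_packetization_def pk by (rule card_cartesian_product)
  have "packets s \<noteq> {}" using S.packets_union[OF S.one_K] S.L_pos by fastforce
  then have ne: "?A \<noteq> {}" "packets sf \<noteq> {}" using pk by auto
  have cA: "0 < card ?A" and cP: "0 < card (packets sf)"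
    using ne finA F.finite_packets by (auto simp: card_gt_0_iff)
  have cs: "real (card (packet_pos s k (B, i))) = S.L / (card ?A * card (packets sf))"
    if "k \<in> {1..K}" "B \<in> ?A" "i \<in> packets sf" for k B i
    using eq that S.ent_packet[OF that(1) S.packet_pos_sub[OF that(1)], of "(B, i)"] pk unfolding equal_size_def sub by simp
  \<comment> \<open>Every part consists of the same number of packets of the same size, so all parts
    have equal shares of the file.\<close>
  have \<alpha>: "\<alpha> B = 1 / card ?A" if B: "B \<in> ?A" for B
  proof -
    have "\<alpha> B * real S.L = real (card (\<Union>i\<in>packets sf. packet_pos s 1 (B, i)))"
      using parts B S.one_K by simp
    also have "card (\<Union>i\<in>packets sf. packet_pos s 1 (B, i)) = (\<Sum>i\<in>packets sf. card (packet_pos s 1 (B, i)))"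
    proof (rule card_UN_disjoint[OF F.finite_packets])
      show "\<forall>i\<in>packets sf. finite (packet_pos s 1 (B, i))"
      proof
        fix i assume "i \<in> packets sf"
        then have "packet_pos s 1 (B, i) \<subseteq> {..<S.L}" using pk B by (intro S.packet_pos_sub[OF S.one_K]) auto
        then show "finite (packet_pos s 1 (B, i))" by (rule finite_subset) simp
      qed
      show "\<forall>i\<in>packets sf. \<forall>j\<in>packets sf. i \<noteq> j \<longrightarrow> packet_pos s 1 (B, i) \<inter> packet_pos s 1 (B, j) = {}"
        using S.packets_disjoint[OF S.one_K] B unfolding pk disjoint_family_on_def by blast
    qed
    also have "real \<dots> = S.L / card ?A"
      using cs[OF S.one_K B] cP by simp
    finally show ?thesis using S.L_pos cA by (simp add: field_simps)
  qed
  obtain B0 where B0: "B0 \<in> ?A" using ne by blast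
  define p where "p = card (packet_pos sf 1 (SOME i. i \<in> packets sf))"
  \<comment> \<open>Parts are split in the proportions of the files of \<open>sf\<close>, so
    equality of the packet sizes passes from \<open>s\<close> to \<open>sf\<close>.\<close>
  have ratio: "real (card (packet_pos sf k i)) = F.L / card (packets sf)"
    if k: "k \<in> {1..K}" and i: "i \<in> packets sf" for k i
  proof -
    have "real (card (packet_pos s k (B0, i))) / (\<alpha> B0 * real S.L) = real (card (packet_pos sf k i)) / real F.L"
      using parts B0 k i by blast
    then show ?thesis
      unfolding cs[OF k B0 i] \<alpha>[OF B0] using S.L_pos F.L_pos cA cP by (simp add: field_simps)
  qed
  have some: "(SOME i. i \<in> packets sf) \<in> packets sf" using ne(2) by (simp add: some_in_eq)
  have size: "card (packet_pos sf k i) = p" if "k \<in> {1..K}" "i \<in> packets sf" for k i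
    using ratio[OF that] ratio[OF F.one_K some] unfolding p_def by linarith
  obtain len \<beta> where lin: "linear_with M K len \<beta> sf" using sd by (elim conjE exE) (rule that)
  have "rate M sf = 1 / (1 + geo (K - 1) M)"
    using achieving cap unfolding capacity_achieving_def by simp
  then have P: "M - 1 \<le> card (packets sf)"
    using linear_tight_packets[OF sf _ K _ lin size] M by simp
  \<comment> \<open>The weight condition is used at server 1 only. With equal weights it says that
    \<mu> is the fraction of active sets containing this server.\<close>
  have "(\<Sum>B | B \<subseteq> {1..N} \<and> card B = M \<and> 1 \<in> B. \<alpha> B) = \<mu>"
    using weights M unfolding valid_weights_def by auto
  moreover have "(\<Sum>B | B \<subseteq> {1..N} \<and> card B = M \<and> 1 \<in> B. \<alpha> B) = (\<Sum>B\<in>{B \<in> ?A. 1 \<in> B}. 1 / card ?A)"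
  proof (rule sum.mono_neutral_cong_right)
    show "finite {B. B \<subseteq> {1..N} \<and> card B = M \<and> 1 \<in> B}"
      by (rule finite_subset[of _ "Pow {1..N}"]) auto
    have nn: "0 \<le> \<alpha> B" if "B \<subseteq> {1..N}" "card B = M" for B
      using weights that unfolding valid_weights_def by blast
    show "\<forall>B\<in>{B. B \<subseteq> {1..N} \<and> card B = M \<and> 1 \<in> B} - {B \<in> ?A. 1 \<in> B}. \<alpha> B = 0"
    proof
      fix B assume "B \<in> {B. B \<subseteq> {1..N} \<and> card B = M \<and> 1 \<in> B} - {B \<in> ?A. 1 \<in> B}"
      then have "B \<subseteq> {1..N}" "card B = M" "\<not> 0 < \<alpha> B" by (auto simp: active_def)
      then show "\<alpha> B = 0" using nn[of B] by simp
    qed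
    show "{B \<in> ?A. 1 \<in> B} \<subseteq> {B. B \<subseteq> {1..N} \<and> card B = M \<and> 1 \<in> B}"
      unfolding active_def by blast
    show "\<alpha> B = 1 / card ?A" if "B \<in> {B \<in> ?A. 1 \<in> B}" for B
      using \<alpha> that by blast
  qed
  ultimately have "real (card {B \<in> ?A. 1 \<in> B}) / card ?A = \<mu>" by simp
  then have "real (card {B \<in> ?A. 1 \<in> B}) = \<mu> * card ?A" using cA by (simp add: field_simps)
  then have "real (card {B \<in> ?A. 1 \<in> B}) * N = (\<mu> * real N) * card ?A" by simp
  then have "real (card {B \<in> ?A. 1 \<in> B} * N) = real (M * card ?A)" unfolding \<mu> by simp
  then have nat_eq: "card {B \<in> ?A. 1 \<in> B} * N = M * card ?A" by (simp only: of_nat_eq_iff)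
  have g: "0 < gcd N M" using M by simp
  \<comment> \<open>Cancelling the gcd leaves coprime \<open>n'\<close> and \<open>m'\<close>, so
    \<open>n'\<close>, which is N divided by the gcd, divides the number of active sets.\<close>
  have "N dvd M * card ?A" using nat_eq by (metis dvd_triv_right)
  moreover obtain n' m' where nm: "N = n' * gcd N M" "M = m' * gcd N M" "coprime n' m'"
    using gcd_coprime_exists[of N M] g by auto
  ultimately have "n' * gcd N M dvd m' * card ?A * gcd N M" by (metis mult.assoc mult.commute)
  then have "n' dvd m' * card ?A" using g by auto
  then have "n' dvd card ?A" using nm(3) by (simp add: coprime_dvd_mult_right_iff)
  then have "n' \<le> card ?A" using cA by (intro dvd_imp_le) auto
  moreover have "N div gcd N M = n'" using nm(1) g by (metis nonzero_mult_div_cancel_right less_numeral_extra(3))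
  ultimately have A: "N div gcd N M \<le> card ?A" by simp
  have "N * (M - 1) div gcd N M = (N div gcd N M) * (M - 1)"
    by (metis div_mult_swap gcd_dvd1 mult.commute)
  also have "\<dots> \<le> card ?A * card (packets sf)" using A P by (rule mult_le_mono)
  finally show ?thesis by (simp add: sub)
qed

section \<open>Schemes with uniformly distributed files and keys\<close>

text \<open>The family of all \<open>Y j\<close> takes each value in the box equally often, so the
  count over a sub-box is its size times \<open>c\<close>.\<close>

lemma card_uniform_fibers:
  assumes S: "finite S" and J: "finite J" and B: "\<And>j. j \<in> J \<Longrightarrow> finite (B j)"
    and Y: "\<And>\<omega>. \<omega> \<in> S \<Longrightarrow> (\<lambda>j\<in>J. Y j \<omega>) \<in> PiE J B"
    and c: "\<And>g. g \<in> PiE J B \<Longrightarrow> card {\<omega>\<in>S. (\<lambda>j\<in>J. Y j \<omega>) = g} = c"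
  shows "card {\<omega>\<in>S. \<forall>j\<in>J. Y j \<omega> \<in> A j} = (\<Prod>j\<in>J. card (B j \<inter> A j)) * c"
proof -
  let ?P = "PiE J (\<lambda>j. B j \<inter> A j)"
  have fin: "finite ?P" using J B by (intro finite_PiE) auto
  have "{\<omega>\<in>S. \<forall>j\<in>J. Y j \<omega> \<in> A j} = (\<Union>g\<in>?P. {\<omega>\<in>S. (\<lambda>j\<in>J. Y j \<omega>) = g})"
  proof (intro set_eqI iffI)
    fix \<omega> assume a: "\<omega> \<in> {\<omega>\<in>S. \<forall>j\<in>J. Y j \<omega> \<in> A j}"
    then have "(\<lambda>j\<in>J. Y j \<omega>) \<in> ?P" using Y[of \<omega>] by (auto simp: PiE_iff)
    then show "\<omega> \<in> (\<Union>g\<in>?P. {\<omega>\<in>S. (\<lambda>j\<in>J. Y j \<omega>) = g})" using a by blast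
  next
    fix \<omega> assume "\<omega> \<in> (\<Union>g\<in>?P. {\<omega>\<in>S. (\<lambda>j\<in>J. Y j \<omega>) = g})"
    then have "\<omega> \<in> S" "(\<lambda>j\<in>J. Y j \<omega>) \<in> ?P" by auto
    then show "\<omega> \<in> {\<omega>\<in>S. \<forall>j\<in>J. Y j \<omega> \<in> A j}" by (auto simp: PiE_iff)
  qed
  also have "card \<dots> = (\<Sum>g\<in>?P. card {\<omega>\<in>S. (\<lambda>j\<in>J. Y j \<omega>) = g})"
    using S fin by (intro card_UN_disjoint) auto
  also have "\<dots> = (\<Sum>g\<in>?P. c)" by (intro sum.cong refl c) (auto simp: PiE_iff)
  also have "\<dots> = (\<Prod>j\<in>J. card (B j \<inter> A j)) * c" using J by (simp add: card_PiE)
  finally show ?thesis .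
qed

text \<open>Independence by counting: the common fibre size \<open>c\<close> cancels, and the
  probability of a box becomes a product of fractions, one for each coordinate.\<close>

lemma indep_vars_uniform_fibers:
  assumes S: "finite S" "S \<noteq> {}" and J: "finite J" "J \<noteq> {}" and B: "\<And>j. j \<in> J \<Longrightarrow> finite (B j)"
    and Y: "\<And>\<omega>. \<omega> \<in> S \<Longrightarrow> (\<lambda>j\<in>J. Y j \<omega>) \<in> PiE J B"
    and c: "\<And>g. g \<in> PiE J B \<Longrightarrow> card {\<omega>\<in>S. (\<lambda>j\<in>J. Y j \<omega>) = g} = c"
  shows "prob_space.indep_vars (uniform_count_measure S) (\<lambda>_. count_space UNIV) Y J"
proof -
  let ?M = "uniform_count_measure S"
  interpret prob_space ?M using S by (rule prob_space_uniform_count_measure)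
  note cf = card_uniform_fibers[OF S(1) J(1) B Y c]
  have cS: "card S = (\<Prod>j\<in>J. card (B j)) * c" using cf[of "\<lambda>_. UNIV"] by simp
  have "card S \<noteq> 0" using S by simp
  then have c0: "c \<noteq> 0" and prod0: "(\<Prod>j\<in>J. card (B j)) \<noteq> 0"
    unfolding cS by auto
  then have B0: "card (B j) \<noteq> 0" if "j \<in> J" for j
    using that J(1) by auto
  have pr: "prob {\<omega>\<in>S. \<forall>j\<in>J. Y j \<omega> \<in> A j} = (\<Prod>j\<in>J. card (B j \<inter> A j) / card (B j))" for A
    using S(1) J(2) c0 by (simp add: measure_uniform_count_measure cf cS prod_dividef)
  have single: "prob {\<omega>\<in>S. Y j \<omega> \<in> A} = card (B j \<inter> A) / card (B j)" if j: "j \<in> J" for j A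
  proof -
    have "{\<omega>\<in>S. Y j \<omega> \<in> A} = {\<omega>\<in>S. \<forall>i\<in>J. Y i \<omega> \<in> (if i = j then A else UNIV)}" using j by auto
    then have "prob {\<omega>\<in>S. Y j \<omega> \<in> A} = (\<Prod>i\<in>J. card (B i \<inter> (if i = j then A else UNIV)) / card (B i))"
      by (simp only: pr)
    also have "\<dots> = (\<Prod>i\<in>J. if i = j then card (B j \<inter> A) / card (B j) else 1)"
      by (intro prod.cong) (auto simp: B0)
    finally show ?thesis using j J(1) by simp
  qed
  show ?thesis
  proof (subst indep_vars_finite[where E="\<lambda>_. UNIV"])
    show "\<forall>A\<in>J \<rightarrow> UNIV. prob (\<Inter>j\<in>J. Y j -` A j \<inter> space ?M) = (\<Prod>j\<in>J. prob (Y j -` A j \<inter> space ?M))"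
    proof
      fix A :: "'b \<Rightarrow> 'c set"
      have "(\<Inter>j\<in>J. Y j -` A j \<inter> space ?M) = {\<omega>\<in>S. \<forall>j\<in>J. Y j \<omega> \<in> A j}"
        using J(2) by (auto simp: space_uniform_count_measure)
      moreover have "Y j -` A j \<inter> space ?M = {\<omega>\<in>S. Y j \<omega> \<in> A j}" for j
        by (auto simp: space_uniform_count_measure)
      ultimately show "prob (\<Inter>j\<in>J. Y j -` A j \<inter> space ?M) = (\<Prod>j\<in>J. prob (Y j -` A j \<inter> space ?M))"
        using single by (simp add: pr)
    qed
    show "sets (count_space UNIV) = sigma_sets (space (count_space (UNIV :: 'c set))) UNIV" 
      by (metis Pow_UNIV sets_count_space sets.sigma_sets_eq)
    show "random_variable (count_space UNIV) (Y i)" for i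
      by (auto simp: measurable_def space_uniform_count_measure sets_uniform_count_measure)
  qed (use J in \<open>auto simp: Int_stable_def\<close>)
qed

lemma simple_function_uniform: "finite S \<Longrightarrow> simple_function (uniform_count_measure S) X"
  by (auto simp: simple_function_def space_uniform_count_measure sets_uniform_count_measure)

lemma pr_uniform: "finite S \<Longrightarrow> pr (uniform_count_measure S) X x = card {\<omega>\<in>S. X \<omega> = x} / card S"
  by (simp add: pr_def space_uniform_count_measure measure_uniform_count_measure)

lemma card_fiber_bij:
  assumes "bij_betw h S T"
  shows "card {\<omega>\<in>S. R (h \<omega>)} = card {z\<in>T. R z}"
proof -
  have "bij_betw h {\<omega>\<in>S. R (h \<omega>)} {z\<in>T. R z}"
    using assms by (auto simp: bij_betw_def inj_on_def)
  then show ?thesis by (rule bij_betw_same_card)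
qed

lemma distr_eq_pr:
  assumes M: "prob_space M" "simple_function M X" and M': "prob_space M'" "simple_function M' Y"
    and eq: "pr M X = pr M' Y"
  shows "distr M (count_space UNIV) X = distr M' (count_space UNIV) Y"
proof (rule measure_eqI)
  interpret M: prob_space M by fact
  interpret M': prob_space M' by fact
  fix A assume "A \<in> sets (distr M (count_space UNIV) X)"
  let ?U = "X ` space M \<union> Y ` space M'"
  have fin: "finite ?U" using simple_functionD(1)[OF M(2)] simple_functionD(1)[OF M'(2)] by simp
  have "M.prob {\<omega> \<in> space M. X \<omega> \<in> A} = (\<Sum>x | x \<in> X ` space M \<and> x \<in> A. pr M X x)"
    using M.pr_marginal[OF M(2), of "\<lambda>x. x \<in> A" True] by (simp add: pr_def[of _ _ True])
  also have "\<dots> = (\<Sum>x | x \<in> ?U \<and> x \<in> A. pr M X x)"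
  proof (rule sum.mono_neutral_left)
    show "\<forall>x\<in>{x. x \<in> ?U \<and> x \<in> A} - {x. x \<in> X ` space M \<and> x \<in> A}. pr M X x = 0"
      by (intro ballI pr_eq_0) blast
  qed (use fin in auto)
  also have "\<dots> = (\<Sum>x | x \<in> ?U \<and> x \<in> A. pr M' Y x)" unfolding eq ..
  also have "\<dots> = (\<Sum>x | x \<in> Y ` space M' \<and> x \<in> A. pr M' Y x)"
  proof (rule sum.mono_neutral_right)
    show "\<forall>x\<in>{x. x \<in> ?U \<and> x \<in> A} - {x. x \<in> Y ` space M' \<and> x \<in> A}. pr M' Y x = 0"
      by (intro ballI pr_eq_0) blast
  qed (use fin in auto)
  also have "\<dots> = M'.prob {\<omega> \<in> space M'. Y \<omega> \<in> A}"
    using M'.pr_marginal[OF M'(2), of "\<lambda>x. x \<in> A" True] by (simp add: pr_def[of _ _ True])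
  finally have "M.prob (X -` A \<inter> space M) = M'.prob (Y -` A \<inter> space M')"
    by (simp add: vimage_def Int_def conj_commute)
  then show "emeasure (distr M (count_space UNIV) X) A = emeasure (distr M' (count_space UNIV) Y) A"
    using measurable_simple_function[OF M(2)] measurable_simple_function[OF M'(2)]
    by (simp add: emeasure_distr M.emeasure_eq_measure M'.emeasure_eq_measure)
qed simp

text \<open>Samples are the numbers below \<open>m\<close> because the capacity and the set of
  sub-packetizations range over schemes with sample space in the natural numbers. \<open>dec\<close>
  turns a sample into the array of symbols and the random key of the user.\<close>

definition uniform_scheme ::
  "nat \<Rightarrow> 'i set \<Rightarrow> (nat \<Rightarrow> 'i \<Rightarrow> nat set) \<Rightarrow> (nat \<Rightarrow> 'i set) \<Rightarrow> (nat \<Rightarrow> nat \<Rightarrow> 'r \<Rightarrow> 'q) \<Rightarrow>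
   (nat \<Rightarrow> 'q \<Rightarrow> (nat \<times> nat \<Rightarrow> 'f) \<Rightarrow> 'a) \<Rightarrow> nat \<Rightarrow> (nat \<Rightarrow> (nat \<times> nat \<Rightarrow> 'f) \<times> 'r) \<Rightarrow> (nat, 'f, 'i, 'q, 'a) pir" where
  "uniform_scheme L P pos st qry ans m dec =
    \<lparr>sample = uniform_count_measure {..<m}, file_len = L,
     file_var = (\<lambda>k \<omega>. map (\<lambda>t. fst (dec \<omega>) (k, t)) [0..<L]),
     packets = P, packet_pos = pos, stored = st,
     query = (\<lambda>\<theta> n \<omega>. qry \<theta> n (snd (dec \<omega>))),
     answer = (\<lambda>\<theta> n \<omega>. ans n (qry \<theta> n (snd (dec \<omega>))) (fst (dec \<omega>)))\<rparr>"

text \<open>Combinatorial conditions under which uniform arrays and keys give a scheme. Since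
  \<open>dec\<close> is a bijection, array and key are independent; privacy reduces to counting the
  keys that send a given query to a given server.\<close>

locale uniform_pir =
  fixes \<mu> :: real and N K L :: nat and P :: "'i set" and pos :: "nat \<Rightarrow> 'i \<Rightarrow> nat set"
    and st :: "nat \<Rightarrow> 'i set" and R :: "'r set" and qry :: "nat \<Rightarrow> nat \<Rightarrow> 'r \<Rightarrow> 'q"
    and ans :: "nat \<Rightarrow> 'q \<Rightarrow> (nat \<times> nat \<Rightarrow> 'f::{field,finite}) \<Rightarrow> 'a"
    and m :: nat and dec :: "nat \<Rightarrow> (nat \<times> nat \<Rightarrow> 'f) \<times> 'r"
  assumes K1: "1 \<le> K" and L0: "0 < L" and finP: "finite P"
    and posD: "k \<in> {1..K} \<Longrightarrow> disjoint_family_on (pos k) P"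
    and posU: "k \<in> {1..K} \<Longrightarrow> (\<Union>i\<in>P. pos k i) = {..<L}"
    and posC: "k \<in> {1..K} \<Longrightarrow> i \<in> P \<Longrightarrow> card (pos k i) = card (pos 1 i)"
    and stU: "(\<Union>n\<in>{1..N}. st n) = P"
    and stS: "n \<in> {1..N} \<Longrightarrow> (\<Sum>i\<in>st n. real (card (pos 1 i))) \<le> \<mu> * L"
    and finR: "finite R" and neR: "R \<noteq> {}"
    and dep: "n \<in> {1..N} \<Longrightarrow> (\<And>k i t. k \<in> {1..K} \<Longrightarrow> i \<in> st n \<Longrightarrow> t \<in> pos k i \<Longrightarrow> w (k, t) = w' (k, t)) \<Longrightarrow>
      ans n x w = ans n x w'"
    and dcd: "\<theta> \<in> {1..K} \<Longrightarrow> r \<in> R \<Longrightarrow> (\<And>n. n \<in> {1..N} \<Longrightarrow> ans n (qry \<theta> n r) w = ans n (qry \<theta> n r) w') \<Longrightarrow>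
      t < L \<Longrightarrow> w (\<theta>, t) = w' (\<theta>, t)"
    and prv: "n \<in> {1..N} \<Longrightarrow> \<theta> \<in> {1..K} \<Longrightarrow> \<theta>' \<in> {1..K} \<Longrightarrow>
      card {r\<in>R. qry \<theta> n r = x} = card {r\<in>R. qry \<theta>' n r = x}"
    and bij: "bij_betw dec {..<m} (({1..K} \<times> {..<L} \<rightarrow>\<^sub>E UNIV) \<times> R)"
begin

definition "s = uniform_scheme L P pos st qry ans m dec"
abbreviation "\<Omega>' \<equiv> {1..K} \<times> {..<L} \<rightarrow>\<^sub>E (UNIV :: 'f set)"

lemma sel [simp]: "sample s = uniform_count_measure {..<m}" "file_len s = L"
  "file_var s k \<omega> = map (\<lambda>t. fst (dec \<omega>) (k, t)) [0..<L]" "packets s = P" "packet_pos s = pos" "stored s = st"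
  "query s \<theta> n \<omega> = qry \<theta> n (snd (dec \<omega>))" "answer s \<theta> n \<omega> = ans n (qry \<theta> n (snd (dec \<omega>))) (fst (dec \<omega>))"
  by (simp_all add: s_def uniform_scheme_def)

lemma fin\<Omega>': "finite \<Omega>'" and ne\<Omega>': "\<Omega>' \<noteq> {}"
  by (auto intro!: finite_PiE simp: PiE_eq_empty_iff)

lemma c\<Omega>': "0 < card \<Omega>'"
  using fin\<Omega>' ne\<Omega>' by (simp add: card_gt_0_iff)

lemma cR: "0 < card R"
  using finR neR by (simp add: card_gt_0_iff)

lemma m_eq: "m = card \<Omega>' * card R"
  using bij_betw_same_card[OF bij] by (simp only: card_cartesian_product card_lessThan)

lemma m_pos: "0 < m"
  using c\<Omega>' cR unfolding m_eq by simp

lemma simple [simp]: "simple_function (uniform_count_measure {..<m}) X"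
  by (intro simple_function_uniform) simp

lemma space_s [simp]: "space (uniform_count_measure {..<m}) = {..<m}"
  by (rule space_uniform_count_measure)

lemma dec_in: "\<omega> < m \<Longrightarrow> fst (dec \<omega>) \<in> \<Omega>'" "\<omega> < m \<Longrightarrow> snd (dec \<omega>) \<in> R"
  using bij_betwE[OF bij] by (fastforce simp: mem_Times_iff)+

lemma card_dec: "card {\<omega>\<in>{..<m}. E (fst (dec \<omega>)) \<and> E' (snd (dec \<omega>))} = card {w\<in>\<Omega>'. E w} * card {r\<in>R. E' r}"
proof -
  have "card {\<omega>\<in>{..<m}. E (fst (dec \<omega>)) \<and> E' (snd (dec \<omega>))} = card {z\<in>\<Omega>' \<times> R. E (fst z) \<and> E' (snd z)}"
    by (rule card_fiber_bij[OF bij])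
  also have "{z\<in>\<Omega>' \<times> R. E (fst z) \<and> E' (snd z)} = {w\<in>\<Omega>'. E w} \<times> {r\<in>R. E' r}" by auto
  finally show ?thesis by (simp only: card_cartesian_product)
qed

lemma card_dec_fst: "card {\<omega>\<in>{..<m}. E (fst (dec \<omega>))} = card {w\<in>\<Omega>'. E w} * card R"
  using card_dec[of E "\<lambda>_. True"] by simp

lemma card_dec_snd: "card {\<omega>\<in>{..<m}. E (snd (dec \<omega>))} = card \<Omega>' * card {r\<in>R. E r}"
  using card_dec[of "\<lambda>_. True" E] by simp

lemma prob_s: "prob_space (sample s)"
  using m_pos by (auto intro!: prob_space_uniform_count_measure)

lemma uniform_s: "uniform_files K s"
  unfolding uniform_files_def
proof (intro conjI ballI allI impI)
  show "0 < file_len s" using L0 by simp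
  show "simple_function (sample s) (file_var s k)" for k by simp
  show "length (file_var s k \<omega>) = file_len s" for k \<omega> by simp
  show "prob_space.indep_vars (sample s) (\<lambda>_. count_space UNIV) (file_var s) {1..K}"
    unfolding sel(1)
  proof (rule indep_vars_uniform_fibers)
    show "finite {l :: 'f list. length l = L}" using finite_lists_length_eq[of "UNIV :: 'f set" L] by simp
    show "(\<lambda>j\<in>{1..K}. file_var s j \<omega>) \<in> PiE {1..K} (\<lambda>_. {l. length l = L})" for \<omega> by simp
    fix g assume g: "g \<in> PiE {1..K} (\<lambda>_. {l :: 'f list. length l = L})"
    \<comment> \<open>The only array whose rows are the lists \<open>g\<close>; it occurs once for
      each key.\<close>
    let ?w = "\<lambda>x\<in>{1..K} \<times> {..<L}. g (fst x) ! snd x"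
    have "(\<lambda>j\<in>{1..K}. file_var s j \<omega>) = g \<longleftrightarrow> fst (dec \<omega>) = ?w" if \<omega>: "\<omega> \<in> {..<m}" for \<omega>
    proof
      assume *: "(\<lambda>j\<in>{1..K}. file_var s j \<omega>) = g"
      show "fst (dec \<omega>) = ?w"
      proof (rule PiE_ext)
        show "fst (dec \<omega>) \<in> \<Omega>'" using dec_in(1) \<omega> by blast
        fix x assume x: "x \<in> {1..K} \<times> {..<L}"
        have "file_var s (fst x) \<omega> = g (fst x)" using fun_cong[OF *, of "fst x"] x by auto
        then have "file_var s (fst x) \<omega> ! snd x = g (fst x) ! snd x" by simp
        then show "fst (dec \<omega>) x = ?w x" using x by auto
      qed auto
    next
      assume *: "fst (dec \<omega>) = ?w"
      show "(\<lambda>j\<in>{1..K}. file_var s j \<omega>) = g"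
      proof (rule PiE_ext[OF _ g])
        show "(\<lambda>j\<in>{1..K}. file_var s j \<omega>) \<in> PiE {1..K} (\<lambda>_. {l. length l = L})" by simp
        fix k assume k: "k \<in> {1..K}"
        then have "length (g k) = L" using g by (auto simp: PiE_iff)
        then show "(\<lambda>j\<in>{1..K}. file_var s j \<omega>) k = g k"
          using k by (auto simp: * list_eq_iff_nth_eq)
      qed
    qed
    then have "{\<omega>\<in>{..<m}. (\<lambda>j\<in>{1..K}. file_var s j \<omega>) = g} = {\<omega>\<in>{..<m}. fst (dec \<omega>) = ?w}"
      by blast
    then have eq: "card {\<omega>\<in>{..<m}. (\<lambda>j\<in>{1..K}. file_var s j \<omega>) = g} = card {w\<in>\<Omega>'. w = ?w} * card R"
      using card_dec_fst[of "\<lambda>w. w = ?w"] by (simp only:)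
    have "?w \<in> \<Omega>'" by (simp only: PiE_def restrict_extensional Int_iff Pi_UNIV UNIV_I)
    then have "{w\<in>\<Omega>'. w = ?w} = {?w}" by blast
    then have "card {w\<in>\<Omega>'. w = ?w} = 1" by (metis card.empty card_insert_disjoint empty_iff finite.emptyI One_nat_def)
    then show "card {\<omega>\<in>{..<m}. (\<lambda>j\<in>{1..K}. file_var s j \<omega>) = g} = card R"
      using eq by (simp only: mult_1)
  qed (use m_pos K1 in auto)
  fix k assume k: "k \<in> {1..K}"
  let ?C = "{k} \<times> {..<L}"
  \<comment> \<open>Prescribing symbols at \<open>T\<close> in file \<open>k\<close> leaves the
    other symbols and the key free. Independence uses all positions as \<open>T\<close>, uniformity
    a single one.\<close>
  have fib: "card {\<omega>\<in>{..<m}. \<forall>t\<in>T. file_var s k \<omega> ! t = g t} = CARD('f) ^ (card ({1..K} \<times> {..<L}) - card T) * card R"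
    if T: "T \<subseteq> {..<L}" for g T
  proof -
    let ?w = "\<lambda>x\<in>{1..K} \<times> {..<L}. g (snd x)"
    have "{\<omega>\<in>{..<m}. \<forall>t\<in>T. file_var s k \<omega> ! t = g t}
      = {\<omega>\<in>{..<m}. restrict (fst (dec \<omega>)) ({k} \<times> T) = restrict ?w ({k} \<times> T)}"
      using k T unfolding restrict_eq_iff by (intro Collect_cong) (auto simp: subset_iff)
    then have "card {\<omega>\<in>{..<m}. \<forall>t\<in>T. file_var s k \<omega> ! t = g t}
      = card {w\<in>\<Omega>'. restrict w ({k} \<times> T) = restrict ?w ({k} \<times> T)} * card R"
      using card_dec_fst[of "\<lambda>w. restrict w ({k} \<times> T) = restrict ?w ({k} \<times> T)"] by (simp only:)
    also have "card {w\<in>\<Omega>'. restrict w ({k} \<times> T) = restrict ?w ({k} \<times> T)}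
      = CARD('f) ^ (card ({1..K} \<times> {..<L}) - card ({k} \<times> T))"
      using k T by (intro card_PiE_fiber) auto
    also have "card ({k} \<times> T) = card T" by (subst card_cartesian_product) simp
    finally show ?thesis .
  qed
  show "prob_space.indep_vars (sample s) (\<lambda>_. count_space UNIV) (\<lambda>t \<omega>. file_var s k \<omega> ! t) {..<file_len s}"
    unfolding sel(1,2)
  proof (rule indep_vars_uniform_fibers)
    show "finite (UNIV :: 'f set)" by simp
    show "(\<lambda>t\<in>{..<L}. file_var s k \<omega> ! t) \<in> PiE {..<L} (\<lambda>_. UNIV)" for \<omega> by simp
    fix g :: "nat \<Rightarrow> 'f" assume g: "g \<in> PiE {..<L} (\<lambda>_. UNIV)"
    have "(\<lambda>t\<in>{..<L}. file_var s k \<omega> ! t) = g \<longleftrightarrow> (\<forall>t\<in>{..<L}. file_var s k \<omega> ! t = g t)" for \<omega>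
      using PiE_restrict[OF g] restrict_eq_iff[where A="{..<L}" and f="\<lambda>t. file_var s k \<omega> ! t" and g=g] by simp
    then show "card {\<omega>\<in>{..<m}. (\<lambda>t\<in>{..<L}. file_var s k \<omega> ! t) = g}
      = CARD('f) ^ (card ({1..K} \<times> {..<L}) - card {..<L}) * card R"
      using fib[where T="{..<L}" and g=g] by simp
  qed (use m_pos L0 in auto)
  fix t assume t: "t < file_len s"
  show "distr (sample s) (count_space UNIV) (\<lambda>\<omega>. file_var s k \<omega> ! t) = uniform_count_measure UNIV"
  proof (rule measure_eqI_finite[where A=UNIV])
    interpret prob_space "sample s" by (rule prob_s)
    fix a :: 'f
    \<comment> \<open>Ensures that the natural subtraction in the exponent is a genuine one.\<close>
    have le: "1 \<le> card ({1..K} \<times> {..<L})" using K1 L0 by (simp add: card_cartesian_product)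
    have "pr (sample s) (\<lambda>\<omega>. file_var s k \<omega> ! t) a = card {\<omega>\<in>{..<m}. \<forall>t'\<in>{t}. file_var s k \<omega> ! t' = a} / m"
      unfolding sel(1) by (subst pr_uniform) auto
    also have "\<dots> = CARD('f) ^ (card ({1..K} \<times> {..<L}) - 1) * card R / m"
      using fib[where T="{t}" and g="\<lambda>_. a"] t by simp
    also have "real m = CARD('f) * CARD('f) ^ (card ({1..K} \<times> {..<L}) - 1) * card R"
    proof -
      have "card \<Omega>' = CARD('f) ^ card ({1..K} \<times> {..<L})" by (subst card_PiE) auto
      also have "\<dots> = CARD('f) * CARD('f) ^ (card ({1..K} \<times> {..<L}) - 1)"
        using le by (metis One_nat_def Suc_le_D Suc_eq_plus1 diff_Suc_1 power_Suc)
      finally show ?thesis unfolding m_eq by simp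
    qed
    finally have "pr (sample s) (\<lambda>\<omega>. file_var s k \<omega> ! t) a = 1 / CARD('f)" using cR by simp
    then have "measure (distr (sample s) (count_space UNIV) (\<lambda>\<omega>. file_var s k \<omega> ! t)) {a} = 1 / CARD('f)"
      by (subst measure_distr_singleton) auto
    moreover have "prob_space (distr (sample s) (count_space UNIV) (\<lambda>\<omega>. file_var s k \<omega> ! t))"
      by (intro prob_space_distr measurable_simple_function) simp
    then interpret D: prob_space "distr (sample s) (count_space UNIV) (\<lambda>\<omega>. file_var s k \<omega> ! t)" .
    show "emeasure (distr (sample s) (count_space UNIV) (\<lambda>\<omega>. file_var s k \<omega> ! t)) {a}
        = emeasure (uniform_count_measure UNIV) {a}"
      unfolding D.emeasure_eq_measure using calculation by (simp add: emeasure_uniform_count_measure)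
  qed (auto simp: sets_uniform_count_measure)
qed

end

sublocale uniform_pir \<subseteq> file_source K s
  by (intro file_source.intro prob_s uniform_s K1)

context uniform_pir
begin

section \<open>Verification of the scheme conditions by counting\<close>

lemma simple_s: "simple_function (sample s) X"
  by simp

lemma pr_s: "pr (sample s) X x = card {\<omega>\<in>{..<m}. X \<omega> = x} / m"
  by (simp add: pr_uniform)

lemma pos_sub': "k \<in> {1..K} \<Longrightarrow> i \<in> P \<Longrightarrow> pos k i \<subseteq> {..<L}"
  using posU by blast

lemma st_sub': "n \<in> {1..N} \<Longrightarrow> st n \<subseteq> P"
  using stU by blast

lemma ent_packet_s: "k \<in> {1..K} \<Longrightarrow> i \<in> P \<Longrightarrow> ent s (packet s k i) = card (pos k i)"
  using ent_packet[of k i] pos_sub' by simp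

lemma valid_storage_s: "valid_storage \<mu> N K s"
  unfolding valid_storage_def
proof (intro conjI ballI)
  show "finite (packets s)" using finP by simp
  show "disjoint_family_on (packet_pos s k) (packets s)" if "k \<in> {1..K}" for k using posD[OF that] by simp
  show "(\<Union>i\<in>packets s. packet_pos s k i) = {..<file_len s}" if "k \<in> {1..K}" for k using posU[OF that] by simp
  show "ent s (packet s k i) = ent s (packet s k' i)" if "k \<in> {1..K}" "k' \<in> {1..K}" "i \<in> packets s" for k k' i
    using that ent_packet_s[OF that(1)] ent_packet_s[OF that(2)] posC[OF that(1)] posC[OF that(2)] by simp
  show "(\<Union>n\<in>{1..N}. stored s n) = packets s" using stU by simp
  show "ent s (content K s n) \<le> \<mu> * real K * real (file_len s)" if n: "n \<in> {1..N}" for n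
  proof -
    have "ent s (content K s n) = K * (\<Sum>i\<in>stored s n. real (card (packet_pos s 1 i)))"
    proof (rule ent_content)
      show "finite (stored s n)" using finite_subset[OF st_sub'[OF n] finP] by simp
      show "packet_pos s k i \<subseteq> {..<file_len s}" if "k \<in> {1..K}" "i \<in> stored s n" for k i
        using pos_sub'[OF that(1), of i] that(2) st_sub'[OF n] by (simp add: subset_iff)
      show "disjoint_family_on (packet_pos s k) (stored s n)" if "k \<in> {1..K}" for k
        using disjoint_family_on_mono[OF st_sub'[OF n] posD[OF that]] by simp
      show "card (packet_pos s k i) = card (packet_pos s 1 i)" if "k \<in> {1..K}" "i \<in> stored s n" for k i
        using posC[OF that(1), of i] that(2) st_sub'[OF n] by (simp add: subset_iff)
    qed
    also have "\<dots> \<le> K * (\<mu> * L)" using stS[OF n] by (intro mult_left_mono) auto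
    finally show ?thesis by (simp add: mult_ac)
  qed
qed

lemma file_of_dec: "k \<in> {1..K} \<Longrightarrow> file_var s k \<omega> = file_of (fst (dec \<omega>)) k"
  by (simp add: file_of_def)

lemma content_dec: "content K s n \<omega> = stored_of n (fst (dec \<omega>))"
  unfolding content_def stored_of_def restrict_eq_iff packet_def by (auto simp: file_of_dec[symmetric] simp del: sel(3))

lemma answer_determined:
  assumes n: "n \<in> {1..N}" and "stored_of n w = stored_of n w'"
  shows "ans n x w = ans n x w'"
proof (rule dep[OF n])
  fix k i t assume a: "k \<in> {1..K}" "i \<in> st n" "t \<in> pos k i"
  have sub: "pos k i \<subseteq> {..<file_len s}" using pos_sub'[OF a(1)] st_sub'[OF n] a(2) by auto
  have "nths (file_of w k) (pos k i) = nths (file_of w' k) (pos k i)"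
    using fun_cong[OF assms(2), of "(k, i)"] a by (simp add: stored_of_def)
  then show "w (k, t) = w' (k, t)" using a(3) unfolding restrict_nths_eq[OF sub] by blast
qed

lemma cond_ent_eq_0I:
  assumes "\<And>\<omega> \<omega>'. \<omega> < m \<Longrightarrow> \<omega>' < m \<Longrightarrow> Y \<omega> = Y \<omega>' \<Longrightarrow> X \<omega> = X \<omega>'"
  shows "cond_ent s X Y = 0"
  unfolding cond_ent_def
proof (rule conditional_entropy_eq_0I[OF simple_s simple_s])
  fix \<omega> assume "\<omega> \<in> space (sample s)"
  then have "\<omega> < m" by simp
  then have "(SOME \<omega>'. \<omega>' < m \<and> Y \<omega>' = Y \<omega>) < m \<and> Y (SOME \<omega>'. \<omega>' < m \<and> Y \<omega>' = Y \<omega>) = Y \<omega>"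
    by (intro someI_ex[of "\<lambda>\<omega>'. \<omega>' < m \<and> Y \<omega>' = Y \<omega>"]) blast
  then show "X \<omega> = (\<lambda>y. X (SOME \<omega>'. \<omega>' < m \<and> Y \<omega>' = y)) (Y \<omega>)"
    using assms \<open>\<omega> < m\<close> by metis
qed

lemma pr_product:
  "pr (sample s) (\<lambda>\<omega>. (X (snd (dec \<omega>)), Y (fst (dec \<omega>)))) (x, y)
    = pr (sample s) (\<lambda>\<omega>. X (snd (dec \<omega>))) x * pr (sample s) (\<lambda>\<omega>. Y (fst (dec \<omega>))) y"
proof -
  have "{\<omega>\<in>{..<m}. (X (snd (dec \<omega>)), Y (fst (dec \<omega>))) = (x, y)}
      = {\<omega>\<in>{..<m}. Y (fst (dec \<omega>)) = y \<and> X (snd (dec \<omega>)) = x}" by auto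
  then show ?thesis
    using c\<Omega>' cR card_dec[of "\<lambda>w. Y w = y" "\<lambda>r. X r = x"] card_dec_fst[of "\<lambda>w. Y w = y"] card_dec_snd[of "\<lambda>r. X r = x"]
    unfolding pr_s by (simp add: m_eq field_simps)
qed

lemma valid_retrieval_s: "valid_retrieval N K s"
  unfolding valid_retrieval_def
proof (intro conjI ballI)
  fix \<theta> assume \<theta>: "\<theta> \<in> {1..K}"
  show "simple_function (sample s) (query s \<theta> n)" "simple_function (sample s) (answer s \<theta> n)" for n
    by (rule simple_s)+
  show "mut_inf s (all_queries N s \<theta>) (all_files K s) = 0"
    unfolding mut_inf_def
  proof (rule mutual_information_eq_0I[OF simple_s simple_s])
    fix x y
    let ?X = "\<lambda>r. \<lambda>n\<in>{1..N}. qry \<theta> n r" and ?Y = "\<lambda>w. \<lambda>k\<in>{1..K}. map (\<lambda>t. w (k, t)) [0..<L]"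
    have q: "all_queries N s \<theta> = (\<lambda>\<omega>. ?X (snd (dec \<omega>)))" by (simp add: all_queries_def fun_eq_iff)
    have f: "all_files K s = (\<lambda>\<omega>. ?Y (fst (dec \<omega>)))" by (simp add: all_files_def fun_eq_iff)
    show "pr (sample s) (\<lambda>\<omega>. (all_queries N s \<theta> \<omega>, all_files K s \<omega>)) (x, y)
       = pr (sample s) (all_queries N s \<theta>) x * pr (sample s) (all_files K s) y"
      unfolding q f by (rule pr_product)
  qed
  show "cond_ent s (answer s \<theta> n) (\<lambda>\<omega>. (query s \<theta> n \<omega>, content K s n \<omega>)) = 0" if n: "n \<in> {1..N}" for n
    by (rule cond_ent_eq_0I) (auto simp: content_dec intro: answer_determined[OF n])
  show "cond_ent s (file_var s \<theta>) (\<lambda>\<omega>. (all_answers N s \<theta> \<omega>, all_queries N s \<theta> \<omega>)) = 0"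
  proof (rule cond_ent_eq_0I)
    fix \<omega> \<omega>' assume \<omega>: "\<omega> < m" "\<omega>' < m"
      and "(all_answers N s \<theta> \<omega>, all_queries N s \<theta> \<omega>) = (all_answers N s \<theta> \<omega>', all_queries N s \<theta> \<omega>')"
    then have a: "answer s \<theta> n \<omega> = answer s \<theta> n \<omega>'" and q: "query s \<theta> n \<omega> = query s \<theta> n \<omega>'" if "n \<in> {1..N}" for n
      using that unfolding all_answers_def all_queries_def prod.inject restrict_eq_iff by blast+
    have "ans n (qry \<theta> n (snd (dec \<omega>))) (fst (dec \<omega>)) = ans n (qry \<theta> n (snd (dec \<omega>))) (fst (dec \<omega>'))"
      if "n \<in> {1..N}" for n using a[OF that] q[OF that] by simp
    then have "fst (dec \<omega>) (\<theta>, t) = fst (dec \<omega>') (\<theta>, t)" if "t < L" for t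
      using dcd[OF \<theta> dec_in(2)[OF \<omega>(1)] _ that] by blast
    then show "file_var s \<theta> \<omega> = file_var s \<theta> \<omega>'" by simp
  qed
qed

lemma pr_query: "pr (sample s) (query s \<theta> n) x = card {r\<in>R. qry \<theta> n r = x} / card R"
proof -
  have "pr (sample s) (query s \<theta> n) x = real (card \<Omega>' * card {r\<in>R. qry \<theta> n r = x}) / real m"
    using card_dec_snd[of "\<lambda>r. qry \<theta> n r = x"] unfolding pr_s by simp
  then show ?thesis using c\<Omega>' unfolding m_eq by simp
qed

text \<open>For a given query, answer and content are functions of the array alone. Hence the joint
  law involves \<theta> only through the number of keys that produce this query.\<close>

lemma private_s: "private_retrieval N K s"
  unfolding private_retrieval_def
proof (intro ballI)
  fix n \<theta> \<theta>' assume n: "n \<in> {1..N}" and \<theta>: "\<theta> \<in> {1..K}" "\<theta>' \<in> {1..K}"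
  let ?T = "\<lambda>\<theta> \<omega>. (query s \<theta> n \<omega>, answer s \<theta> n \<omega>, content K s n \<omega>)"
  have T: "card {\<omega>\<in>{..<m}. ?T \<theta> \<omega> = (x, a, c)}
      = card {w\<in>\<Omega>'. ans n x w = a \<and> stored_of n w = c} * card {r\<in>R. qry \<theta> n r = x}" for \<theta> x a c
  proof -
    have "{\<omega>\<in>{..<m}. ?T \<theta> \<omega> = (x, a, c)}
        = {\<omega>\<in>{..<m}. (ans n x (fst (dec \<omega>)) = a \<and> stored_of n (fst (dec \<omega>)) = c) \<and> qry \<theta> n (snd (dec \<omega>)) = x}"
      by (auto simp: content_dec)
    then show ?thesis
      using card_dec[of "\<lambda>w. ans n x w = a \<and> stored_of n w = c" "\<lambda>r. qry \<theta> n r = x"] by simp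
  qed
  have "pr (sample s) (?T \<theta>) = pr (sample s) (?T \<theta>')"
  proof
    fix v show "pr (sample s) (?T \<theta>) v = pr (sample s) (?T \<theta>') v"
      by (cases v) (simp only: pr_s T prv[OF n \<theta>])
  qed
  then show "distr (sample s) (count_space UNIV) (?T \<theta>) = distr (sample s) (count_space UNIV) (?T \<theta>')"
    by (intro distr_eq_pr prob_s simple_s)
qed

lemma scheme_s: "sc_pir_scheme \<mu> N K s"
  unfolding sc_pir_scheme_def
  by (intro conjI prob_s uniform_s valid_storage_s valid_retrieval_s private_s)

lemma cond_ent_answer_s:
  assumes n: "n \<in> {1..N}"
  shows "cond_ent s (answer s \<theta> n) (query s \<theta> n) = (\<Sum>r\<in>R. uent CARD('f) \<Omega>' (ans n (qry \<theta> n r))) / card R"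
proof -
  have "pr (sample s) (\<lambda>\<omega>. (answer s \<theta> n \<omega>, query s \<theta> n \<omega>)) (a, x)
      = pr (sample s) (query s \<theta> n) x * (card {w\<in>\<Omega>'. ans n x w = a} / card \<Omega>')" for a x
  proof -
    have "{\<omega>\<in>{..<m}. (answer s \<theta> n \<omega>, query s \<theta> n \<omega>) = (a, x)}
        = {\<omega>\<in>{..<m}. ans n x (fst (dec \<omega>)) = a \<and> qry \<theta> n (snd (dec \<omega>)) = x}" by auto
    then have "pr (sample s) (\<lambda>\<omega>. (answer s \<theta> n \<omega>, query s \<theta> n \<omega>)) (a, x)
        = real (card {w\<in>\<Omega>'. ans n x w = a} * card {r\<in>R. qry \<theta> n r = x}) / real m"
      using card_dec[of "\<lambda>w. ans n x w = a" "\<lambda>r. qry \<theta> n r = x"]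
      unfolding pr_s[of "\<lambda>\<omega>. (answer s \<theta> n \<omega>, query s \<theta> n \<omega>)"] by simp
    moreover have "real m = real (card \<Omega>') * real (card R)" by (simp only: m_eq of_nat_mult)
    ultimately show ?thesis by (simp only: pr_query of_nat_mult) (simp add: mult.commute)
  qed
  then have "cond_ent s (answer s \<theta> n) (query s \<theta> n)
      = (\<Sum>x\<in>query s \<theta> n ` space (sample s). pr (sample s) (query s \<theta> n) x * uent CARD('f) \<Omega>' (ans n x))"
    unfolding cond_ent_def by (intro conditional_entropy_uniform_pr simple_s fin\<Omega>')
  also have "query s \<theta> n ` space (sample s) = qry \<theta> n ` R"
  proof -
    have "qry \<theta> n ` snd ` dec ` {..<m} = qry \<theta> n ` R"
      using bij_betw_imp_surj_on[OF bij] ne\<Omega>' by (simp only: snd_image_times if_False)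
    then show ?thesis by (simp add: image_image)
  qed
  also have "(\<Sum>x\<in>qry \<theta> n ` R. pr (sample s) (query s \<theta> n) x * uent CARD('f) \<Omega>' (ans n x))
      = (\<Sum>x\<in>qry \<theta> n ` R. \<Sum>r | r \<in> R \<and> qry \<theta> n r = x. uent CARD('f) \<Omega>' (ans n (qry \<theta> n r)) / card R)"
    unfolding pr_query by (intro sum.cong refl) simp
  also have "\<dots> = (\<Sum>r\<in>R. uent CARD('f) \<Omega>' (ans n (qry \<theta> n r)) / card R)"
    using finR by (intro sum.group) auto
  finally show ?thesis unfolding sum_divide_distrib .
qed

end

text \<open>Comparison with the uniform law on \<open>B\<close>, again through
  \<open>ln x \<le> x - 1\<close>. It allows the download to be bounded by counting possible
  answers, without knowing their law.\<close>

lemma uent_le_log_card: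
  assumes b: "1 < b" and \<Omega>: "finite \<Omega>" and B: "finite B" "X ` \<Omega> \<subseteq> B" "0 < card B"
  shows "uent b \<Omega> X \<le> log b (card B)"
proof (cases "\<Omega> = {}")
  case True
  then show ?thesis using B(3) b by (simp add: uent_def)
next
  case False
  let ?c = "\<lambda>w. real (card {w'\<in>\<Omega>. X w' = X w})" and ?n = "real (card \<Omega>)" and ?B = "real (card B)"
  have n: "0 < ?n" using False \<Omega> by (simp add: card_gt_0_iff)
  have c: "0 < ?c w" if "w \<in> \<Omega>" for w using card_fiber_pos[OF \<Omega> that, of X] by simp
  have "(\<Sum>w\<in>\<Omega>. 1 / ?c w) = (\<Sum>x\<in>B. \<Sum>w | w \<in> \<Omega> \<and> X w = x. 1 / ?c w)"
    using \<Omega> B by (intro sum.group[symmetric]) auto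
  also have "\<dots> \<le> (\<Sum>x\<in>B. 1)" by (intro sum_mono sum_inverse_card_fiber_le_1 \<Omega>)
  finally have s: "(\<Sum>w\<in>\<Omega>. 1 / ?c w) \<le> ?B" by simp
  have "(\<Sum>w\<in>\<Omega>. log b (?n / ?c w)) \<le> (\<Sum>w\<in>\<Omega>. log b ?B + (?n / ?B * (1 / ?c w) - 1) / ln b)"
  proof (rule sum_mono)
    fix w assume w: "w \<in> \<Omega>"
    have "ln (?n / ?c w / ?B) \<le> ?n / ?c w / ?B - 1"
      using n c[OF w] B(3) by (intro ln_le_minus_one) simp
    then have "log b (?n / ?c w / ?B) \<le> (?n / ?B * (1 / ?c w) - 1) / ln b"
      unfolding log_def using b by (intro divide_right_mono) (auto simp: mult.commute)
    moreover have "log b (?n / ?c w / ?B) = log b (?n / ?c w) - log b ?B"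
      using log_divide[of b "?n / ?c w" ?B] n c[OF w] B(3) by simp
    ultimately show "log b (?n / ?c w) \<le> log b ?B + (?n / ?B * (1 / ?c w) - 1) / ln b" by simp
  qed
  also have "\<dots> = ?n * log b ?B + (?n / ?B * (\<Sum>w\<in>\<Omega>. 1 / ?c w) - ?n) / ln b"
    by (simp only: sum.distrib sum_subtractf sum_divide_distrib[symmetric] sum_distrib_left[symmetric] sum_constant)
      simp
  also have "\<dots> \<le> ?n * log b ?B"
  proof -
    have "?n / ?B * (\<Sum>w\<in>\<Omega>. 1 / ?c w) \<le> ?n / ?B * ?B" using s n B(3) by (intro mult_left_mono) auto
    then have "?n / ?B * (\<Sum>w\<in>\<Omega>. 1 / ?c w) - ?n \<le> 0" using B(3) by simp
    then show ?thesis using b by (simp add: divide_nonpos_pos)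
  qed
  finally show ?thesis using n by (simp add: uent_def divide_le_eq mult.commute)
qed

section \<open>The Tian-Sun-Chen code on a family of server sets\<close>

text \<open>For \<open>j = K - 1\<close> the right side is the expected number of symbols that the
  code downloads for a set of M servers, and \<open>M - 1\<close> is the number of symbols
  retrieved.\<close>

lemma geo_closed:
  assumes "0 < M"
  shows "(real M - 1) * (1 + geo j (real M)) = real M - real M / real M ^ Suc j"
proof (induction j)
  case 0
  then show ?case using assms by simp
next
  case (Suc j)
  have "geo (Suc j) (real M) = (1 + geo j (real M)) / real M"
    using geo_Suc[of "real M" j] assms by (simp add: field_simps)
  then have "(real M - 1) * (1 + geo (Suc j) (real M)) = (real M - 1) + (real M - 1) * (1 + geo j (real M)) / real M"
    by (simp add: distrib_left)
  also have "\<dots> = (real M - 1) + (real M - real M / real M ^ Suc j) / real M" by (simp only: Suc.IH)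
  also have "\<dots> = real M - real M / real M ^ Suc (Suc j)" using assms by (simp add: field_simps)
  finally show ?case .
qed

text \<open>
  For every set \<open>S\<close> of the family, the servers in \<open>S\<close> run the code of Tian, Sun and Chen: a random vector
  \<open>f\<close> of numbers below \<open>M\<close> is drawn, and the \<open>m\<close>-th server receives \<open>f\<close> with the entry of the desired
  file changed such that the sum is \<open>m\<close> modulo \<open>M\<close>; it answers with the sum of the packets with these
  indices, index \<open>0\<close> standing for the zero packet. The maps \<open>lab\<close>, \<open>encq\<close> and \<open>enca\<close> relabel packets, queries
  and answers, so that the single-set code and a code with alphabet \<open>nat\<close> are instances as well.
\<close>

locale tsc =
  fixes \<mu> :: real and N K M :: nat and \<S> :: "nat set set" and \<sigma> :: "nat set \<Rightarrow> nat \<Rightarrow> nat"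
    and cell :: "nat set \<times> nat \<Rightarrow> nat" and lab :: "nat set \<times> nat \<Rightarrow> 'i"
    and encq :: "(nat set \<Rightarrow> nat) \<Rightarrow> 'q" and decq :: "'q \<Rightarrow> nat set \<Rightarrow> nat"
    and enca :: "(nat set \<Rightarrow> 'f::{field,finite} list list) \<Rightarrow> 'a" and deca :: "'a \<Rightarrow> nat set \<Rightarrow> 'f list list"
  assumes K1: "1 \<le> K" and M2: "2 \<le> M" and \<mu>: "\<mu> * real N = real M"
    and ne\<S>: "\<S> \<noteq> {}" and sub\<S>: "S \<in> \<S> \<Longrightarrow> S \<subseteq> {1..N}" and \<sigma>: "S \<in> \<S> \<Longrightarrow> bij_betw (\<sigma> S) {1..M} S"
    and cover: "n \<in> {1..N} \<Longrightarrow> N * card {S\<in>\<S>. n \<in> S} = M * card \<S>"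
    and cell: "bij_betw cell (\<S> \<times> {1..<M}) {..<card \<S> * (M - 1)}"
    and lab: "inj_on lab (\<S> \<times> {1..<M})"
    and decq: "n \<in> {1..N} \<Longrightarrow> decq (encq (restrict v {S\<in>\<S>. n \<in> S})) = restrict v {S\<in>\<S>. n \<in> S}"
    and deca: "n \<in> {1..N} \<Longrightarrow> deca (enca (restrict v' {S\<in>\<S>. n \<in> S})) = restrict v' {S\<in>\<S>. n \<in> S}"
begin

abbreviation "parts n \<equiv> {S\<in>\<S>. n \<in> S}"
definition "F = {1..K} \<rightarrow>\<^sub>E {..<M}"
definition "R = \<S> \<rightarrow>\<^sub>E F"
text \<open>The factor \<open>M - 1\<close> acts as -1 modulo \<open>M\<close> and avoids
  subtraction of natural numbers; the entries then sum to \<open>m\<close> modulo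
  \<open>M\<close>.\<close>

definition qvec :: "nat \<Rightarrow> nat \<Rightarrow> (nat \<Rightarrow> nat) \<Rightarrow> nat \<Rightarrow> nat" where
  "qvec \<theta> m f k = (if k = \<theta> then (m + (M - 1) * sum f ({1..K} - {\<theta>})) mod M else f k)"
text \<open>Query vectors are coded as numbers since the set of sub-packetizations fixes the query
  type of \<open>sf\<close> to natural numbers. Files count from 1 and list positions from 0, whence
  the shift in \<open>dv\<close>.\<close>

definition ev :: "(nat \<Rightarrow> nat) \<Rightarrow> nat" where
  "ev v = to_nat (map v [1..<Suc K])"
definition dv :: "nat \<Rightarrow> nat \<Rightarrow> nat" where
  "dv x k = (from_nat x :: nat list) ! (k - 1)"
definition "\<tau> S n = inv_into {1..M} (\<sigma> S) n"
definition "L = card \<S> * (M - 1)"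
text \<open>Each packet is a single symbol, at the same position in all files. The image form yields
  the empty set for a foreign label.\<close>

definition posn :: "nat \<Rightarrow> 'i \<Rightarrow> nat set" where
  "posn k l = cell ` {z \<in> \<S> \<times> {1..<M}. lab z = l}"
definition "P = lab ` (\<S> \<times> {1..<M})"
definition "st n = lab ` (parts n \<times> {1..<M})"
definition \<beta> :: "nat \<Rightarrow> nat \<Rightarrow> nat \<Rightarrow> nat \<Rightarrow> nat \<Rightarrow> 'f" where
  "\<beta> n x k i j = (if dv x k = i then 1 else 0)"
definition la :: "nat \<Rightarrow> (nat \<times> nat \<Rightarrow> 'f) \<Rightarrow> nat set \<Rightarrow> 'f list list" where
  "la x w S = lin_answer K (\<lambda>_ _. 1) \<beta> {1..<M} (\<lambda>k i. [w (k, cell (S, i))]) 0 x"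
definition "qry \<theta> n r = encq (\<lambda>S\<in>parts n. ev (qvec \<theta> (\<tau> S n) (r S)))"
definition "ans n x w = enca (\<lambda>S\<in>parts n. la (decq x S) w S)"

lemma dv_ev: "k \<in> {1..K} \<Longrightarrow> dv (ev v) k = v k"
proof -
  assume k: "k \<in> {1..K}"
  then have "k - 1 < length [1..<Suc K]" "[1..<Suc K] ! (k - 1) = k"
    by (auto simp del: upt_Suc)
  then show ?thesis by (simp only: dv_def ev_def from_nat_to_nat nth_map)
qed

lemma N_pos: "0 < N"
  using \<mu> M2 by (cases "N = 0") auto

lemma fin\<S>: "finite \<S>"
  by (rule finite_subset[of _ "Pow {1..N}"]) (use sub\<S> in auto)

lemma card\<S>: "0 < card \<S>"
  using fin\<S> ne\<S> by (simp add: card_gt_0_iff)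

lemma L_pos: "0 < L"
  using card\<S> M2 by (simp add: L_def)

lemma finF: "finite F"
  unfolding F_def by (intro finite_PiE) auto

lemma cardF: "card F = M ^ K"
  unfolding F_def by (subst card_PiE) auto

lemma F_ne: "F \<noteq> {}"
  using cardF M2 by (metis card.empty not_numeral_le_zero power_not_zero)

lemma finR: "finite R"
  unfolding R_def by (intro finite_PiE fin\<S> finF)

lemma R_ne: "R \<noteq> {}"
  unfolding R_def using F_ne by (simp add: PiE_eq_empty_iff)

lemma R_F: "r \<in> R \<Longrightarrow> S \<in> \<S> \<Longrightarrow> r S \<in> F"
  unfolding R_def by (auto simp: PiE_iff)

lemma \<tau>_\<sigma>: "S \<in> \<S> \<Longrightarrow> m \<in> {1..M} \<Longrightarrow> \<tau> S (\<sigma> S m) = m"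
  unfolding \<tau>_def using \<sigma> by (intro inv_into_f_f) (auto simp: bij_betw_def)

lemma \<sigma>_in: "S \<in> \<S> \<Longrightarrow> m \<in> {1..M} \<Longrightarrow> \<sigma> S m \<in> S"
  using \<sigma>[of S] unfolding bij_betw_def by blast

lemma \<sigma>_server: "S \<in> \<S> \<Longrightarrow> m \<in> {1..M} \<Longrightarrow> \<sigma> S m \<in> {1..N}"
  using \<sigma>_in sub\<S> by blast

lemma la_eq: "la x w S = [[\<Sum>k\<in>{1..K}. if dv x k \<in> {1..<M} then w (k, cell (S, dv x k)) else 0]]"
proof -
  have ne: "{1..K} \<times> {1..<M} \<noteq> {}" using K1 M2 by auto
  have len: "(\<lambda>z. length ((\<lambda>(k, i). [w (k, cell (S, i))]) z)) ` ({1..K} \<times> {1..<M}) = {1}"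
    using ne by (auto simp: image_def split_beta)
  have "(\<Sum>(k, i)\<in>{1..K} \<times> {1..<M}. \<beta> 0 x k i 1 * w (k, cell (S, i)))
      = (\<Sum>k\<in>{1..K}. \<Sum>i\<in>{1..<M}. \<beta> 0 x k i 1 * w (k, cell (S, i)))"
    by (simp add: sum.cartesian_product)
  also have "\<dots> = (\<Sum>k\<in>{1..K}. if dv x k \<in> {1..<M} then w (k, cell (S, dv x k)) else 0)"
  proof (intro sum.cong refl)
    fix k
    have "(\<Sum>i\<in>{1..<M}. \<beta> 0 x k i 1 * w (k, cell (S, i))) = (\<Sum>i\<in>{1..<M}. if i = dv x k then w (k, cell (S, i)) else 0)"
      by (intro sum.cong) (auto simp: \<beta>_def)
    then show "(\<Sum>i\<in>{1..<M}. \<beta> 0 x k i 1 * w (k, cell (S, i))) = (if dv x k \<in> {1..<M} then w (k, cell (S, dv x k)) else 0)"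
      by simp
  qed
  finally have sum: "(\<Sum>(k, i)\<in>{1..K} \<times> {1..<M}. \<beta> 0 x k i 1 * w (k, cell (S, i)))
      = (\<Sum>k\<in>{1..K}. if dv x k \<in> {1..<M} then w (k, cell (S, dv x k)) else 0)" .
  have "lin_comb ({1..K} \<times> {1..<M}) (\<lambda>(k, i). \<beta> 0 x k i 1) (\<lambda>(k, i). [w (k, cell (S, i))])
      = [\<Sum>z\<in>{1..K} \<times> {1..<M}. (\<lambda>(k, i). \<beta> 0 x k i 1) z * nth_default 0 ((\<lambda>(k, i). [w (k, cell (S, i))]) z) 0]"
    unfolding lin_comb_def len by simp
  also have "\<dots> = [\<Sum>(k, i)\<in>{1..K} \<times> {1..<M}. \<beta> 0 x k i 1 * w (k, cell (S, i))]"
    by (simp add: split_beta nth_default_def)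
  finally show ?thesis unfolding la_def lin_answer_def sum by simp
qed

section \<open>Arithmetic of query vectors, privacy and decoding\<close>

lemma sum_split: "\<theta> \<in> {1..K} \<Longrightarrow> sum (f :: nat \<Rightarrow> nat) {1..K} = f \<theta> + sum f ({1..K} - {\<theta>})"
  by (rule sum.remove) auto

lemma qvec_lt: "f \<in> F \<Longrightarrow> k \<in> {1..K} \<Longrightarrow> qvec \<theta> m f k < M"
  using M2 by (auto simp: qvec_def F_def PiE_iff)

lemma mult_pred: "(M - 1) * x + x = M * (x :: nat)"
  using M2 by (cases M) auto

lemma sum_qvec: "\<theta> \<in> {1..K} \<Longrightarrow> sum (qvec \<theta> m f) {1..K} mod M = m mod M"
proof -
  assume \<theta>: "\<theta> \<in> {1..K}"
  let ?s = "sum f ({1..K} - {\<theta>})"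
  have "sum (qvec \<theta> m f) ({1..K} - {\<theta>}) = ?s" by (intro sum.cong) (auto simp: qvec_def)
  then have "sum (qvec \<theta> m f) {1..K} mod M = ((m + (M - 1) * ?s) mod M + ?s) mod M"
    using sum_split[OF \<theta>, of "qvec \<theta> m f"] by (simp add: qvec_def)
  also have "\<dots> = (m + ((M - 1) * ?s + ?s)) mod M" by (simp add: mod_add_left_eq add.assoc)
  also have "\<dots> = m mod M" unfolding mult_pred by simp
  finally show ?thesis .
qed

text \<open>An entry below \<open>M\<close> is determined by the other entries and the residue of
  the sum. Hence a query vector does not betray which of its entries was adjusted.\<close>

lemma complement_mod:
  assumes \<theta>: "\<theta> \<in> {1..K}" and "sum q {1..K} mod M = m mod M" and "q \<theta> < M"
  shows "(m + (M - 1) * sum q ({1..K} - {\<theta>})) mod M = q \<theta>"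
proof -
  let ?s = "sum q ({1..K} - {\<theta>})"
  have "(m + (M - 1) * ?s) mod M = (m mod M + (M - 1) * ?s) mod M" by (simp add: mod_add_left_eq)
  also have "\<dots> = (sum q {1..K} + (M - 1) * ?s) mod M" unfolding assms(2)[symmetric] by (simp add: mod_add_left_eq)
  also have "sum q {1..K} + (M - 1) * ?s = q \<theta> + ((M - 1) * ?s + ?s)" using sum_split[OF \<theta>, of q] by simp
  also have "\<dots> mod M = q \<theta>" unfolding mult_pred using assms(3) by simp
  finally show ?thesis .
qed

text \<open>
  \<open>tr\<close> turns keys for \<open>\<theta>\<close> into keys for \<open>\<theta>'\<close> producing the same query at the \<open>m\<close>-th server; the entry
  \<open>f \<theta>\<close>, which the query does not use, is kept in position \<open>\<theta>'\<close> to make this a bijection.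
\<close>

definition tr :: "nat \<Rightarrow> nat \<Rightarrow> nat \<Rightarrow> (nat \<Rightarrow> nat) \<Rightarrow> nat \<Rightarrow> nat" where
  "tr \<theta> \<theta>' m f = (\<lambda>k\<in>{1..K}. if k = \<theta>' then f \<theta> else qvec \<theta> m f k)"

lemma tr_F: "\<theta> \<in> {1..K} \<Longrightarrow> f \<in> F \<Longrightarrow> tr \<theta> \<theta>' m f \<in> F"
  using qvec_lt[of f] by (auto simp: tr_def F_def PiE_iff)

lemma qvec_tr:
  assumes \<theta>: "\<theta> \<in> {1..K}" "\<theta>' \<in> {1..K}" and f: "f \<in> F" and k: "k \<in> {1..K}"
  shows "qvec \<theta>' m (tr \<theta> \<theta>' m f) k = qvec \<theta> m f k"
proof (cases "k = \<theta>'")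
  case True
  have "sum (tr \<theta> \<theta>' m f) ({1..K} - {\<theta>'}) = sum (qvec \<theta> m f) ({1..K} - {\<theta>'})"
    by (intro sum.cong) (auto simp: tr_def)
  then show ?thesis
    using complement_mod[OF \<theta>(2) sum_qvec[OF \<theta>(1), of m f] qvec_lt[OF f \<theta>(2), of \<theta> m]] True by (simp add: qvec_def)
next
  case False
  then show ?thesis using k by (simp add: qvec_def tr_def)
qed

lemma tr_tr:
  assumes \<theta>: "\<theta> \<in> {1..K}" "\<theta>' \<in> {1..K}" and f: "f \<in> F"
  shows "tr \<theta>' \<theta> m (tr \<theta> \<theta>' m f) = f"
proof (rule PiE_ext[OF _ f[unfolded F_def]])
  show "tr \<theta>' \<theta> m (tr \<theta> \<theta>' m f) \<in> {1..K} \<rightarrow>\<^sub>E {..<M}"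
    using tr_F[OF \<theta>(2) tr_F[OF \<theta>(1) f]] by (simp add: F_def)
  fix k assume k: "k \<in> {1..K}"
  show "tr \<theta>' \<theta> m (tr \<theta> \<theta>' m f) k = f k"
  proof (cases "k = \<theta>")
    case True
    then show ?thesis using \<theta> by (simp add: tr_def)
  next
    case False
    have "tr \<theta>' \<theta> m (tr \<theta> \<theta>' m f) k = qvec \<theta>' m (tr \<theta> \<theta>' m f) k"
      using False k by (simp add: tr_def[of \<theta>'])
    also have "\<dots> = qvec \<theta> m f k" by (rule qvec_tr[OF \<theta> f k])
    finally show ?thesis using False by (simp add: qvec_def)
  qed
qed

lemma ev_cong: "(\<And>k. k \<in> {1..K} \<Longrightarrow> v k = v' k) \<Longrightarrow> ev v = ev v'"
proof -
  assume "\<And>k. k \<in> {1..K} \<Longrightarrow> v k = v' k"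
  then have "map v [1..<Suc K] = map v' [1..<Suc K]" by (intro map_cong) (auto simp del: upt_Suc)
  then show ?thesis by (simp only: ev_def)
qed

text \<open>The map \<open>tr\<close> is applied for every set separately. For sets without server
  \<open>n\<close> the index \<open>\<tau> S n\<close> is arbitrary, but \<open>tr\<close> is
  invertible for every index, and such sets do not occur in the query. One inequality suffices by
  symmetry in the two files.\<close>

lemma qry_private_le:
  assumes \<theta>: "\<theta> \<in> {1..K}" "\<theta>' \<in> {1..K}"
  shows "card {r\<in>R. qry \<theta> n r = x} \<le> card {r\<in>R. qry \<theta>' n r = x}"
proof (rule card_inj_on_le)
  let ?t = "\<lambda>\<theta> \<theta>' r. \<lambda>S\<in>\<S>. tr \<theta> \<theta>' (\<tau> S n) (r S)"
  have inv: "?t \<theta>' \<theta> (?t \<theta> \<theta>' r) = r" if r: "r \<in> R" for r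
  proof (rule PiE_ext[OF _ r[unfolded R_def]])
    show "?t \<theta>' \<theta> (?t \<theta> \<theta>' r) \<in> \<S> \<rightarrow>\<^sub>E F"
      using tr_F[OF \<theta>(2) tr_F[OF \<theta>(1) R_F[OF r]]] by auto
    show "?t \<theta>' \<theta> (?t \<theta> \<theta>' r) S = r S" if "S \<in> \<S>" for S
      using tr_tr[OF \<theta> R_F[OF r that]] that by simp
  qed
  show "inj_on (?t \<theta> \<theta>') {r\<in>R. qry \<theta> n r = x}"
    using inv by (intro inj_on_inverseI[where g="?t \<theta>' \<theta>"]) blast
  show "?t \<theta> \<theta>' ` {r\<in>R. qry \<theta> n r = x} \<subseteq> {r\<in>R. qry \<theta>' n r = x}"
  proof
    fix r' assume "r' \<in> ?t \<theta> \<theta>' ` {r\<in>R. qry \<theta> n r = x}"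
    then obtain r where r: "r \<in> R" "qry \<theta> n r = x" "r' = ?t \<theta> \<theta>' r" by blast
    have "r' \<in> R" unfolding r(3) R_def using tr_F[OF \<theta>(1) R_F[OF r(1)]] by auto
    moreover have "ev (qvec \<theta>' (\<tau> S n) (r' S)) = ev (qvec \<theta> (\<tau> S n) (r S))" if "S \<in> parts n" for S
      using qvec_tr[OF \<theta> R_F[OF r(1)]] that by (intro ev_cong) (simp add: r(3))
    then have "qry \<theta>' n r' = qry \<theta> n r"
      unfolding qry_def by (intro arg_cong[where f=encq] restrict_ext) blast
    ultimately show "r' \<in> {r\<in>R. qry \<theta>' n r = x}" using r(2) by simp
  qed
  show "finite {r\<in>R. qry \<theta>' n r = x}" using finR by simp
qed

lemma shift_surj:
  assumes "i < M"
  shows "\<exists>m\<in>{1..M}. (m + c) mod M = i"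
proof -
  let ?m = "(i + (M - 1) * c) mod M"
  have "(?m + c) mod M = (i + ((M - 1) * c + c)) mod M" by (simp add: mod_add_left_eq add.assoc)
  then have e: "(?m + c) mod M = i" unfolding mult_pred using assms by simp
  \<comment> \<open>Servers are numbered from 1 to M, so a residue 0 is represented by M.\<close>
  show ?thesis
  proof (cases "?m = 0")
    case True
    then have "(M + c) mod M = i" using e by simp
    then show ?thesis using M2 by (intro bexI[of _ M]) auto
  next
    case False
    moreover have "?m \<le> M" using M2 by (simp add: less_imp_le)
    ultimately show ?thesis using e by (intro bexI[of _ ?m]) auto
  qed
qed

text \<open>As \<open>m\<close> varies, the index for the desired file runs through all residues
  while the interference \<open>J\<close> stays the same. The server that gets index 0 returns
  \<open>J\<close> alone, and the other answers then reveal all packets of the desired file.\<close>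

lemma decode_part:
  assumes \<theta>: "\<theta> \<in> {1..K}" and f: "f \<in> F" and i: "i \<in> {1..<M}"
    and eq: "\<And>m. m \<in> {1..M} \<Longrightarrow> la (ev (qvec \<theta> m f)) w S = la (ev (qvec \<theta> m f)) w' S"
  shows "w (\<theta>, cell (S, i)) = w' (\<theta>, cell (S, i))"
proof -
  define J where "J w = (\<Sum>k\<in>{1..K} - {\<theta>}. if f k \<in> {1..<M} then w (k, cell (S, f k)) else (0 :: 'f))" for w
  define t where "t w v = (if v \<in> {1..<M} then w (\<theta>, cell (S, v)) else (0 :: 'f))" for w v
  let ?c = "(M - 1) * sum f ({1..K} - {\<theta>})"
  have la: "la (ev (qvec \<theta> m f)) w S = [[t w ((m + ?c) mod M) + J w]]" for m w
  proof -
    have "(\<Sum>k\<in>{1..K}. if dv (ev (qvec \<theta> m f)) k \<in> {1..<M} then w (k, cell (S, dv (ev (qvec \<theta> m f)) k)) else 0)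
        = (\<Sum>k\<in>{1..K}. if qvec \<theta> m f k \<in> {1..<M} then w (k, cell (S, qvec \<theta> m f k)) else 0)"
      by (intro sum.cong refl) (simp only: dv_ev)
    also have "\<dots> = t w ((m + ?c) mod M) + (\<Sum>k\<in>{1..K} - {\<theta>}. if qvec \<theta> m f k \<in> {1..<M} then w (k, cell (S, qvec \<theta> m f k)) else 0)"
      using \<theta> by (subst sum.remove[OF _ \<theta>]) (auto simp: t_def qvec_def)
    also have "(\<Sum>k\<in>{1..K} - {\<theta>}. if qvec \<theta> m f k \<in> {1..<M} then w (k, cell (S, qvec \<theta> m f k)) else 0) = J w"
      unfolding J_def by (intro sum.cong) (auto simp: qvec_def)
    finally show ?thesis unfolding la_eq by simp
  qed
  have all: "t w v + J w = t w' v + J w'" if v: "v < M" for v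
  proof -
    obtain m where "m \<in> {1..M}" "(m + ?c) mod M = v" using shift_surj[OF v] by blast
    then show ?thesis using eq[of m] unfolding la by simp
  qed
  have "t w 0 = 0" "t w' 0 = 0" by (simp_all add: t_def)
  then have "J w = J w'" using all[of 0] M2 by simp
  then have "t w i = t w' i" using all[of i] i by simp
  then show ?thesis using i by (simp add: t_def)
qed

lemma posn_lab: "z \<in> \<S> \<times> {1..<M} \<Longrightarrow> posn k (lab z) = {cell z}"
  using lab by (auto simp: posn_def inj_on_def)

definition "m = card (({1..K} \<times> {..<L} \<rightarrow>\<^sub>E (UNIV :: 'f set)) \<times> R)"
definition "dec = (SOME h. bij_betw h {..<m} (({1..K} \<times> {..<L} \<rightarrow>\<^sub>E (UNIV :: 'f set)) \<times> R))"

lemma dec: "bij_betw dec {..<m} (({1..K} \<times> {..<L} \<rightarrow>\<^sub>E (UNIV :: 'f set)) \<times> R)"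
proof -
  have "finite (({1..K} \<times> {..<L} \<rightarrow>\<^sub>E (UNIV :: 'f set)) \<times> R)"
    using finR by (intro finite_cartesian_product finite_PiE) auto
  from ex_bij_betw_nat_finite[OF this] show ?thesis
    unfolding dec_def m_def atLeast0LessThan by (rule someI_ex)
qed

lemma union_parts: "(\<Union>n\<in>{1..N}. parts n) = \<S>"
proof -
  have "\<exists>n\<in>{1..N}. n \<in> S" if "S \<in> \<S>" for S
    using \<sigma>_in[OF that, of 1] \<sigma>_server[OF that, of 1] M2 by auto
  then show ?thesis by blast
qed

end

sublocale tsc \<subseteq> U: uniform_pir \<mu> N K L P posn st R qry ans m dec
proof
  fix k
  show "disjoint_family_on (posn k) P"
    unfolding disjoint_family_on_def
  proof (intro ballI impI)
    fix i j assume "i \<in> P" "j \<in> P" "i \<noteq> j"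
    have inj: "inj_on cell (\<S> \<times> {1..<M})" using cell by (rule bij_betw_imp_inj_on)
    have "posn k i \<inter> posn k j = cell ` ({z \<in> \<S> \<times> {1..<M}. lab z = i} \<inter> {z \<in> \<S> \<times> {1..<M}. lab z = j})"
      unfolding posn_def by (rule inj_on_image_Int[OF inj, symmetric]) blast+
    also have "\<dots> = {}" using \<open>i \<noteq> j\<close> by blast
    finally show "posn k i \<inter> posn k j = {}" .
  qed
  have "(\<Union>i\<in>P. posn k i) = cell ` (\<S> \<times> {1..<M})" unfolding posn_def P_def by blast
  then show "(\<Union>i\<in>P. posn k i) = {..<L}" using cell by (simp add: bij_betw_def L_def)
  show "card (posn k i) = card (posn 1 i)" for i by (simp add: posn_def)
next
  have "(\<Union>n\<in>{1..N}. st n) = lab ` ((\<Union>n\<in>{1..N}. parts n) \<times> {1..<M})" unfolding st_def by blast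
  then show "(\<Union>n\<in>{1..N}. st n) = P" unfolding union_parts P_def .
next
  fix n assume n: "n \<in> {1..N}"
  have "card (st n) = card (parts n \<times> {1..<M})"
    unfolding st_def by (intro card_image inj_on_subset[OF lab]) auto
  then have c: "card (st n) = card (parts n) * (M - 1)" by (simp only: card_cartesian_product card_atLeastLessThan)
  have "(\<Sum>i\<in>st n. real (card (posn 1 i))) = (\<Sum>i\<in>st n. 1)"
    by (intro sum.cong refl) (auto simp: st_def posn_lab)
  also have "\<dots> = real (card (parts n)) * real (M - 1)" by (simp add: c)
  also have "real (card (parts n)) = \<mu> * real (card \<S>)"
  proof -
    have "real N * real (card (parts n)) = real M * real (card \<S>)"
      using cover[OF n] by (metis of_nat_mult)
    also have "\<dots> = real N * (\<mu> * real (card \<S>))" unfolding \<mu>[symmetric] by simp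
    finally show ?thesis using N_pos by simp
  qed
  finally show "(\<Sum>i\<in>st n. real (card (posn 1 i))) \<le> \<mu> * real L" by (simp add: L_def)
next
  fix n x and w w' :: "nat \<times> nat \<Rightarrow> 'f"
  assume n: "n \<in> {1..N}" and eq: "\<And>k i t. k \<in> {1..K} \<Longrightarrow> i \<in> st n \<Longrightarrow> t \<in> posn k i \<Longrightarrow> w (k, t) = w' (k, t)"
  have "w (k, cell (S, i)) = w' (k, cell (S, i))" if "k \<in> {1..K}" "S \<in> parts n" "i \<in> {1..<M}" for k S i
  proof (rule eq[OF that(1), of "lab (S, i)"])
    show "lab (S, i) \<in> st n" using that unfolding st_def by blast
    show "cell (S, i) \<in> posn k (lab (S, i))" using that posn_lab[of "(S, i)"] by simp
  qed
  then have "la y w S = la y w' S" if "S \<in> parts n" for y S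
    unfolding la_eq using that by (intro arg_cong[where f="\<lambda>z. [[z]]"] sum.cong) auto
  then show "ans n x w = ans n x w'"
    unfolding ans_def by (intro arg_cong[where f=enca] restrict_ext) blast
next
  fix \<theta> r t and w w' :: "nat \<times> nat \<Rightarrow> 'f"
  assume \<theta>: "\<theta> \<in> {1..K}" and r: "r \<in> R" and eq: "\<And>n. n \<in> {1..N} \<Longrightarrow> ans n (qry \<theta> n r) w = ans n (qry \<theta> n r) w'"
    and t: "t < L"
  obtain S i where Si: "S \<in> \<S>" "i \<in> {1..<M}" "t = cell (S, i)"
  proof -
    have "t \<in> cell ` (\<S> \<times> {1..<M})"
      using t bij_betw_imp_surj_on[OF cell] unfolding L_def by simp
    then show ?thesis using that by blast
  qed
  have "la (ev (qvec \<theta> m' (r S))) w S = la (ev (qvec \<theta> m' (r S))) w' S" if m: "m' \<in> {1..M}" for m'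
  proof -
    let ?n = "\<sigma> S m'"
    have n: "?n \<in> {1..N}" and mem: "S \<in> parts ?n" using \<sigma>_server[OF Si(1) m] \<sigma>_in[OF Si(1) m] Si(1) by auto
    have d: "decq (qry \<theta> ?n r) S = ev (qvec \<theta> m' (r S))"
      unfolding qry_def decq[OF n] using mem \<tau>_\<sigma>[OF Si(1) m] by simp
    have "deca (ans ?n (qry \<theta> ?n r) w) S = deca (ans ?n (qry \<theta> ?n r) w') S" using eq[OF n] by simp
    then show ?thesis unfolding ans_def deca[OF n] using mem d by simp
  qed
  then show "w (\<theta>, t) = w' (\<theta>, t)"
    unfolding Si(3) by (rule decode_part[OF \<theta> R_F[OF r Si(1)] Si(2)])
next
  fix n \<theta> \<theta>' x assume "\<theta> \<in> {1..K}" "\<theta>' \<in> {1..K}"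
  then show "card {r\<in>R. qry \<theta> n r = x} = card {r\<in>R. qry \<theta>' n r = x}"
    by (intro antisym qry_private_le)
next
  show "finite P" unfolding P_def using fin\<S> by simp
qed (fact K1 L_pos finR R_ne dec)+

context tsc
begin

section \<open>Download cost of the code\<close>

abbreviation "nz v \<equiv> \<not> (\<forall>k\<in>{1..K}. v k = (0::nat))"

lemma fiber_R:
  assumes "g \<in> R"
  shows "card {r\<in>R. r = g} = 1"
proof -
  have "{r\<in>R. r = g} = {g}" using assms by blast
  then show ?thesis by simp
qed

text \<open>A single coordinate of a uniform key is uniform on \<open>F\<close>; keys for the other
  sets contribute the same factor to numerator and denominator.\<close>

lemma card_R_coordinate:
  assumes S: "S \<in> \<S>"
  shows "real (card {r\<in>R. E (r S)}) / card R = real (card {f\<in>F. E f}) / card F"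
proof -
  have fib: "card {r\<in>R. (\<lambda>j\<in>\<S>. r j) = g} = 1" if "g \<in> \<S> \<rightarrow>\<^sub>E F" for g
  proof -
    have "(\<lambda>j\<in>\<S>. r j) = r" if "r \<in> R" for r
      using that unfolding R_def by (rule PiE_restrict)
    then have "{r\<in>R. (\<lambda>j\<in>\<S>. r j) = g} = {r\<in>R. r = g}" by (intro Collect_cong) auto
    then show ?thesis using fiber_R that unfolding R_def by simp
  qed
  have mem: "(\<lambda>j\<in>\<S>. r j) \<in> \<S> \<rightarrow>\<^sub>E F" if "r \<in> R" for r
    using that R_F by auto
  note c = card_uniform_fibers[where Y="\<lambda>S r. r S", OF finR fin\<S> finF mem fib]
  let ?A = "\<lambda>j. if j = S then {f. E f} else UNIV"
  have "{r\<in>R. E (r S)} = {r\<in>R. \<forall>j\<in>\<S>. r j \<in> ?A j}" using S by auto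
  then have "card {r\<in>R. E (r S)} = (\<Prod>j\<in>\<S>. card (F \<inter> ?A j))" using c[of ?A] by simp
  also have "\<dots> = card (F \<inter> ?A S) * (\<Prod>j\<in>\<S> - {S}. card (F \<inter> ?A j))" by (rule prod.remove[OF fin\<S> S])
  also have "(\<Prod>j\<in>\<S> - {S}. card (F \<inter> ?A j)) = card F ^ card (\<S> - {S})" by simp
  also have "F \<inter> ?A S = {f\<in>F. E f}" by auto
  finally have 1: "card {r\<in>R. E (r S)} = card {f\<in>F. E f} * card F ^ card (\<S> - {S})" .
  have "card R = card F ^ card \<S>" unfolding R_def by (subst card_PiE[OF fin\<S>]) simp
  also have "card \<S> = Suc (card (\<S> - {S}))" using S fin\<S> by (rule card.remove[rotated])
  finally have 2: "card R = card F * card F ^ card (\<S> - {S})" by simp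
  have "0 < card F" using finF F_ne by (simp add: card_gt_0_iff)
  then show ?thesis unfolding 1 2 by simp
qed

lemma la_zero: "\<not> nz v \<Longrightarrow> la (ev v) w S = [[0]]"
proof -
  assume "\<not> nz v"
  then have "(\<Sum>k\<in>{1..K}. if dv (ev v) k \<in> {1..<M} then w (k, cell (S, dv (ev v) k)) else 0) = 0"
    by (intro sum.neutral ballI) (simp add: dv_ev)
  then show ?thesis unfolding la_eq by simp
qed

text \<open>A zero query vector forces the answer 0, any other leaves at most q possible answers.
  The whole answer thus ranges over at most q to the number of nonzero query vectors.\<close>

lemma uent_ans_le:
  assumes n: "n \<in> {1..N}"
  shows "uent CARD('f) ({1..K} \<times> {..<L} \<rightarrow>\<^sub>E UNIV) (ans n (qry \<theta> n r))
    \<le> card {S\<in>parts n. nz (qvec \<theta> (\<tau> S n) (r S))}"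
proof -
  let ?nz = "\<lambda>S. nz (qvec \<theta> (\<tau> S n) (r S))"
  let ?C = "\<lambda>S. if ?nz S then range (\<lambda>a :: 'f. [[a]]) else {[[0]]}"
  let ?B = "enca ` (PiE (parts n) ?C)"
  have finp: "finite (parts n)" using fin\<S> by simp
  have finC: "finite (PiE (parts n) ?C)" using finp by (intro finite_PiE) auto
  have cr: "card (range (\<lambda>a :: 'f. [[a]])) = CARD('f)" by (intro card_image inj_onI) simp
  have "card (PiE (parts n) ?C) = (\<Prod>S\<in>parts n. if ?nz S then CARD('f) else 1)"
    using finp cr by (subst card_PiE) (auto intro!: prod.cong)
  also have "\<dots> = CARD('f) ^ card {S\<in>parts n. ?nz S}"
    using finp by (simp add: prod.If_cases Int_def)
  finally have cC: "card (PiE (parts n) ?C) = CARD('f) ^ card {S\<in>parts n. ?nz S}" .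
  have cB: "card ?B \<le> CARD('f) ^ card {S\<in>parts n. ?nz S}"
    using card_image_le[OF finC, of enca] cC by simp
  have "PiE (parts n) ?C \<noteq> {}" by (auto simp: PiE_eq_empty_iff)
  then have B0: "0 < card ?B" using finC by (simp add: card_gt_0_iff)
  have b: "1 < real CARD('f)" using one_less_card_field[where 'f='f] by simp
  have "uent CARD('f) ({1..K} \<times> {..<L} \<rightarrow>\<^sub>E UNIV) (ans n (qry \<theta> n r)) \<le> log CARD('f) (card ?B)"
  proof (rule uent_le_log_card[OF b])
    show "ans n (qry \<theta> n r) ` ({1..K} \<times> {..<L} \<rightarrow>\<^sub>E UNIV) \<subseteq> ?B"
    proof
      fix y assume "y \<in> ans n (qry \<theta> n r) ` ({1..K} \<times> {..<L} \<rightarrow>\<^sub>E UNIV)"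
      then obtain w where y: "y = ans n (qry \<theta> n r) w" by blast
      have "la (decq (qry \<theta> n r) S) w S \<in> ?C S" if S: "S \<in> parts n" for S
      proof -
        have d: "decq (qry \<theta> n r) S = ev (qvec \<theta> (\<tau> S n) (r S))"
          unfolding qry_def decq[OF n] using S by simp
        show ?thesis
        proof (cases "?nz S")
          case True
          then show ?thesis unfolding la_eq by simp
        next
          case False
          show ?thesis unfolding d la_zero[OF False] using False by simp
        qed
      qed
      then show "y \<in> ?B" unfolding y ans_def by (intro imageI restrict_PiE_iff[THEN iffD2]) blast
    qed
  qed (use finC B0 in \<open>auto intro!: finite_PiE\<close>)
  also have "\<dots> \<le> log CARD('f) (real CARD('f) ^ card {S\<in>parts n. ?nz S})"
  proof -
    have "real (card ?B) \<le> real (CARD('f) ^ card {S\<in>parts n. ?nz S})" using cB by (rule of_nat_mono)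
    then have le: "real (card ?B) \<le> real CARD('f) ^ card {S\<in>parts n. ?nz S}" by (simp only: of_nat_power)
    show ?thesis using log_mono[OF b _ le] B0 by linarith
  qed
  also have "\<dots> = card {S\<in>parts n. ?nz S}" using b by (simp add: log_nat_power)
  finally show ?thesis .
qed

lemma card_nz: "card {f\<in>F. nz (qvec \<theta> m' f)} \<le> card F"
  using finF by (intro card_mono) auto

text \<open>At index \<open>M\<close> the query vector sums to 0 modulo \<open>M\<close>. It
  vanishes whenever all entries of \<open>f\<close> other than \<open>f \<theta>\<close> do,
  whatever \<open>f \<theta>\<close> is, and this happens for \<open>M\<close> keys.\<close>

lemma card_nz_M:
  assumes \<theta>: "\<theta> \<in> {1..K}"
  shows "card {f\<in>F. nz (qvec \<theta> M f)} \<le> card F - M"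
proof -
  let ?Z = "PiE {1..K} (\<lambda>k. if k = \<theta> then {..<M} else {0})"
  have sub: "?Z \<subseteq> {f\<in>F. \<not> nz (qvec \<theta> M f)}"
  proof
    fix f assume f: "f \<in> ?Z"
    have z: "f k = 0" if "k \<in> {1..K} - {\<theta>}" for k
    proof -
      have "f k \<in> (if k = \<theta> then {..<M} else {0})" using f that by (blast dest: PiE_mem)
      then show ?thesis using that by simp
    qed
    have "f \<theta> < M" using PiE_mem[OF f \<theta>] by simp
    then have "f k < M" if "k \<in> {1..K}" for k using z[of k] that M2 by (cases "k = \<theta>") auto
    then have "f \<in> F" using f unfolding F_def by (auto simp: PiE_iff)
    moreover have "qvec \<theta> M f k = 0" if "k \<in> {1..K}" for k using z that by (simp add: qvec_def)
    ultimately show "f \<in> {f\<in>F. \<not> nz (qvec \<theta> M f)}" by simp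
  qed
  have "card ?Z = (\<Prod>k\<in>{1..K}. card (if k = \<theta> then {..<M} else {0}))"
    by (rule card_PiE) simp
  also have "\<dots> = (\<Prod>k\<in>{1..K}. if k = \<theta> then M else 1)"
    by (intro prod.cong refl) simp
  also have "\<dots> = M" using \<theta> by simp
  finally have cZ: "M \<le> card {f\<in>F. \<not> nz (qvec \<theta> M f)}"
    using card_mono[OF _ sub] finF by simp
  have "{f\<in>F. nz (qvec \<theta> M f)} = F - {f\<in>F. \<not> nz (qvec \<theta> M f)}" by blast
  then have "card {f\<in>F. nz (qvec \<theta> M f)} = card F - card {f\<in>F. \<not> nz (qvec \<theta> M f)}"
    using finF by (simp add: card_Diff_subset)
  then show ?thesis using cZ by simp
qed

text \<open>Exchanging sums reduces the cost to the expected number of nonzero query vectors for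
  each set, which is at most \<open>M - M / M ^ K\<close>. By \<open>geo_closed\<close> this is
  \<open>M - 1\<close> times the inverse capacity.\<close>

lemma download_le: "download N U.s 1 \<le> L * (1 + geo (K - 1) M)"
proof -
  have one: "1 \<in> {1..K}" using K1 by simp
  let ?nz = "\<lambda>S n r. nz (qvec 1 (\<tau> S n) (r S))"
  have cR: "0 < real (card R)" using finR R_ne by (simp add: card_gt_0_iff)
  have cF: "0 < real (card F)" using finF F_ne by (simp add: card_gt_0_iff)
  have "download N U.s 1 = (\<Sum>n\<in>{1..N}. (\<Sum>r\<in>R. uent CARD('f) ({1..K} \<times> {..<L} \<rightarrow>\<^sub>E UNIV) (ans n (qry 1 n r))) / card R)"
    unfolding download_def by (intro sum.cong refl U.cond_ent_answer_s)
  also have "\<dots> \<le> (\<Sum>n\<in>{1..N}. (\<Sum>r\<in>R. real (card {S\<in>parts n. ?nz S n r})) / card R)"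
    using uent_ans_le cR by (intro sum_mono divide_right_mono) auto
  also have "\<dots> = (\<Sum>n\<in>{1..N}. \<Sum>S\<in>\<S>. if n \<in> S then real (card {r\<in>R. ?nz S n r}) / card R else 0)"
  proof (intro sum.cong refl)
    fix n
    have "(\<Sum>r\<in>R. real (card {S\<in>parts n. ?nz S n r})) = (\<Sum>r\<in>R. \<Sum>S\<in>\<S>. if n \<in> S \<and> ?nz S n r then 1 else 0)"
    proof (intro sum.cong refl)
      fix r
      have "{S\<in>parts n. ?nz S n r} = {S\<in>\<S>. n \<in> S \<and> ?nz S n r}" by blast
      then show "real (card {S\<in>parts n. ?nz S n r}) = (\<Sum>S\<in>\<S>. if n \<in> S \<and> ?nz S n r then 1 else 0)"
        using fin\<S> by (simp add: sum.If_cases Int_def)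
    qed
    also have "\<dots> = (\<Sum>S\<in>\<S>. \<Sum>r\<in>R. if n \<in> S \<and> ?nz S n r then 1 else 0)" by (rule sum.swap)
    also have "\<dots> = (\<Sum>S\<in>\<S>. if n \<in> S then real (card {r\<in>R. ?nz S n r}) else 0)"
    proof (intro sum.cong refl)
      fix S
      show "(\<Sum>r\<in>R. if n \<in> S \<and> ?nz S n r then 1 else 0) = (if n \<in> S then real (card {r\<in>R. ?nz S n r}) else 0)"
        using finR by (cases "n \<in> S") (simp_all add: sum.If_cases Int_def)
    qed
    finally show "(\<Sum>r\<in>R. real (card {S\<in>parts n. ?nz S n r})) / card R
        = (\<Sum>S\<in>\<S>. if n \<in> S then real (card {r\<in>R. ?nz S n r}) / card R else 0)"
      by (simp add: sum_divide_distrib if_distrib[where f="\<lambda>x. x / _"] cong: if_cong)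
  qed
  also have "\<dots> = (\<Sum>S\<in>\<S>. \<Sum>n\<in>{1..N}. if n \<in> S then real (card {r\<in>R. ?nz S n r}) / card R else 0)"
    by (rule sum.swap)
  also have "\<dots> \<le> (\<Sum>S\<in>\<S>. real M - real M / real M ^ K)"
  proof (rule sum_mono)
    fix S assume S: "S \<in> \<S>"
    let ?h = "\<lambda>m'. real (card {f\<in>F. nz (qvec 1 m' f)}) / card F"
    have "(\<Sum>n\<in>{1..N}. if n \<in> S then real (card {r\<in>R. ?nz S n r}) / card R else 0)
        = (\<Sum>n\<in>S. real (card {r\<in>R. ?nz S n r}) / card R)"
      using sub\<S>[OF S] by (intro sum.mono_neutral_cong_right) auto
    also have "\<dots> = (\<Sum>m'\<in>{1..M}. real (card {r\<in>R. ?nz S (\<sigma> S m') r}) / card R)"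
      by (rule sum.reindex_bij_betw[OF \<sigma>[OF S], symmetric])
    also have "\<dots> = (\<Sum>m'\<in>{1..M}. ?h m')"
      using card_R_coordinate[OF S, of "\<lambda>f. nz (qvec 1 _ f)"] \<tau>_\<sigma>[OF S] by (intro sum.cong refl) simp
    also have "\<dots> = ?h M + (\<Sum>m'\<in>{1..M} - {M}. ?h m')"
      using M2 by (intro sum.remove) auto
    \<comment> \<open>The saving occurs only at index \<open>M\<close>; for the other servers the
      probability of a nonzero vector is bounded by 1.\<close>
    also have "\<dots> \<le> (1 - real M / card F) + (\<Sum>m'\<in>{1..M} - {M}. 1)"
    proof (intro add_mono sum_mono)
      have "M \<le> card F" using M2 K1 unfolding cardF by (simp add: self_le_power)
      then have "card {f\<in>F. nz (qvec 1 M f)} + M \<le> card F"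
        using card_nz_M[OF one] by linarith
      from of_nat_mono[OF this, where 'a=real]
      have "real (card {f\<in>F. nz (qvec 1 M f)}) \<le> real (card F) - real M" by simp
      then show "?h M \<le> 1 - real M / card F" using cF by (simp add: field_simps)
      show "?h m' \<le> 1" for m' using card_nz[of 1 m'] cF by (simp add: divide_le_eq)
    qed
    also have "\<dots> = real M - real M / real M ^ K" using M2 by (simp add: cardF of_nat_diff)
    finally show "(\<Sum>n\<in>{1..N}. if n \<in> S then real (card {r\<in>R. ?nz S n r}) / card R else 0) \<le> real M - real M / real M ^ K" .
  qed
  also have "\<dots> = real (card \<S>) * ((real M - 1) * (1 + geo (K - 1) M))"
    using geo_closed[of M "K - 1"] M2 K1 by simp
  also have "\<dots> = L * (1 + geo (K - 1) M)" using M2 by (simp add: L_def of_nat_diff)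
  finally show ?thesis .
qed

text \<open>Counting answers bounds the download from above only; the converse, applied to this
  scheme, gives the other inequality.\<close>

lemma rate_eq: "rate N U.s = 1 / (1 + geo (K - 1) M)"
proof -
  interpret sc: sc_scheme \<mu> N K U.s by (intro sc_scheme.intro U.scheme_s K1)
  have pos: "0 < \<mu> * real N" using \<mu> M2 by simp
  have "L * (1 + geo (K - 1) M) \<le> download N U.s 1" using sc.download_ge[OF pos] \<mu> by simp
  then have "download N U.s 1 = L * (1 + geo (K - 1) M)" using download_le by simp
  then show ?thesis using L_pos by (simp add: rate_def)
qed

section \<open>Law and independence of the keys for different sets\<close>

lemma pr_key:
  assumes S: "S \<in> \<S>"
  shows "pr (sample U.s) (\<lambda>\<omega>. G (snd (dec \<omega>) S)) v = card {f\<in>F. G f = v} / card F"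
proof -
  have "pr (sample U.s) (\<lambda>\<omega>. G (snd (dec \<omega>) S)) v
      = real (card U.\<Omega>' * card {r\<in>R. G (r S) = v}) / real m"
    unfolding U.pr_s using U.card_dec_snd[of "\<lambda>r. G (r S) = v"] by simp
  also have "\<dots> = real (card {r\<in>R. G (r S) = v}) / card R"
    using U.c\<Omega>' by (simp add: U.m_eq)
  finally show ?thesis using card_R_coordinate[OF S, of "\<lambda>f. G f = v"] by simp
qed

lemma indep_keys: "prob_space.indep_vars (sample U.s) (\<lambda>_. count_space UNIV) (\<lambda>S \<omega>. snd (dec \<omega>) S) \<S>"
  unfolding U.sel(1)
proof (rule indep_vars_uniform_fibers[where c="card U.\<Omega>'"])
  show "(\<lambda>S\<in>\<S>. snd (dec \<omega>) S) \<in> PiE \<S> (\<lambda>_. F)" if "\<omega> \<in> {..<m}" for \<omega>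
    using U.dec_in(2)[of \<omega>] that R_F by auto
  fix g assume g: "g \<in> PiE \<S> (\<lambda>_. F)"
  have "(\<lambda>S\<in>\<S>. snd (dec \<omega>) S) = snd (dec \<omega>)" if "\<omega> \<in> {..<m}" for \<omega>
    using U.dec_in(2)[of \<omega>] that unfolding R_def by (intro PiE_restrict) auto
  then have "{\<omega>\<in>{..<m}. (\<lambda>S\<in>\<S>. snd (dec \<omega>) S) = g} = {\<omega>\<in>{..<m}. snd (dec \<omega>) = g}"
    by (intro Collect_cong) auto
  then show "card {\<omega>\<in>{..<m}. (\<lambda>S\<in>\<S>. snd (dec \<omega>) S) = g} = card U.\<Omega>'"
    using U.card_dec_snd[of "\<lambda>r. r = g"] fiber_R g unfolding R_def by simp
qed (use U.m_pos fin\<S> ne\<S> finF in auto)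

end

section \<open>Cyclic families of server sets\<close>

lemma inj_add_mod:
  fixes n c :: nat
  shows "inj_on (\<lambda>y. (y + c) mod n) {..<n}"
proof (rule inj_onI)
  fix x y assume "x \<in> {..<n}" "y \<in> {..<n}" and eq: "(x + c) mod n = (y + c) mod n"
  then have lt: "x < n" "y < n" by auto
  from eq obtain q1 q2 where "x + c + n * q1 = y + c + n * q2" unfolding nat_mod_eq_iff by blast
  then have "x mod n = y mod n" unfolding nat_mod_eq_iff by (intro exI[of _ q1] exI[of _ q2]) simp
  then show "x = y" using lt by simp
qed

lemma inj_diff_mod:
  fixes n x :: nat
  shows "inj_on (\<lambda>j. (x + (n - j)) mod n) {..<n}"
proof (rule inj_onI)
  fix j j' assume "j \<in> {..<n}" "j' \<in> {..<n}" and eq: "(x + (n - j)) mod n = (x + (n - j')) mod n"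
  then have lt: "j < n" "j' < n" by auto
  from eq obtain q1 q2 where "x + (n - j) + n * q1 = x + (n - j') + n * q2" unfolding nat_mod_eq_iff by blast
  then have "j' + n * q1 = j + n * q2" using lt by simp
  then have "j' mod n = j mod n" unfolding nat_mod_eq_iff by blast
  then show "j = j'" using lt by simp
qed

lemma card_less_inj:
  fixes h :: "nat \<Rightarrow> nat"
  assumes "inj_on h {..<n}" "\<And>y. y < n \<Longrightarrow> h y < n" "m \<le> n"
  shows "card {y\<in>{..<n}. h y < m} = m"
proof -
  have "bij_betw h {..<n} {..<n}"
    unfolding bij_betw_def using assms(1,2) by (intro conjI endo_inj_surj) auto
  then have "card {y\<in>{..<n}. h y < m} = card {z\<in>{..<n}. z < m}" by (rule card_fiber_bij)
  also have "{z\<in>{..<n}. z < m} = {..<m}" using assms(3) by auto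
  finally show ?thesis by simp
qed

text \<open>Quotient and shifted residue identify the numbers below \<open>g * n\<close> with a
  grid, in which the condition selects \<open>m\<close> of the \<open>n\<close> columns.\<close>

lemma card_residue_window:
  fixes n m g c :: nat
  assumes "0 < n" "m \<le> n"
  shows "card {x\<in>{..<g * n}. (x + c) mod n < m} = g * m"
proof -
  let ?h = "\<lambda>x. (x div n, (x + c) mod n)"
  have inj: "inj_on ?h {..<g * n}"
  proof (rule inj_onI)
    fix x y assume eq: "?h x = ?h y"
    then have d: "x div n = y div n" and e: "(x + c) mod n = (y + c) mod n" by simp_all
    have "(x mod n + c) mod n = (y mod n + c) mod n" using e by (simp add: mod_add_left_eq)
    then have "x mod n = y mod n" using inj_onD[OF inj_add_mod[of c n], of "x mod n" "y mod n"] assms(1) by simp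
    then show "x = y" using d by (metis div_mult_mod_eq)
  qed
  have sub: "?h ` {..<g * n} \<subseteq> {..<g} \<times> {..<n}"
    using assms(1) by (auto simp: less_mult_imp_div_less)
  have "card (?h ` {..<g * n}) = card ({..<g} \<times> {..<n})" using card_image[OF inj] by simp
  then have "?h ` {..<g * n} = {..<g} \<times> {..<n}" using sub by (intro card_subset_eq) auto
  then have "bij_betw ?h {..<g * n} ({..<g} \<times> {..<n})" using inj by (simp add: bij_betw_def)
  then have "card {x\<in>{..<g * n}. snd (?h x) < m} = card {z\<in>{..<g} \<times> {..<n}. snd z < m}" by (rule card_fiber_bij)
  also have "{z\<in>{..<g} \<times> {..<n}. snd z < m} = {..<g} \<times> {..<m}" using assms(2) by auto
  finally show ?thesis by simp
qed

text \<open>Servers are grouped by residue modulo \<open>n\<close>, which is N divided by the gcd,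
  with gcd many servers in each class. A window of \<open>m\<close> residues then has M servers, and
  only \<open>n\<close> windows are needed to treat all classes alike; each server lies in
  \<open>m\<close> of them.\<close>

lemma regular_family_exists:
  fixes N M :: nat
  assumes M: "1 \<le> M" "M \<le> N"
  obtains \<S> where "card \<S> = N div gcd N M" "\<S> \<noteq> {}" "\<And>S. S \<in> \<S> \<Longrightarrow> S \<subseteq> {1..N} \<and> card S = M"
    "\<And>n. n \<in> {1..N} \<Longrightarrow> N * card {S\<in>\<S>. n \<in> S} = M * card \<S>"
proof -
  let ?g = "gcd N M"
  have g: "0 < ?g" using M by simp
  obtain n m where nm: "N = n * ?g" "M = m * ?g" "coprime n m"
    using gcd_coprime_exists[of N M] g by auto
  have n0: "0 < n" and m0: "0 < m" using nm M by (auto intro: gr0I)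
  have mn: "m \<le> n" using nm(1,2) M(2) g by (metis mult_le_cancel2)
  \<comment> \<open>cyclic windows of \<open>m\<close> consecutive residues modulo \<open>n\<close>\<close>
  define S where "S j = {a\<in>{1..N}. (a - 1 + (n - j)) mod n < m}" for j
  have mem: "a \<in> S j \<longleftrightarrow> (a - 1 + (n - j)) mod n < m" if "a \<in> {1..N}" for a j
    using that by (simp add: S_def)
  have nN: "n \<le> N" using nm(1) g by (metis mult.commute mult_le_mono1 nat_mult_1 Suc_leI One_nat_def)
  have cS: "card (S j) = M" for j
  proof -
    have "card {x\<in>{..<N}. (x + (n - j)) mod n < m} = card (S j)"
    proof (rule bij_betw_same_card[of Suc])
      show "bij_betw Suc {x\<in>{..<N}. (x + (n - j)) mod n < m} (S j)"
        by (rule bij_betwI[where g="\<lambda>a. a - 1"]) (auto simp: S_def)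
    qed
    moreover have "card {x\<in>{..<?g * n}. (x + (n - j)) mod n < m} = ?g * m"
      by (rule card_residue_window[OF n0 mn])
    ultimately show ?thesis using nm by (metis mult.commute)
  qed
  have ne: "S i \<noteq> S j" if ij: "i < j" "j < n" for i j
  proof
    \<comment> \<open>\<open>j\<close> is the residue just before the window \<open>S j\<close>, so the windows would have to start at the same place.\<close>
    assume eq: "S i = S j"
    \<comment> \<open>Windows comprising all residues would give \<open>m = n\<close>, and
      coprimality would leave only \<open>n = 1\<close>, hence no two different indices.\<close>
    have "m < n"
    proof (rule ccontr)
      assume "\<not> m < n"
      then have "n = 1" using mn nm(3) by simp
      then show False using ij by simp
    qed
    have j1: "j \<in> {1..N}" "Suc j \<in> {1..N}" using ij nN by auto
    have "(j - 1 + (n - j)) mod n = n - 1" using ij by simp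
    then have "j \<notin> S j" using mem[OF j1(1)] \<open>m < n\<close> by simp
    moreover have "Suc j \<in> S j" using mem[OF j1(2)] m0 ij by simp
    then have "Suc j \<in> S i" using eq by simp
    then have "(j + (n - i)) mod n < m" using mem[OF j1(2)] by simp
    moreover have "(j + (n - i)) mod n = j - i"
    proof -
      have "j + (n - i) = (j - i) + n" using ij by simp
      then show ?thesis using ij by (simp only: mod_add_self2) simp
    qed
    moreover have "(j - 1 + (n - i)) mod n = j - i - 1"
    proof -
      have "j - 1 + (n - i) = (j - i - 1) + n" using ij by simp
      then show ?thesis using ij by (simp only: mod_add_self2) simp
    qed
    ultimately have "j \<in> S i" "j \<notin> S j" using mem[OF j1(1)] by auto
    then show False using eq by simp
  qed
  then have inj: "inj_on S {..<n}" by (intro linorder_inj_onI) auto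
  have c\<S>: "card (S ` {..<n}) = n" using card_image[OF inj] by simp
  have cover: "card {B\<in>S ` {..<n}. a \<in> B} = m" if a: "a \<in> {1..N}" for a
  proof -
    have "{B\<in>S ` {..<n}. a \<in> B} = S ` {j\<in>{..<n}. (a - 1 + (n - j)) mod n < m}"
      using mem[OF a] by auto
    moreover have "card \<dots> = card {j\<in>{..<n}. (a - 1 + (n - j)) mod n < m}"
      by (intro card_image inj_on_subset[OF inj]) auto
    moreover have "\<dots> = m" by (rule card_less_inj[OF inj_diff_mod _ mn]) (use n0 in simp)
    ultimately show ?thesis by simp
  qed
  show thesis
  proof (rule that[of "S ` {..<n}"])
    show "card (S ` {..<n}) = N div ?g" using c\<S> nm(1) g by (metis less_numeral_extra(3) nonzero_mult_div_cancel_right)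
    show "S ` {..<n} \<noteq> {}" using n0 by auto
    show "B \<subseteq> {1..N} \<and> card B = M" if mB: "B \<in> S ` {..<n}" for B
    proof -
      obtain j where B: "B = S j" using mB by blast
      show ?thesis unfolding B using cS[of j] by (auto simp only: S_def)
    qed
    show "N * card {B\<in>S ` {..<n}. a \<in> B} = M * card (S ` {..<n})" if "a \<in> {1..N}" for a
      unfolding cover[OF that] c\<S> using nm(1,2) by (metis mult.assoc mult.commute)
  qed
qed

section \<open>The capacity\<close>

lemma filter_eq_upt: "c < n \<Longrightarrow> filter (\<lambda>t. t = c) [0..<n] = [c]"
  by (induction n) (auto simp: less_Suc_eq filter_empty_conv)

context tsc
begin

lemma packet_eq:
  assumes "S \<in> \<S>" "i \<in> {1..<M}"
  shows "packet U.s k (lab (S, i)) \<omega> = [fst (dec \<omega>) (k, cell (S, i))]"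
proof -
  have mem: "(S, i) \<in> \<S> \<times> {1..<M}" using assms by simp
  then have "cell (S, i) < L" using bij_betwE[OF cell] unfolding L_def by blast
  then have "filter (\<lambda>t. t \<in> {cell (S, i)}) [0..<L] = [cell (S, i)]"
    by (simp add: filter_eq_upt)
  then show ?thesis
    using posn_lab[OF mem] unfolding packet_def U.sel nths_map_upt by simp
qed

lemma lin_answer_la:
  assumes "S \<in> \<S>"
  shows "lin_answer K (\<lambda>_ _. 1) \<beta> {1..<M} (\<lambda>k i. packet U.s k (lab (S, i)) \<omega>) n x = la x (fst (dec \<omega>)) S"
proof -
  have "lin_comb ({1..K} \<times> {1..<M}) (\<lambda>(k, i). \<beta> n x k i j) (\<lambda>(k, i). packet U.s k (lab (S, i)) \<omega>)
      = lin_comb ({1..K} \<times> {1..<M}) (\<lambda>(k, i). \<beta> 0 x k i j) (\<lambda>(k, i). [fst (dec \<omega>) (k, cell (S, i))])" for j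
  proof -
    have \<beta>: "(\<lambda>(k, i). \<beta> n x k i j) = (\<lambda>(k, i). \<beta> 0 x k i j)" by (simp add: \<beta>_def fun_eq_iff)
    show ?thesis unfolding \<beta> using packet_eq[OF assms] by (intro lin_comb_cong) auto
  qed
  then show ?thesis unfolding la_def lin_answer_def by simp
qed

lemma decoded_query:
  assumes "S \<in> \<S>" "m' \<in> {1..M}"
  shows "decq (query U.s \<theta> (\<sigma> S m') \<omega>) S = ev (qvec \<theta> m' (snd (dec \<omega>) S))"
  unfolding U.sel qry_def decq[OF \<sigma>_server[OF assms]] using assms \<sigma>_in[OF assms] \<tau>_\<sigma>[OF assms] by simp

lemma decoded_answer:
  assumes "S \<in> \<S>" "m' \<in> {1..M}"
  shows "deca (answer U.s \<theta> (\<sigma> S m') \<omega>) S = la (decq (query U.s \<theta> (\<sigma> S m') \<omega>) S) (fst (dec \<omega>)) S"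
  unfolding U.sel ans_def deca[OF \<sigma>_server[OF assms]] using assms \<sigma>_in[OF assms] by simp

lemma pr_query_vector:
  assumes "S \<in> \<S>"
  shows "pr (sample U.s) (\<lambda>\<omega>. \<lambda>m'\<in>{1..M}. decq (query U.s \<theta> (\<sigma> S m') \<omega>) S) v
    = card {f \<in> {1..K} \<rightarrow>\<^sub>E {..<M}. (\<lambda>m'\<in>{1..M}. ev (qvec \<theta> m' f)) = v} / card ({1..K} \<rightarrow>\<^sub>E {..<M})"
proof -
  have "(\<lambda>\<omega>. \<lambda>m'\<in>{1..M}. decq (query U.s \<theta> (\<sigma> S m') \<omega>) S) = (\<lambda>\<omega>. (\<lambda>f. \<lambda>m'\<in>{1..M}. ev (qvec \<theta> m' f)) (snd (dec \<omega>) S))"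
    unfolding restrict_eq_iff fun_eq_iff using decoded_query[OF assms] by (auto simp del: U.sel)
  then show ?thesis
    using pr_key[OF assms, of "\<lambda>f. \<lambda>m'\<in>{1..M}. ev (qvec \<theta> m' f)" v] unfolding F_def by (simp only:)
qed

lemma indep_query_vectors:
  "prob_space.indep_vars (sample U.s) (\<lambda>_. count_space UNIV)
    (\<lambda>S \<omega>. \<lambda>m'\<in>{1..M}. decq (query U.s \<theta> (\<sigma> S m') \<omega>) S) \<S>"
proof -
  have "U.indep_vars (\<lambda>_. count_space UNIV) (\<lambda>S \<omega>. (\<lambda>f. \<lambda>m'\<in>{1..M}. ev (qvec \<theta> m' f)) (snd (dec \<omega>) S)) \<S>"
    by (rule U.indep_vars_compose2[OF indep_keys]) simp
  moreover have "(\<lambda>\<omega>. \<lambda>m'\<in>{1..M}. decq (query U.s \<theta> (\<sigma> S m') \<omega>) S) = (\<lambda>\<omega>. (\<lambda>f. \<lambda>m'\<in>{1..M}. ev (qvec \<theta> m' f)) (snd (dec \<omega>) S))"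
    if "S \<in> \<S>" for S
    unfolding restrict_eq_iff fun_eq_iff using decoded_query[OF that] by (auto simp del: U.sel)
  ultimately show ?thesis by (subst U.indep_vars_cong[OF refl _ refl]) auto
qed

end

text \<open>The supremum is a maximum: the converse bounds every scheme by the rate that
  \<open>s\<close> attains.\<close>

lemma capacity_eqI_scheme:
  fixes s :: "(nat, 'f::{field,finite}, nat, nat, nat) pir"
  assumes "1 \<le> K" "0 < \<mu> * real N" "\<mu> * real N = real M"
    and s: "sc_pir_scheme \<mu> N K s" "rate N s = 1 / (1 + geo (K - 1) M)"
  shows "capacity TYPE('f) \<mu> N K = 1 / (1 + geo (K - 1) M)"
  unfolding capacity_def
proof (rule cSup_eq_maximum)
  show "1 / (1 + geo (K - 1) M) \<in> {rate N s | s :: (nat, 'f, nat, nat, nat) pir. sc_pir_scheme \<mu> N K s}"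
    using s by force
  fix x assume "x \<in> {rate N s | s :: (nat, 'f, nat, nat, nat) pir. sc_pir_scheme \<mu> N K s}"
  then obtain s' :: "(nat, 'f, nat, nat, nat) pir" where x: "x = rate N s'" "sc_pir_scheme \<mu> N K s'" by blast
  interpret sc_scheme \<mu> N K s' using x(2) assms(1) by (intro sc_scheme.intro)
  show "x \<le> 1 / (1 + geo (K - 1) M)" using rate_le[OF assms(2)] x(1) assms(3) by simp
qed

lemma tsc_parameters:
  fixes \<S> :: "nat set set"
  assumes fin: "finite \<S>" and card: "\<And>S. S \<in> \<S> \<Longrightarrow> finite S \<and> card S = M"
  obtains \<sigma> cell where "\<And>S. S \<in> \<S> \<Longrightarrow> bij_betw (\<sigma> S) {1..M} S"
    "bij_betw cell (\<S> \<times> {1..<M}) {..<card \<S> * (M - 1)}"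
proof -
  have "\<exists>h. bij_betw h {1..M} S" if "S \<in> \<S>" for S
    using card[OF that] by (intro finite_same_card_bij) auto
  then obtain \<sigma> where "\<forall>S\<in>\<S>. bij_betw (\<sigma> S) {1..M} S" by metis
  moreover have "card (\<S> \<times> {1..<M}) = card {..<card \<S> * (M - 1)}"
    by (simp only: card_cartesian_product card_atLeastLessThan card_lessThan)
  then obtain cell where "bij_betw cell (\<S> \<times> {1..<M}) {..<card \<S> * (M - 1)}"
    using finite_same_card_bij[of "\<S> \<times> {1..<M}" "{..<card \<S> * (M - 1)}"] fin by auto
  ultimately show thesis using that by blast
qed

text \<open>The union over \<open>T\<close> of the extensional function spaces is countable, so one
  pair of maps serves all servers. It recodes families of queries or answers as the natural numbers
  required in \<open>capacity\<close>.\<close>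

lemma countable_encoding:
  fixes A :: "'n \<Rightarrow> 's set"
  assumes "finite T" "\<And>n. n \<in> T \<Longrightarrow> finite (A n)"
  shows "\<exists>(enc :: ('s \<Rightarrow> 'b::countable) \<Rightarrow> nat) dec. \<forall>n\<in>T. \<forall>v. dec (enc (restrict v (A n))) = restrict v (A n)"
proof -
  let ?B = "\<Union>n\<in>T. PiE (A n) (\<lambda>_. UNIV :: 'b set)"
  have c: "countable ?B" using assms by (intro countable_UN countable_PiE countableI_type) (auto intro: countable_finite)
  show ?thesis
  proof (intro exI ballI allI)
    fix n and v :: "'s \<Rightarrow> 'b" assume "n \<in> T"
    moreover have "restrict v (A n) \<in> PiE (A n) (\<lambda>_. UNIV)" by auto
    ultimately have "restrict v (A n) \<in> ?B" by blast
    then show "from_nat_into ?B (to_nat_on ?B (restrict v (A n))) = restrict v (A n)"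
      by (rule from_nat_into_to_nat_on[OF c])
  qed
qed

text \<open>The code on the cyclic family, with all alphabets recoded, attains the bound. The case
  \<open>\<mu> = 1\<close> and \<open>N = M\<close> is the capacity of the full storage
  system.\<close>

lemma capacity_eq:
  assumes K: "1 \<le> K" and M: "2 \<le> M" "M \<le> N" and \<mu>: "\<mu> * real N = real M"
  shows "capacity TYPE('f::{field,finite}) \<mu> N K = 1 / (1 + geo (K - 1) M)"
proof -
  obtain \<S> where \<S>: "\<S> \<noteq> {}" "\<And>S. S \<in> \<S> \<Longrightarrow> S \<subseteq> {1..N} \<and> card S = M"
    "\<And>n. n \<in> {1..N} \<Longrightarrow> N * card {S\<in>\<S>. n \<in> S} = M * card \<S>"
    using regular_family_exists[of M N] M by (metis one_le_numeral order_trans)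
  have fin: "finite \<S>" by (rule finite_subset[of _ "Pow {1..N}"]) (use \<S>(2) in auto)
  have finS: "finite S \<and> card S = M" if "S \<in> \<S>" for S using \<S>(2)[OF that] finite_subset by blast
  obtain \<sigma> cell where \<sigma>: "\<And>S. S \<in> \<S> \<Longrightarrow> bij_betw (\<sigma> S) {1..M} S"
    and cell: "bij_betw cell (\<S> \<times> {1..<M}) {..<card \<S> * (M - 1)}"
    using tsc_parameters[OF fin finS] by blast
  have fparts: "finite {S\<in>\<S>. n \<in> S}" for n :: nat using fin by simp
  from countable_encoding[where T="{1..N}" and A="\<lambda>n. {S\<in>\<S>. n \<in> S}", OF finite_atLeastAtMost fparts]
  obtain encq :: "(nat set \<Rightarrow> nat) \<Rightarrow> nat" and decq where
    q: "\<forall>n\<in>{1..N}. \<forall>v. decq (encq (restrict v {S\<in>\<S>. n \<in> S})) = restrict v {S\<in>\<S>. n \<in> S}"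
    by (elim exE)
  from countable_encoding[where T="{1..N}" and A="\<lambda>n. {S\<in>\<S>. n \<in> S}", OF finite_atLeastAtMost fparts]
  obtain enca :: "(nat set \<Rightarrow> 'f list list) \<Rightarrow> nat" and deca where
    a: "\<forall>n\<in>{1..N}. \<forall>v. deca (enca (restrict v {S\<in>\<S>. n \<in> S})) = restrict v {S\<in>\<S>. n \<in> S}"
    by (elim exE)
  have lab: "inj_on (to_nat_on (\<S> \<times> {1..<M})) (\<S> \<times> {1..<M})"
    using fin by (intro inj_on_to_nat_on countable_finite) auto
  interpret T: tsc \<mu> N K M \<S> \<sigma> cell "to_nat_on (\<S> \<times> {1..<M})" encq decq enca deca
    by (rule tsc.intro[OF K M(1) \<mu> \<S>(1) conjunct1[OF \<S>(2)] \<sigma> \<S>(3) cell lab q[rule_format] a[rule_format]])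
  have "0 < \<mu> * real N" using \<mu> M by simp
  then show ?thesis by (rule capacity_eqI_scheme[OF K _ \<mu> T.U.scheme_s T.rate_eq])
qed

section \<open>The optimal sub-packetization\<close>

text \<open>One code is instantiated twice: \<open>T\<close> on the cyclic family gives the scheme
  itself, \<open>T1\<close> on a single set gives the full storage scheme it is built from. All
  clauses relating the two then compare copies of the same construction.\<close>

lemma sub_packetization_attained:
  assumes K: "2 \<le> K" and M: "2 \<le> M" "M \<le> N" and \<mu>: "\<mu> * real N = real M"
  shows "N * (M - 1) div gcd N M \<in> equal_size_sub_packetizations TYPE('f::{field,finite}) \<mu> N K M"
proof -
  have K1: "1 \<le> K" and M1: "1 \<le> M" using K M by simp_all
  obtain \<S> where \<S>: "card \<S> = N div gcd N M" "\<S> \<noteq> {}" "\<And>S. S \<in> \<S> \<Longrightarrow> S \<subseteq> {1..N} \<and> card S = M"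
    "\<And>n. n \<in> {1..N} \<Longrightarrow> N * card {S\<in>\<S>. n \<in> S} = M * card \<S>"
    by (rule regular_family_exists[OF M1 M(2) that])
  have fin: "finite \<S>" by (rule finite_subset[of _ "Pow {1..N}"]) (use \<S>(3) in auto)
  have finS: "finite S \<and> card S = M" if "S \<in> \<S>" for S using \<S>(3)[OF that] finite_subset by blast
  obtain \<sigma> cell where \<sigma>: "\<And>S. S \<in> \<S> \<Longrightarrow> bij_betw (\<sigma> S) {1..M} S"
    and cell: "bij_betw cell (\<S> \<times> {1..<M}) {..<card \<S> * (M - 1)}"
    using tsc_parameters[OF fin finS] by blast
  define A1 where "A1 = {1..M}"
  obtain \<sigma>' cell' where cell': "bij_betw cell' ({A1} \<times> {1..<M}) {..<card {A1} * (M - 1)}"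
    using tsc_parameters[of "{A1}" M] by (auto simp: A1_def)
  interpret T: tsc \<mu> N K M \<S> \<sigma> cell "\<lambda>z. z" "\<lambda>x. x" "\<lambda>x. x" "\<lambda>a :: nat set \<Rightarrow> 'f list list. a" "\<lambda>a. a"
    by (rule tsc.intro[OF K1 M(1) \<mu> \<S>(2) conjunct1[OF \<S>(3)] \<sigma> \<S>(4) cell]) simp_all
  have A: "{S \<in> {A1}. n \<in> S} = {A1}" if "n \<in> {1..M}" for n using that by (auto simp: A1_def)
  \<comment> \<open>For the one-element family, \<open>snd\<close> drops the set from a packet
    label, and a family of queries or answers is replaced by its only member, at
    \<open>A1\<close>.\<close>
  interpret T1: tsc 1 M K M "{A1}" "\<lambda>_ m. m" cell' snd "\<lambda>x. x A1" "\<lambda>y. \<lambda>S\<in>{A1}. y"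
    "\<lambda>a :: nat set \<Rightarrow> 'f list list. a A1" "\<lambda>b. \<lambda>S\<in>{A1}. b"
  proof (rule tsc.intro[OF K1 M(1) _ _ _ _ _ cell'])
    show "M * card {S \<in> {A1}. n \<in> S} = M * card {A1}" if "n \<in> {1..M}" for n using A[OF that] by simp
    show "inj_on snd ({A1} \<times> {1..<M})" by (auto simp: inj_on_def)
    show "(\<lambda>S\<in>{A1}. restrict v {S \<in> {A1}. n \<in> S} A1) = restrict v {S \<in> {A1}. n \<in> S}"
      if "n \<in> {1..M}" for n and v :: "nat set \<Rightarrow> nat" unfolding A[OF that] by auto
    show "(\<lambda>S\<in>{A1}. restrict v {S \<in> {A1}. n \<in> S} A1) = restrict v {S \<in> {A1}. n \<in> S}"
      if "n \<in> {1..M}" for n and v :: "nat set \<Rightarrow> 'f list list" unfolding A[OF that] by auto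
    show "bij_betw (\<lambda>m. m) {1..M} S" if "S \<in> {A1}" for S
      using that bij_betw_id[of A1] by (simp add: id_def A1_def)
  qed (auto simp: A1_def)
  let ?s = T.U.s and ?sf = T1.U.s
  \<comment> \<open>Uniform weights on the family: each part then has \<open>M - 1\<close> symbols,
    exactly the file length of the full storage scheme.\<close>
  define \<alpha> where "\<alpha> S = (if S \<in> \<S> then 1 / real (card \<S>) else 0)" for S
  have act: "active N M \<alpha> = \<S>"
    using \<S>(3) T.card\<S> by (auto simp: active_def \<alpha>_def)
  have capN: "capacity TYPE('f) \<mu> N K = 1 / (1 + geo (K - 1) M)" by (rule capacity_eq[OF K1 M \<mu>])
  have cap1: "capacity TYPE('f) 1 M K = 1 / (1 + geo (K - 1) M)" by (rule capacity_eq[OF K1 M(1)]) auto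
  have P1: "T1.P = {1..<M}" unfolding T1.P_def by force
  have P: "T.P = \<S> \<times> {1..<M}" by (simp add: T.P_def)
  have st: "T.st n = {S\<in>\<S>. n \<in> S} \<times> {1..<M}" for n by (simp add: T.st_def)
  have st1: "T1.st n = {1..<M}" if "n \<in> {1..M}" for n
    unfolding T1.st_def A[OF that] by force
  have pos: "T.posn k (S, i) = {cell (S, i)}" if "S \<in> \<S>" "i \<in> {1..<M}" for k S i
    using T.posn_lab[of "(S, i)" k] that by simp
  have pos1: "T1.posn k i = {cell' (A1, i)}" if "i \<in> {1..<M}" for k i
    using T1.posn_lab[of "(A1, i)" k] that by simp
  have L1: "T1.L = M - 1" by (simp add: T1.L_def)
  have packets1: "packets ?sf = {1..<M}" by (rule trans[OF T1.U.sel(4) P1])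
  have packets: "packets ?s = \<S> \<times> {1..<M}" by (rule trans[OF T.U.sel(4) P])
  have weights: "valid_weights \<mu> N M \<alpha>"
    unfolding valid_weights_def
  proof (intro conjI allI impI ballI)
    have "1 \<le> card \<S>" using T.card\<S> by simp
    then show "0 \<le> \<alpha> S" "\<alpha> S \<le> 1" for S by (auto simp: \<alpha>_def divide_le_eq)
    fix n assume n: "n \<in> {1..N}"
    have "(\<Sum>S | S \<subseteq> {1..N} \<and> card S = M \<and> n \<in> S. \<alpha> S) = (\<Sum>S\<in>{S\<in>\<S>. n \<in> S}. 1 / card \<S>)"
    proof (rule sum.mono_neutral_cong_right)
      show "finite {S. S \<subseteq> {1..N} \<and> card S = M \<and> n \<in> S}"
        by (rule finite_subset[of _ "Pow {1..N}"]) auto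
      show "{S\<in>\<S>. n \<in> S} \<subseteq> {S. S \<subseteq> {1..N} \<and> card S = M \<and> n \<in> S}" using \<S>(3) by blast
    qed (auto simp: \<alpha>_def)
    also have "\<dots> = real (card {S\<in>\<S>. n \<in> S}) / card \<S>" by simp
    also have "\<dots> = \<mu>"
    proof -
      have "real N * real (card {S\<in>\<S>. n \<in> S}) = real N * (\<mu> * card \<S>)"
        using \<S>(4)[OF n] \<mu> by (metis mult.assoc mult.commute of_nat_mult)
      then show ?thesis using T.N_pos T.card\<S> by (simp add: divide_eq_eq)
    qed
    finally show "(\<Sum>S | S \<subseteq> {1..N} \<and> card S = M \<and> n \<in> S. \<alpha> S) = \<mu>" .
  qed
  have sf: "sf_pir_scheme M K ?sf"
    unfolding sf_pir_scheme_def packets1 T1.U.sel(6) using T1.U.scheme_s st1 by blast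
  have achieving1: "capacity_achieving 1 M K ?sf"
    unfolding capacity_achieving_def cap1 by (rule T1.rate_eq)
  have sizes: "real (card (\<Union>i\<in>packets ?sf. packet_pos ?s k (S, i))) = \<alpha> S * real (file_len ?s) \<and>
      (\<forall>i\<in>packets ?sf. real (card (packet_pos ?s k (S, i))) / (\<alpha> S * real (file_len ?s)) =
         real (card (packet_pos ?sf k i)) / real (file_len ?sf))" if S: "S \<in> \<S>" for k S
  proof -
    have len: "\<alpha> S * real T.L = real (M - 1)" using S T.card\<S> by (simp add: \<alpha>_def T.L_def)
    have "(\<Union>i\<in>{1..<M}. T.posn k (S, i)) = cell ` ({S} \<times> {1..<M})" using pos[OF S] by auto
    moreover have "card (cell ` ({S} \<times> {1..<M})) = card ({S} \<times> {1..<M})"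
      using S bij_betw_imp_inj_on[OF cell] by (intro card_image) (auto intro: inj_on_subset)
    ultimately have "card (\<Union>i\<in>{1..<M}. T.posn k (S, i)) = M - 1"
      by (simp only: card_cartesian_product) simp
    then show ?thesis unfolding packets1 T.U.sel T1.U.sel unfolding L1 using len pos[OF S] pos1 by simp
  qed
  have query1: "query ?sf \<theta> n \<omega> = T1.ev (T1.qvec \<theta> n (snd (T1.dec \<omega>) A1))" if "n \<in> {1..M}" for \<theta> n \<omega>
    using T1.decoded_query[of A1 n \<theta> \<omega>] that by (simp del: T1.U.sel)
  have lin: "linear_with M K (\<lambda>_ _. 1) T1.\<beta> ?sf"
    unfolding linear_with_def
  proof (intro ballI)
    fix \<theta> n \<omega> assume n: "n \<in> {1..M}"
    have "answer ?sf \<theta> n \<omega> = T1.la (query ?sf \<theta> n \<omega>) (fst (T1.dec \<omega>)) A1"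
      using T1.decoded_answer[of A1 n \<theta> \<omega>] n by (simp del: T1.U.sel)
    also have "\<dots> = lin_answer K (\<lambda>_ _. 1) T1.\<beta> {1..<M} (\<lambda>k i. packet ?sf k (snd (A1, i)) \<omega>) n (query ?sf \<theta> n \<omega>)"
      by (rule T1.lin_answer_la[symmetric]) simp
    finally show "answer ?sf \<theta> n \<omega> = lin_answer K (\<lambda>_ _. 1) T1.\<beta> (stored ?sf n) (\<lambda>k i. packet ?sf k i \<omega>) n (query ?sf \<theta> n \<omega>)"
      using st1[OF n] by (simp only: T1.U.sel(6) snd_conv)
  qed
  \<comment> \<open>Both query vectors are the image of a uniform \<open>f\<close> under the same
    map, so the two laws are given by the same quotient of cardinalities.\<close>
  have distr: "distr (sample ?s) (count_space UNIV) (\<lambda>\<omega>. \<lambda>m\<in>{1..M}. query ?s \<theta> (\<sigma> S m) \<omega> S) =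
      distr (sample ?sf) (count_space UNIV) (all_queries M ?sf \<theta>)" if S: "S \<in> \<S>" for \<theta> S
  proof (rule distr_eq_pr[OF T.U.prob_s T.U.simple_s T1.U.prob_s T1.U.simple_s], rule ext)
    fix v
    have "all_queries M ?sf \<theta> = (\<lambda>\<omega>. \<lambda>m\<in>{1..M}. (\<lambda>S\<in>{A1}. query ?sf \<theta> m \<omega>) A1)"
      by (simp add: all_queries_def fun_eq_iff)
    then show "pr (sample ?s) (\<lambda>\<omega>. \<lambda>m\<in>{1..M}. query ?s \<theta> (\<sigma> S m) \<omega> S) v = pr (sample ?sf) (all_queries M ?sf \<theta>) v"
      using T.pr_query_vector[OF S, of \<theta> v] T1.pr_query_vector[of A1 \<theta> v] by (simp del: T.U.sel T1.U.sel)
  qed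
  have ans: "answer ?s \<theta> (\<sigma> S m) \<omega> S = lin_answer K (\<lambda>_ _. 1) T1.\<beta> (packets ?sf) (\<lambda>k i. packet ?s k (S, i) \<omega>) m
      (query ?s \<theta> (\<sigma> S m) \<omega> S)" if "S \<in> \<S>" "m \<in> {1..M}" for \<theta> S m \<omega>
    using T.decoded_answer[OF that, of \<theta> \<omega>] T.lin_answer_la[OF that(1), of \<omega> m "query ?s \<theta> (\<sigma> S m) \<omega> S"]
    unfolding packets1 by (simp only:)
  have ext: "query ?s \<theta> n \<omega> \<in> extensional {S\<in>\<S>. n \<in> S}" "answer ?s \<theta> n \<omega> \<in> extensional {S\<in>\<S>. n \<in> S}" for \<theta> n \<omega>
    by (simp_all add: T.qry_def T.ans_def)
  have linear: "linear_sf_sc_pir_scheme \<mu> N K M \<alpha> ?sf ?s"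
    unfolding linear_sf_sc_pir_scheme_def act
  proof (intro conjI)
    show "packets ?s = \<S> \<times> packets ?sf" unfolding packets packets1 ..
    show "\<forall>n\<in>{1..N}. stored ?s n = {S \<in> \<S>. n \<in> S} \<times> packets ?sf"
      unfolding packets1 T.U.sel(6) using st by blast
    show "\<exists>len \<beta> \<sigma>. linear_with M K len \<beta> ?sf \<and> (\<forall>S\<in>\<S>. bij_betw (\<sigma> S) {1..M} S) \<and>
        (\<forall>\<theta>\<in>{1..K}.
           (\<forall>n\<in>{1..N}. \<forall>\<omega>\<in>space (sample ?s).
              query ?s \<theta> n \<omega> \<in> extensional {S \<in> \<S>. n \<in> S} \<and>
              answer ?s \<theta> n \<omega> \<in> extensional {S \<in> \<S>. n \<in> S}) \<and>
           (\<forall>S\<in>\<S>.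
              distr (sample ?s) (count_space UNIV) (\<lambda>\<omega>. \<lambda>m\<in>{1..M}. query ?s \<theta> (\<sigma> S m) \<omega> S) =
              distr (sample ?sf) (count_space UNIV) (all_queries M ?sf \<theta>)) \<and>
           prob_space.indep_vars (sample ?s) (\<lambda>_. count_space UNIV)
             (\<lambda>S \<omega>. \<lambda>m\<in>{1..M}. query ?s \<theta> (\<sigma> S m) \<omega> S) \<S> \<and>
           (\<forall>S\<in>\<S>. \<forall>m\<in>{1..M}. \<forall>\<omega>\<in>space (sample ?s).
              answer ?s \<theta> (\<sigma> S m) \<omega> S =
                lin_answer K len \<beta> (packets ?sf) (\<lambda>k i. packet ?s k (S, i) \<omega>) m
                  (query ?s \<theta> (\<sigma> S m) \<omega> S)))"
      by (rule exI[of _ "\<lambda>_ _. 1"], rule exI[of _ "T1.\<beta>"], rule exI[of _ \<sigma>])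
        (intro conjI ballI lin \<sigma> ext distr ans T.indep_query_vectors)
  qed (use weights sf achieving1 T.U.scheme_s sizes in blast)+
  have sub: "sub_packetization ?s = card \<S> * (M - 1)"
    unfolding sub_packetization_def packets by (simp only: card_cartesian_product card_atLeastLessThan)
  have "equal_size K ?s"
    unfolding equal_size_def
  proof (intro ballI)
    fix k z assume k: "k \<in> {1..K}" and z: "z \<in> packets ?s"
    then obtain S i where Si: "z = (S, i)" "S \<in> \<S>" "i \<in> {1..<M}" unfolding packets by blast
    have "ent ?s (packet ?s k z) = 1"
      using T.U.ent_packet_s[OF k z[unfolded T.U.sel(4)]] pos[OF Si(2,3)] Si(1) by simp
    moreover have "real (file_len ?s) / real (sub_packetization ?s) = 1"
      unfolding sub trans[OF T.U.sel(2) T.L_def] using T.L_pos unfolding T.L_def by simp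
    ultimately show "ent ?s (packet ?s k z) = real (file_len ?s) / real (sub_packetization ?s)" by simp
  qed
  moreover have "capacity_achieving \<mu> N K ?s"
    unfolding capacity_achieving_def capN by (rule T.rate_eq)
  moreover have "N * (M - 1) div gcd N M = sub_packetization ?s"
    unfolding sub \<S>(1) by (metis div_mult_swap gcd_dvd1 mult.commute)
  ultimately show ?thesis
    unfolding equal_size_sub_packetizations_def using linear by blast
qed

theorem theorem5:
  fixes \<mu> :: real and N K M :: nat
  assumes "K \<ge> 2" and "2 \<le> M" and "M \<le> N" and "\<mu> * real N = real M"
  shows "N * (M - 1) div gcd N M
           \<in> equal_size_sub_packetizations TYPE('f::{field,finite}) \<mu> N K M \<and>
         (\<forall>F \<in> equal_size_sub_packetizations TYPE('f) \<mu> N K M. N * (M - 1) div gcd N M \<le> F)"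
proof (intro conjI ballI)
  show "N * (M - 1) div gcd N M \<in> equal_size_sub_packetizations TYPE('f) \<mu> N K M"
    using assms by (rule sub_packetization_attained)
  have cap: "capacity TYPE('f) 1 M K = 1 / (1 + geo (K - 1) M)"
    using assms by (intro capacity_eq) auto
  fix F assume "F \<in> equal_size_sub_packetizations TYPE('f) \<mu> N K M"
  then obtain \<alpha> and sf :: "(nat, 'f, nat, nat, 'f list list) pir"
    and s :: "(nat, 'f, nat set \<times> nat, nat set \<Rightarrow> nat, nat set \<Rightarrow> 'f list list) pir"
    where "F = sub_packetization s" "linear_sf_sc_pir_scheme \<mu> N K M \<alpha> sf s" "equal_size K s"
    unfolding equal_size_sub_packetizations_def by blast
  then show "N * (M - 1) div gcd N M \<le> F"
    using sub_packetization_ge[OF assms cap] by simp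
qed

end
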